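(* Let $\mathcal{C}$ be a small category and let $\hat{\mathcal{C}} = [\mathcal{C}^{op},\mathbf{Set}]$ be its presheaf topos. Then there is an equivalence of categories $$\mathbf{KRegFrm}_{\hat{\mathcal{C}}} \simeq [\mathcal{C}^{op},\mathbf{KRegFrm}],$$ where $\mathbf{KRegFrm}_{\hat{\mathcal{C}}}$ is the category of internal compact regular frames in the topos $\hat{\mathcal{C}}$ (and internal frame homomorphisms), and $[\mathcal{C}^{op},\mathbf{KRegFrm}]$ is the category of functors $\mathcal{C}^{op}\to\mathbf{KRegFrm}$ and natural transformations.
   Context: A frame is a complete lattice in which finite meets distribute over arbitrary joins; frame homomorphisms preserve finite meets and arbitrary joins. In a distributive lattice write $a \triangleleft b$ if there exists $c$ with $a\wedge c = 0$ and $b \vee c = 1$. A frame $L$ is regular if $b = \bigvee\{b' \mid b' \triangleleft b\}$ for every $b \in L$. It is compact if every directed (in particular inhabited) subset of $L$ whose join is $1$ contains $1$. $\mathbf{KRegFrm}$ is the category of compact regular frames (in $\mathbf{Set}$) and frame homomorphisms. For a topos $\mathcal{T}$, $\mathbf{KRegFrm}_{\mathcal{T}}$ denotes the category obtained by interpreting these definitions in the internal logic of $\mathcal{T}$. Its objects are the internal posets $L$ of $\mathcal{T}$ which, internally, are frames (in particular the order-embedding of $L$ into its power object $P_{\mathcal{T}}L$, sending $a$ to its down-set, has an internal left adjoint $\bigvee : P_{\mathcal{T}}L \to L$) and which internally are compact (every directed, in particular inhabited, subset of $L$ whose join is $1$ contains $1$) and regular ($b = \bigvee\{b' \mid b' \triangleleft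 b\}$ for every $b \in L$). Its morphisms are the morphisms of $\mathcal{T}$ that internally preserve finite meets and arbitrary joins. For $\mathcal{T}=\hat{\mathcal{C}}$, an internal poset is the same as a functor from $\mathcal{C}^{op}$ to posets, and the internal logic is Kripke–Joyal semantics in the presheaf topos. *)

theory Defs
  imports "HOL-Algebra.Complete_Lattice" "HOL-Library.Equipollence" "HOL-Library.FuncSet"
begin

section \<open>Categories\<close>

text \<open>\<open>Cmp C g f\<close> is the composite \<open>g \<circ> f\<close>; it is only meaningful for \<open>Cod C f = Dom C g\<close>.\<close>

record ('o, 'a) category =
  Obj :: "'o set"
  Arr :: "'a set"
  Dom :: "'a \<Rightarrow> 'o"
  Cod :: "'a \<Rightarrow> 'o"
  Idt :: "'o \<Rightarrow> 'a"
  Cmp :: "'a \<Rightarrow> 'a \<Rightarrow> 'a"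

definition Hom :: "('o, 'a) category \<Rightarrow> 'o \<Rightarrow> 'o \<Rightarrow> 'a set" where
  "Hom C a b = {f \<in> Arr C. Dom C f = a \<and> Cod C f = b}"

definition is_category :: "('o, 'a) category \<Rightarrow> bool" where
  "is_category C \<longleftrightarrow>
     (\<forall>f\<in>Arr C. Dom C f \<in> Obj C \<and> Cod C f \<in> Obj C) \<and>
     (\<forall>a\<in>Obj C. Idt C a \<in> Hom C a a) \<and>
     (\<forall>f\<in>Arr C. \<forall>g\<in>Arr C. Cod C f = Dom C g \<longrightarrow> Cmp C g f \<in> Hom C (Dom C f) (Cod C g)) \<and>
     (\<forall>f\<in>Arr C. Cmp C f (Idt C (Dom C f)) = f \<and> Cmp C (Idt C (Cod C f)) f = f) \<and>
     (\<forall>f\<in>Arr C. \<forall>g\<in>Arr C. \<forall>h\<in>Arr C. Cod C f = Dom C g \<longrightarrow> Cod C g = Dom C h \<longrightarrow>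
        Cmp C h (Cmp C g f) = Cmp C (Cmp C h g) f)"

definition op_cat :: "('o, 'a) category \<Rightarrow> ('o, 'a) category" where
  "op_cat C = \<lparr>Obj = Obj C, Arr = Arr C, Dom = Cod C, Cod = Dom C, Idt = Idt C,
     Cmp = (\<lambda>g f. Cmp C f g)\<rparr>"

definition is_iso :: "('o, 'a) category \<Rightarrow> 'a \<Rightarrow> bool" where
  "is_iso C f \<longleftrightarrow> f \<in> Arr C \<and>
     (\<exists>g \<in> Hom C (Cod C f) (Dom C f).
        Cmp C g f = Idt C (Dom C f) \<and> Cmp C f g = Idt C (Cod C f))"

record ('o, 'a, 'p, 'b) fctr =
  FObj :: "'o \<Rightarrow> 'p"
  FArr :: "'a \<Rightarrow> 'b"

definition is_functor ::
  "('o, 'a) category \<Rightarrow> ('p, 'b) category \<Rightarrow> ('o, 'a, 'p, 'b) fctr \<Rightarrow> bool" where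
  "is_functor C D F \<longleftrightarrow>
     (\<forall>a\<in>Obj C. FObj F a \<in> Obj D) \<and>
     (\<forall>f\<in>Arr C. FArr F f \<in> Hom D (FObj F (Dom C f)) (FObj F (Cod C f))) \<and>
     (\<forall>a\<in>Obj C. FArr F (Idt C a) = Idt D (FObj F a)) \<and>
     (\<forall>f\<in>Arr C. \<forall>g\<in>Arr C. Cod C f = Dom C g \<longrightarrow>
        FArr F (Cmp C g f) = Cmp D (FArr F g) (FArr F f))"

definition id_fctr :: "('o, 'a, 'o, 'a) fctr" where
  "id_fctr = \<lparr>FObj = (\<lambda>a. a), FArr = (\<lambda>f. f)\<rparr>"

definition comp_fctr ::
  "('p, 'b, 'q, 'c) fctr \<Rightarrow> ('o, 'a, 'p, 'b) fctr \<Rightarrow> ('o, 'a, 'q, 'c) fctr" where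
  "comp_fctr G F = \<lparr>FObj = FObj G \<circ> FObj F, FArr = FArr G \<circ> FArr F\<rparr>"

definition is_nat_trans ::
  "('o, 'a) category \<Rightarrow> ('p, 'b) category \<Rightarrow> ('o, 'a, 'p, 'b) fctr \<Rightarrow>
     ('o, 'a, 'p, 'b) fctr \<Rightarrow> ('o \<Rightarrow> 'b) \<Rightarrow> bool" where
  "is_nat_trans C D F G \<eta> \<longleftrightarrow>
     (\<forall>a\<in>Obj C. \<eta> a \<in> Hom D (FObj F a) (FObj G a)) \<and>
     (\<forall>f\<in>Arr C. Cmp D (\<eta> (Cod C f)) (FArr F f) = Cmp D (FArr G f) (\<eta> (Dom C f)))"

definition naturally_isomorphic ::
  "('o, 'a) category \<Rightarrow> ('p, 'b) category \<Rightarrow> ('o, 'a, 'p, 'b) fctr \<Rightarrow>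
     ('o, 'a, 'p, 'b) fctr \<Rightarrow> bool" where
  "naturally_isomorphic C D F G \<longleftrightarrow>
     (\<exists>\<eta>. is_nat_trans C D F G \<eta> \<and> (\<forall>a\<in>Obj C. is_iso D (\<eta> a)))"

definition equivalent_categories :: "('o, 'a) category \<Rightarrow> ('p, 'b) category \<Rightarrow> bool" where
  "equivalent_categories C D \<longleftrightarrow>
     is_category C \<and> is_category D \<and>
     (\<exists>F G. is_functor C D F \<and> is_functor D C G \<and>
        naturally_isomorphic C C id_fctr (comp_fctr G F) \<and>
        naturally_isomorphic D D (comp_fctr F G) id_fctr)"

text \<open>Functors and natural transformations are made extensional, so that equality of arrows in
  the functor category is equality of natural transformations.\<close>

definition functor_category ::
  "('o, 'a) category \<Rightarrow> ('p, 'b) category \<Rightarrow>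
     (('o, 'a, 'p, 'b) fctr,
      ('o, 'a, 'p, 'b) fctr \<times> ('o \<Rightarrow> 'b) \<times> ('o, 'a, 'p, 'b) fctr) category" where
  "functor_category C D =
    (let Fun = {F. is_functor C D F \<and> FObj F \<in> extensional (Obj C) \<and> FArr F \<in> extensional (Arr C)}
     in \<lparr>Obj = Fun,
         Arr = {(F, \<eta>, G). F \<in> Fun \<and> G \<in> Fun \<and> is_nat_trans C D F G \<eta> \<and> \<eta> \<in> extensional (Obj C)},
         Dom = (\<lambda>(F, \<eta>, G). F),
         Cod = (\<lambda>(F, \<eta>, G). G),
         Idt = (\<lambda>F. (F, \<lambda>a\<in>Obj C. Idt D (FObj F a), F)),
         Cmp = (\<lambda>(G', \<beta>, H) (F, \<alpha>, G). (F, \<lambda>a\<in>Obj C. Cmp D (\<beta> a) (\<alpha> a), H))\<rparr>)"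


section \<open>Sets, smallness and presheaves\<close>

text \<open>
  ``Set'' is the category of members of a universe \<open>U\<close>. The closure conditions are those of a
  Grothendieck universe, read up to bijection because the members of \<open>U\<close> are sets over one type
  \<open>'u\<close>: if \<open>'u\<close> is a model of set theory, \<open>U\<close> may consist of the extensions of all its elements.
\<close>

definition set_universe :: "'u set set \<Rightarrow> bool" where
  "set_universe U \<longleftrightarrow>
     (\<forall>X\<in>U. \<forall>Y. Y \<subseteq> X \<longrightarrow> Y \<in> U) \<and>
     (\<forall>X\<in>U. \<exists>Y\<in>U. Y \<approx> Pow X) \<and>
     (\<forall>I\<in>U. \<forall>X. (\<forall>i\<in>I. X i \<in> U) \<longrightarrow> (\<exists>Y\<in>U. Y \<approx> Sigma I X))"

definition small_category :: "'u set set \<Rightarrow> ('o, 'a) category \<Rightarrow> bool" where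
  "small_category U C \<longleftrightarrow> is_category C \<and> (\<exists>X\<in>U. X \<approx> Obj C) \<and> (\<exists>X\<in>U. X \<approx> Arr C)"

type_synonym 'u set_arr = "'u set \<times> ('u \<Rightarrow> 'u) \<times> 'u set"

definition set_cat :: "'u set set \<Rightarrow> ('u set, 'u set_arr) category" where
  "set_cat U = \<lparr>Obj = U,
     Arr = {(A, f, B). A \<in> U \<and> B \<in> U \<and> f \<in> A \<rightarrow>\<^sub>E B},
     Dom = (\<lambda>(A, f, B). A),
     Cod = (\<lambda>(A, f, B). B),
     Idt = (\<lambda>A. (A, \<lambda>x\<in>A. x, A)),
     Cmp = (\<lambda>(B', g, D) (A, f, B). (A, compose A g f, D))\<rparr>"

definition set_arr_fun :: "'u set_arr \<Rightarrow> 'u \<Rightarrow> 'u" where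
  "set_arr_fun = (\<lambda>(A, f, B). f)"

type_synonym ('o, 'a, 'u) presheaf = "('o, 'a, 'u set, 'u set_arr) fctr"

type_synonym ('o, 'a, 'u) presheaf_arr =
  "('o, 'a, 'u) presheaf \<times> ('o \<Rightarrow> 'u set_arr) \<times> ('o, 'a, 'u) presheaf"

definition presheaf_topos ::
  "'u set set \<Rightarrow> ('o, 'a) category \<Rightarrow> (('o, 'a, 'u) presheaf, ('o, 'a, 'u) presheaf_arr) category"
  where "presheaf_topos U C = functor_category (op_cat C) (set_cat U)"

definition psh_restrict :: "('o, 'a, 'u) presheaf \<Rightarrow> 'a \<Rightarrow> 'u \<Rightarrow> 'u" where
  "psh_restrict X f = set_arr_fun (FArr X f)"

definition psh_map :: "('o, 'a, 'u) presheaf_arr \<Rightarrow> 'o \<Rightarrow> 'u \<Rightarrow> 'u" where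
  "psh_map = (\<lambda>(X, \<eta>, Y) c. set_arr_fun (\<eta> c))"

text \<open>The value at \<open>c\<close> of the power object of \<open>X\<close>: subpresheaves of \<open>y(c) \<times> X\<close>.\<close>

definition psh_power :: "('o, 'a) category \<Rightarrow> ('o, 'a, 'u) presheaf \<Rightarrow> 'o \<Rightarrow> ('a \<times> 'u) set set" where
  "psh_power C X c = {S.
     (\<forall>(f, x)\<in>S. f \<in> Arr C \<and> Cod C f = c \<and> x \<in> FObj X (Dom C f)) \<and>
     (\<forall>(f, x)\<in>S. \<forall>g\<in>Arr C. Cod C g = Dom C f \<longrightarrow> (Cmp C f g, psh_restrict X g x) \<in> S)}"

definition power_restrict ::
  "('o, 'a) category \<Rightarrow> 'a \<Rightarrow> ('a \<times> 'u) set \<Rightarrow> ('a \<times> 'u) set" where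
  "power_restrict C f S = {(g, x). g \<in> Arr C \<and> Cod C g = Dom C f \<and> (Cmp C f g, x) \<in> S}"


section \<open>The internal language of a presheaf with a binary relation\<close>

text \<open>
  Formulas about an object \<open>L\<close> of the presheaf topos with an internal relation \<open>\<le>\<close>. There are
  variables of sort \<open>L\<close> and, in a separate name space, variables of sort \<open>P L\<close> (the power object);
  both are named by natural numbers. \<open>FAllP\<close> quantifies over \<open>P L\<close>.
\<close>

datatype fm =
    FLe nat nat  (infix \<open>\<^bold>\<le>\<close> 60)
  | FEq nat nat  (infix \<open>\<^bold>=\<close> 60)
  | FMem nat nat  (infix \<open>\<^bold>\<in>\<close> 60)
  | FAnd fm fm  (infixr \<open>\<^bold>\<and>\<close> 45)
  | FImp fm fm  (infixr \<open>\<^bold>\<longrightarrow>\<close> 40)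
  | FAll nat fm
  | FEx nat fm
  | FAllP nat fm

definition FIff :: "fm \<Rightarrow> fm \<Rightarrow> fm"  (infix \<open>\<^bold>\<longleftrightarrow>\<close> 40) where
  "FIff p q = ((p \<^bold>\<longrightarrow> q) \<^bold>\<and> (q \<^bold>\<longrightarrow> p))"

type_synonym ('o, 'a, 'u) psh_rel = "('o, 'a, 'u) presheaf \<times> ('o \<Rightarrow> ('u \<times> 'u) set)"

text \<open>Kripke--Joyal semantics: \<open>forces C L c \<rho> \<sigma> p\<close> says that \<open>p\<close> holds at stage \<open>c\<close> for the
  generalized elements \<open>\<rho> n \<in> L(c)\<close> and \<open>\<sigma> n \<in> (P L)(c)\<close>.\<close>

fun forces ::
  "('o, 'a) category \<Rightarrow> ('o, 'a, 'u) psh_rel \<Rightarrow> 'o \<Rightarrow> (nat \<Rightarrow> 'u) \<Rightarrow> (nat \<Rightarrow> ('a \<times> 'u) set) \<Rightarrow>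
     fm \<Rightarrow> bool" where
  "forces C L c \<rho> \<sigma> (FLe x y) \<longleftrightarrow> (\<rho> x, \<rho> y) \<in> snd L c"
| "forces C L c \<rho> \<sigma> (FEq x y) \<longleftrightarrow> \<rho> x = \<rho> y"
| "forces C L c \<rho> \<sigma> (FMem x A) \<longleftrightarrow> (Idt C c, \<rho> x) \<in> \<sigma> A"
| "forces C L c \<rho> \<sigma> (FAnd p q) \<longleftrightarrow> forces C L c \<rho> \<sigma> p \<and> forces C L c \<rho> \<sigma> q"
| "forces C L c \<rho> \<sigma> (FImp p q) \<longleftrightarrow>
     (\<forall>f\<in>Arr C. Cod C f = c \<longrightarrow>
        forces C L (Dom C f) (psh_restrict (fst L) f \<circ> \<rho>) (power_restrict C f \<circ> \<sigma>) p \<longrightarrow>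
        forces C L (Dom C f) (psh_restrict (fst L) f \<circ> \<rho>) (power_restrict C f \<circ> \<sigma>) q)"
| "forces C L c \<rho> \<sigma> (FAll x p) \<longleftrightarrow>
     (\<forall>f\<in>Arr C. Cod C f = c \<longrightarrow> (\<forall>a\<in>FObj (fst L) (Dom C f).
        forces C L (Dom C f) ((psh_restrict (fst L) f \<circ> \<rho>)(x := a)) (power_restrict C f \<circ> \<sigma>) p))"
| "forces C L c \<rho> \<sigma> (FEx x p) \<longleftrightarrow>
     (\<exists>a\<in>FObj (fst L) c. forces C L c (\<rho>(x := a)) \<sigma> p)"
| "forces C L c \<rho> \<sigma> (FAllP A p) \<longleftrightarrow>
     (\<forall>f\<in>Arr C. Cod C f = c \<longrightarrow> (\<forall>S\<in>psh_power C (fst L) (Dom C f).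
        forces C L (Dom C f) (psh_restrict (fst L) f \<circ> \<rho>) ((power_restrict C f \<circ> \<sigma>)(A := S)) p))"

text \<open>Validity of a closed formula; the valuations \<open>\<rho>\<close>, \<open>\<sigma>\<close> are then irrelevant.\<close>

definition valid :: "('o, 'a) category \<Rightarrow> ('o, 'a, 'u) psh_rel \<Rightarrow> fm \<Rightarrow> bool" where
  "valid C L p \<longleftrightarrow> (\<forall>c\<in>Obj C. \<forall>\<rho> \<sigma>. forces C L c \<rho> \<sigma> p)"

text \<open>In the following formulas the parameters are variable names, and the bound variables are
  chosen different from the parameters. Operations are expressed by their graphs:
  \<open>fm_meet a b m\<close> says \<open>m = a \<and> b\<close>, and \<open>fm_Join A s\<close> says \<open>s = \<Or>A\<close>.\<close>

definition fm_top :: "nat \<Rightarrow> fm" where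
  "fm_top t = (let x = t + 1 in FAll x (x \<^bold>\<le> t))"

definition fm_bot :: "nat \<Rightarrow> fm" where
  "fm_bot z = (let x = z + 1 in FAll x (z \<^bold>\<le> x))"

definition fm_meet :: "nat \<Rightarrow> nat \<Rightarrow> nat \<Rightarrow> fm" where
  "fm_meet a b m = (let x = a + b + m + 1 in
     m \<^bold>\<le> a \<^bold>\<and> m \<^bold>\<le> b \<^bold>\<and> FAll x (x \<^bold>\<le> a \<^bold>\<and> x \<^bold>\<le> b \<^bold>\<longrightarrow> x \<^bold>\<le> m))"

definition fm_join :: "nat \<Rightarrow> nat \<Rightarrow> nat \<Rightarrow> fm" where
  "fm_join a b j = (let x = a + b + j + 1 in
     a \<^bold>\<le> j \<^bold>\<and> b \<^bold>\<le> j \<^bold>\<and> FAll x (a \<^bold>\<le> x \<^bold>\<and> b \<^bold>\<le> x \<^bold>\<longrightarrow> j \<^bold>\<le> x))"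

definition fm_Join :: "nat \<Rightarrow> nat \<Rightarrow> fm" where
  "fm_Join A s = (let x = s + 1; u = s + 2 in
     FAll x (x \<^bold>\<in> A \<^bold>\<longrightarrow> x \<^bold>\<le> s) \<^bold>\<and>
     FAll u (FAll x (x \<^bold>\<in> A \<^bold>\<longrightarrow> x \<^bold>\<le> u) \<^bold>\<longrightarrow> s \<^bold>\<le> u))"

definition fm_well_inside :: "nat \<Rightarrow> nat \<Rightarrow> fm" where
  "fm_well_inside a b = (let c = a + b + 1; z = a + b + 2; t = a + b + 3 in
     FEx c (FEx z (FEx t (fm_bot z \<^bold>\<and> fm_top t \<^bold>\<and> fm_meet a c z \<^bold>\<and> fm_join b c t))))"

definition fm_directed :: "nat \<Rightarrow> fm" where
  "fm_directed A =
     (FEx 0 (0 \<^bold>\<in> A) \<^bold>\<and>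
      FAll 0 (FAll 1 (0 \<^bold>\<in> A \<^bold>\<and> 1 \<^bold>\<in> A \<^bold>\<longrightarrow> FEx 2 (2 \<^bold>\<in> A \<^bold>\<and> 0 \<^bold>\<le> 2 \<^bold>\<and> 1 \<^bold>\<le> 2))))"

definition fm_poset :: fm where
  "fm_poset =
     (FAll 0 (0 \<^bold>\<le> 0) \<^bold>\<and>
      FAll 0 (FAll 1 (0 \<^bold>\<le> 1 \<^bold>\<and> 1 \<^bold>\<le> 0 \<^bold>\<longrightarrow> 0 \<^bold>= 1)) \<^bold>\<and>
      FAll 0 (FAll 1 (FAll 2 (0 \<^bold>\<le> 1 \<^bold>\<and> 1 \<^bold>\<le> 2 \<^bold>\<longrightarrow> 0 \<^bold>\<le> 2))))"

definition fm_complete :: fm where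
  "fm_complete = FAllP 0 (FEx 0 (fm_Join 0 0))"

text \<open>With \<open>A = 0\<close>, \<open>B = 1\<close> (sort \<open>P L\<close>) and \<open>a = 0\<close>, \<open>s = 1\<close>, \<open>m = 2\<close> (sort \<open>L\<close>):
  if \<open>s = \<Or>A\<close>, \<open>m = a \<and> s\<close> and \<open>B = {a \<and> x | x \<in> A}\<close>, then \<open>m = \<Or>B\<close>.\<close>

definition fm_distrib :: fm where
  "fm_distrib = FAllP 0 (FAll 0 (FAll 1 (FAll 2 (fm_Join 0 1 \<^bold>\<and> fm_meet 0 1 2 \<^bold>\<longrightarrow>
     FAllP 1 (FAll 3 (3 \<^bold>\<in> 1 \<^bold>\<longleftrightarrow> FEx 4 (4 \<^bold>\<in> 0 \<^bold>\<and> fm_meet 0 4 3)) \<^bold>\<longrightarrow> fm_Join 1 2)))))"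

definition fm_frame :: fm where
  "fm_frame = (fm_poset \<^bold>\<and> fm_complete \<^bold>\<and> fm_distrib)"

definition fm_compact :: fm where
  "fm_compact = FAllP 0 (FAll 0 (fm_directed 0 \<^bold>\<and> fm_top 0 \<^bold>\<and> fm_Join 0 0 \<^bold>\<longrightarrow> 0 \<^bold>\<in> 0))"

definition fm_regular :: fm where
  "fm_regular = FAll 0 (FAllP 0 (FAll 1 (1 \<^bold>\<in> 0 \<^bold>\<longleftrightarrow> fm_well_inside 1 0) \<^bold>\<longrightarrow> fm_Join 0 0))"


section \<open>Internal compact regular frames in the presheaf topos\<close>

definition internal_kreg_frame ::
  "'u set set \<Rightarrow> ('o, 'a) category \<Rightarrow> ('o, 'a, 'u) psh_rel \<Rightarrow> bool" where
  "internal_kreg_frame U C L \<longleftrightarrow>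
     fst L \<in> Obj (presheaf_topos U C) \<and>
     (\<forall>c\<in>Obj C. snd L c \<subseteq> FObj (fst L) c \<times> FObj (fst L) c) \<and>
     (\<forall>f\<in>Arr C. \<forall>(x, y)\<in>snd L (Cod C f).
        (psh_restrict (fst L) f x, psh_restrict (fst L) f y) \<in> snd L (Dom C f)) \<and>
     valid C L fm_frame \<and> valid C L fm_compact \<and> valid C L fm_regular"

text \<open>The internal statements \<open>\<forall>x. p(x) \<longrightarrow> q(\<alpha> x)\<close> that \<open>\<alpha>\<close> preserves the top element, binary
  meets and joins, spelled out by Kripke--Joyal; such a statement is valid iff at every stage each
  generalized element satisfying \<open>p\<close> satisfies \<open>q \<circ> \<alpha>\<close>. The direct image of \<open>S \<in> (P L)(c)\<close> is
  \<open>{(f, \<alpha> x) | (f, x) \<in> S}\<close>.\<close>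

definition internal_frame_hom ::
  "('o, 'a) category \<Rightarrow> ('o, 'a, 'u) psh_rel \<Rightarrow> ('o, 'a, 'u) psh_rel \<Rightarrow>
     ('o, 'a, 'u) presheaf_arr \<Rightarrow> bool" where
  "internal_frame_hom C L M \<alpha> \<longleftrightarrow>
     (\<forall>c\<in>Obj C. \<forall>\<rho> \<sigma>. (\<forall>n. \<rho> n \<in> FObj (fst L) c) \<longrightarrow> (\<forall>n. \<sigma> n \<in> psh_power C (fst L) c) \<longrightarrow>
       (let \<rho>' = psh_map \<alpha> c \<circ> \<rho>;
            \<sigma>' = (\<lambda>n. (\<lambda>(f, x). (f, psh_map \<alpha> (Dom C f) x)) ` \<sigma> n)
        in (forces C L c \<rho> \<sigma> (fm_top 0) \<longrightarrow> forces C M c \<rho>' \<sigma>' (fm_top 0)) \<and>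
           (forces C L c \<rho> \<sigma> (fm_meet 0 1 2) \<longrightarrow> forces C M c \<rho>' \<sigma>' (fm_meet 0 1 2)) \<and>
           (forces C L c \<rho> \<sigma> (fm_Join 0 0) \<longrightarrow> forces C M c \<rho>' \<sigma>' (fm_Join 0 0))))"

definition internal_kreg_frm ::
  "'u set set \<Rightarrow> ('o, 'a) category \<Rightarrow>
     (('o, 'a, 'u) psh_rel,
      ('o, 'a, 'u) psh_rel \<times> ('o, 'a, 'u) presheaf_arr \<times> ('o, 'a, 'u) psh_rel) category" where
  "internal_kreg_frm U C =
     \<lparr>Obj = {L. internal_kreg_frame U C L},
      Arr = {(L, \<alpha>, M). internal_kreg_frame U C L \<and> internal_kreg_frame U C M \<and>
               \<alpha> \<in> Hom (presheaf_topos U C) (fst L) (fst M) \<and> internal_frame_hom C L M \<alpha>},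
      Dom = (\<lambda>(L, \<alpha>, M). L),
      Cod = (\<lambda>(L, \<alpha>, M). M),
      Idt = (\<lambda>L. (L, Idt (presheaf_topos U C) (fst L), L)),
      Cmp = (\<lambda>(M', \<beta>, N) (L, \<alpha>, M). (L, Cmp (presheaf_topos U C) \<beta> \<alpha>, N))\<rparr>"


section \<open>Compact regular frames\<close>

definition is_frame :: "'u gorder \<Rightarrow> bool" where
  "is_frame L \<longleftrightarrow> complete_lattice L \<and>
     (\<forall>a\<in>carrier L. \<forall>A. A \<subseteq> carrier L \<longrightarrow> a \<sqinter>\<^bsub>L\<^esub> (\<Squnion>\<^bsub>L\<^esub> A) = \<Squnion>\<^bsub>L\<^esub> ((\<lambda>x. a \<sqinter>\<^bsub>L\<^esub> x) ` A))"

definition well_inside :: "'u gorder \<Rightarrow> 'u \<Rightarrow> 'u \<Rightarrow> bool" where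
  "well_inside L a b \<longleftrightarrow> (\<exists>c\<in>carrier L. a \<sqinter>\<^bsub>L\<^esub> c = \<bottom>\<^bsub>L\<^esub> \<and> b \<squnion>\<^bsub>L\<^esub> c = \<top>\<^bsub>L\<^esub>)"

definition regular_frame :: "'u gorder \<Rightarrow> bool" where
  "regular_frame L \<longleftrightarrow> (\<forall>b\<in>carrier L. b = \<Squnion>\<^bsub>L\<^esub> {b' \<in> carrier L. well_inside L b' b})"

definition directed_in :: "'u gorder \<Rightarrow> 'u set \<Rightarrow> bool" where
  "directed_in L A \<longleftrightarrow> A \<noteq> {} \<and> (\<forall>a\<in>A. \<forall>b\<in>A. \<exists>d\<in>A. a \<sqsubseteq>\<^bsub>L\<^esub> d \<and> b \<sqsubseteq>\<^bsub>L\<^esub> d)"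

definition compact_frame :: "'u gorder \<Rightarrow> bool" where
  "compact_frame L \<longleftrightarrow>
     (\<forall>A. A \<subseteq> carrier L \<longrightarrow> directed_in L A \<longrightarrow> \<Squnion>\<^bsub>L\<^esub> A = \<top>\<^bsub>L\<^esub> \<longrightarrow> \<top>\<^bsub>L\<^esub> \<in> A)"

definition frame_hom :: "'u gorder \<Rightarrow> 'u gorder \<Rightarrow> ('u \<Rightarrow> 'u) \<Rightarrow> bool" where
  "frame_hom L M h \<longleftrightarrow>
     h \<top>\<^bsub>L\<^esub> = \<top>\<^bsub>M\<^esub> \<and>
     (\<forall>a\<in>carrier L. \<forall>b\<in>carrier L. h (a \<sqinter>\<^bsub>L\<^esub> b) = h a \<sqinter>\<^bsub>M\<^esub> h b) \<and>
     (\<forall>A. A \<subseteq> carrier L \<longrightarrow> h (\<Squnion>\<^bsub>L\<^esub> A) = \<Squnion>\<^bsub>M\<^esub> (h ` A))"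

definition kreg_frm :: "'u set set \<Rightarrow> ('u gorder, 'u gorder \<times> ('u \<Rightarrow> 'u) \<times> 'u gorder) category" where
  "kreg_frm U =
    (let KReg = {L. carrier L \<in> U \<and> is_frame L \<and> compact_frame L \<and> regular_frame L}
     in \<lparr>Obj = KReg,
         Arr = {(L, h, M). L \<in> KReg \<and> M \<in> KReg \<and> h \<in> carrier L \<rightarrow>\<^sub>E carrier M \<and> frame_hom L M h},
         Dom = (\<lambda>(L, h, M). L),
         Cod = (\<lambda>(L, h, M). M),
         Idt = (\<lambda>L. (L, \<lambda>x\<in>carrier L. x, L)),
         Cmp = (\<lambda>(M', k, N) (L, h, M). (L, compose (carrier L) k h, N))\<rparr>)"

end

theory Submission
  imports Defs
begin

text \<open>
  The equivalence is not computed stagewise: for an internal compact regular frame \<open>L\<close> the stage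
  \<open>L(c)\<close> is a compact frame but in general not a regular one, because the internal join
  \<open>b = \<Or>{x | x \<triangleleft> b}\<close> runs over elements at all stages above \<open>c\<close>. Compactness, applied
  to the internally directed set \<open>{x \<or> w | x \<triangleleft> u}\<close>, shows that \<open>L(c)\<close> is normal, and hence
  that its elements of the form \<open>u = \<Or>{v \<in> L(c) | v \<triangleleft> u}\<close> make up a compact regular
  subframe \<open>K(c)\<close>. The functor \<open>L \<mapsto> K\<close> is the equivalence.

  \<open>L\<close> is recovered from \<open>K\<close> as the presheaf of lax families: \<open>u \<in> L(c)\<close> is determined by the
  regular interiors of all its restrictions, and every family \<open>(u\<^sub>f)\<close> with \<open>g\<^sup>* u\<^sub>f \<le> u\<^bsub>fg\<^esub>\<close>
  arises from its internal join. Here compactness enters again: if that join \<open>u\<close> satisfies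
  \<open>u \<or> w = 1\<close>, then the directed set \<open>{y \<or> f\<^sup>* w | y \<le> u\<^sub>f}\<close> has join \<open>1\<close>, so already
  \<open>u\<^bsub>id\<^esub> \<or> w = 1\<close>. Internal joins of lax families are computed pointwise in \<open>K\<close>,
  so that homomorphisms and the frame axioms transfer in both directions.
\<close>


section \<open>Categories and equivalences\<close>

lemma HomI: "f \<in> Arr C \<Longrightarrow> Dom C f = a \<Longrightarrow> Cod C f = b \<Longrightarrow> f \<in> Hom C a b"
  by (simp add: Hom_def)

lemma HomD:
  assumes "f \<in> Hom C a b"
  shows "f \<in> Arr C" "Dom C f = a" "Cod C f = b"
  using assms by (auto simp: Hom_def)

locale cat =
  fixes C :: "('o, 'a) category"
  assumes is_category: "is_category C"
begin

lemma dom_obj [simp, intro]: "f \<in> Arr C \<Longrightarrow> Dom C f \<in> Obj C"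
  and cod_obj [simp, intro]: "f \<in> Arr C \<Longrightarrow> Cod C f \<in> Obj C"
  using is_category by (auto simp: is_category_def)

lemma Hom_obj:
  assumes "f \<in> Hom C a b"
  shows "a \<in> Obj C" "b \<in> Obj C"
  using HomD[OF assms] by auto

lemma id_hom [intro]: "a \<in> Obj C \<Longrightarrow> Idt C a \<in> Hom C a a"
  using is_category by (auto simp: is_category_def)

lemma id_arr [simp]:
  assumes "a \<in> Obj C"
  shows "Idt C a \<in> Arr C" "Dom C (Idt C a) = a" "Cod C (Idt C a) = a"
  using id_hom[OF assms] by (auto simp: Hom_def)

lemma comp_hom [intro]: "f \<in> Hom C a b \<Longrightarrow> g \<in> Hom C b d \<Longrightarrow> Cmp C g f \<in> Hom C a d"
  using is_category by (auto simp: is_category_def Hom_def)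

lemma comp_arr [simp]:
  assumes "f \<in> Arr C" "g \<in> Arr C" "Cod C f = Dom C g"
  shows "Cmp C g f \<in> Arr C" "Dom C (Cmp C g f) = Dom C f" "Cod C (Cmp C g f) = Cod C g"
  using comp_hom[of f "Dom C f" "Dom C g" g "Cod C g"] assms by (auto simp: Hom_def)

lemma comp_id_right [simp]: "f \<in> Arr C \<Longrightarrow> a = Dom C f \<Longrightarrow> Cmp C f (Idt C a) = f"
  and comp_id_left [simp]: "f \<in> Arr C \<Longrightarrow> b = Cod C f \<Longrightarrow> Cmp C (Idt C b) f = f"
  using is_category by (auto simp: is_category_def)

lemma comp_assoc:
  assumes "f \<in> Hom C a b" "g \<in> Hom C b d" "h \<in> Hom C d e"
  shows "Cmp C (Cmp C h g) f = Cmp C h (Cmp C g f)"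
  using is_category assms by (auto simp: is_category_def Hom_def)

lemma is_isoI:
  assumes "f \<in> Hom C a b" "g \<in> Hom C b a" "Cmp C g f = Idt C a" "Cmp C f g = Idt C b"
  shows "is_iso C f"
  using assms by (auto simp: is_iso_def Hom_def)

definition inv_arr :: "'a \<Rightarrow> 'a" where
  "inv_arr f = (SOME g. g \<in> Hom C (Cod C f) (Dom C f) \<and>
     Cmp C g f = Idt C (Dom C f) \<and> Cmp C f g = Idt C (Cod C f))"

lemma
  assumes "is_iso C f" "f \<in> Hom C a b"
  shows inv_arr_hom: "inv_arr f \<in> Hom C b a"
    and comp_inv_left: "Cmp C (inv_arr f) f = Idt C a"
    and comp_inv_right: "Cmp C f (inv_arr f) = Idt C b"
proof -
  have "\<exists>g. g \<in> Hom C (Cod C f) (Dom C f) \<and>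
      Cmp C g f = Idt C (Dom C f) \<and> Cmp C f g = Idt C (Cod C f)"
    using assms(1) by (auto simp: is_iso_def)
  from someI_ex[OF this] show "inv_arr f \<in> Hom C b a" "Cmp C (inv_arr f) f = Idt C a"
    "Cmp C f (inv_arr f) = Idt C b"
    unfolding inv_arr_def[symmetric] using HomD(2,3)[OF assms(2)] by simp_all
qed

lemma iso_comp_inv_comp:
  assumes "is_iso C f" "f \<in> Hom C a b" "x \<in> Hom C z b"
  shows "Cmp C f (Cmp C (inv_arr f) x) = x"
  using comp_assoc[OF assms(3) inv_arr_hom[OF assms(1,2)] assms(2)]
    comp_inv_right[OF assms(1,2)] HomD[OF assms(3)] by simp

lemma iso_cancel_left:
  assumes "is_iso C f" "f \<in> Hom C a b" "x \<in> Hom C z a" "y \<in> Hom C z a" "Cmp C f x = Cmp C f y"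
  shows "x = y"
proof -
  have "Cmp C (inv_arr f) (Cmp C f t) = t" if "t \<in> Hom C z a" for t
    using comp_assoc[OF that assms(2) inv_arr_hom[OF assms(1,2)]] comp_inv_left[OF assms(1,2)]
      HomD[OF that] by simp
  then show ?thesis using assms(3-5) by metis
qed

end

lemma is_categoryI:
  assumes "\<And>f. f \<in> Arr C \<Longrightarrow> Dom C f \<in> Obj C \<and> Cod C f \<in> Obj C"
    and "\<And>a. a \<in> Obj C \<Longrightarrow> Idt C a \<in> Hom C a a"
    and "\<And>f g. f \<in> Arr C \<Longrightarrow> g \<in> Arr C \<Longrightarrow> Cod C f = Dom C g \<Longrightarrow>
           Cmp C g f \<in> Hom C (Dom C f) (Cod C g)"
    and "\<And>f. f \<in> Arr C \<Longrightarrow> Cmp C f (Idt C (Dom C f)) = f \<and> Cmp C (Idt C (Cod C f)) f = f"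
    and "\<And>f g h. f \<in> Arr C \<Longrightarrow> g \<in> Arr C \<Longrightarrow> h \<in> Arr C \<Longrightarrow> Cod C f = Dom C g \<Longrightarrow>
           Cod C g = Dom C h \<Longrightarrow> Cmp C h (Cmp C g f) = Cmp C (Cmp C h g) f"
  shows "is_category C"
  unfolding is_category_def using assms by blast

lemma op_cat_simps [simp]:
  "Obj (op_cat C) = Obj C" "Arr (op_cat C) = Arr C" "Dom (op_cat C) = Cod C"
  "Cod (op_cat C) = Dom C" "Idt (op_cat C) = Idt C" "Cmp (op_cat C) g f = Cmp C f g"
  by (simp_all add: op_cat_def)

lemma is_category_op_cat: "is_category C \<Longrightarrow> is_category (op_cat C)"
  by (auto simp: is_category_def Hom_def)

lemma is_functorD:
  assumes "is_functor C D F"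
  shows "a \<in> Obj C \<Longrightarrow> FObj F a \<in> Obj D"
    and "f \<in> Hom C a b \<Longrightarrow> FArr F f \<in> Hom D (FObj F a) (FObj F b)"
    and "a \<in> Obj C \<Longrightarrow> FArr F (Idt C a) = Idt D (FObj F a)"
    and "f \<in> Hom C a b \<Longrightarrow> g \<in> Hom C b c \<Longrightarrow> FArr F (Cmp C g f) = Cmp D (FArr F g) (FArr F f)"
  using assms by (auto simp: is_functor_def Hom_def)

lemma is_nat_transD:
  assumes "is_nat_trans C D F G \<eta>"
  shows "a \<in> Obj C \<Longrightarrow> \<eta> a \<in> Hom D (FObj F a) (FObj G a)"
    and "f \<in> Hom C a b \<Longrightarrow> Cmp D (\<eta> b) (FArr F f) = Cmp D (FArr G f) (\<eta> a)"
  using assms by (auto simp: is_nat_trans_def Hom_def)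

lemma Obj_functor_category:
  "F \<in> Obj (functor_category C D) \<longleftrightarrow>
     is_functor C D F \<and> FObj F \<in> extensional (Obj C) \<and> FArr F \<in> extensional (Arr C)"
  by (simp add: functor_category_def Let_def)

lemma Arr_functor_category:
  "(F, \<eta>, G) \<in> Arr (functor_category C D) \<longleftrightarrow>
     F \<in> Obj (functor_category C D) \<and> G \<in> Obj (functor_category C D) \<and>
     is_nat_trans C D F G \<eta> \<and> \<eta> \<in> extensional (Obj C)"
  by (simp add: functor_category_def Let_def)

lemma functor_category_simps [simp]:
  "Dom (functor_category C D) (F, \<eta>, G) = F"
  "Cod (functor_category C D) (F, \<eta>, G) = G"
  "Idt (functor_category C D) F = (F, \<lambda>a\<in>Obj C. Idt D (FObj F a), F)"
  "Cmp (functor_category C D) (G', \<beta>, H) (F, \<alpha>, G) = (F, \<lambda>a\<in>Obj C. Cmp D (\<beta> a) (\<alpha> a), H)"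
  by (simp_all add: functor_category_def Let_def)

lemma Hom_functor_category:
  "t \<in> Hom (functor_category C D) F G \<longleftrightarrow>
     (\<exists>\<eta>. t = (F, \<eta>, G) \<and> F \<in> Obj (functor_category C D) \<and> G \<in> Obj (functor_category C D) \<and>
        is_nat_trans C D F G \<eta> \<and> \<eta> \<in> extensional (Obj C))"
  by (cases t) (auto simp: Hom_def Arr_functor_category)

lemma nat_trans_id:
  assumes "is_category C" "is_category D" "is_functor C D F"
  shows "is_nat_trans C D F F (\<lambda>a\<in>Obj C. Idt D (FObj F a))"
proof -
  interpret C: cat C by standard fact
  interpret D: cat D by standard fact
  have "FArr F f \<in> Hom D (FObj F (Dom C f)) (FObj F (Cod C f))" if "f \<in> Arr C" for f
    using is_functorD(2)[OF assms(3)] that by (simp add: Hom_def)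
  then show ?thesis
    using is_functorD(1)[OF assms(3)] by (auto simp: is_nat_trans_def Hom_def)
qed

lemma nat_trans_comp:
  assumes "is_category C" "is_category D" "is_functor C D F" "is_functor C D G" "is_functor C D H"
    and \<alpha>_nat: "is_nat_trans C D F G \<alpha>" and \<beta>_nat: "is_nat_trans C D G H \<beta>"
  shows "is_nat_trans C D F H (\<lambda>a\<in>Obj C. Cmp D (\<beta> a) (\<alpha> a))"
  unfolding is_nat_trans_def
proof (intro conjI ballI)
  interpret C: cat C by standard fact
  interpret D: cat D by standard fact
  fix a assume "a \<in> Obj C"
  then show "(\<lambda>a\<in>Obj C. Cmp D (\<beta> a) (\<alpha> a)) a \<in> Hom D (FObj F a) (FObj H a)"
    using is_nat_transD(1)[OF \<alpha>_nat] is_nat_transD(1)[OF \<beta>_nat] by auto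
next
  interpret C: cat C by standard fact
  interpret D: cat D by standard fact
  fix f assume "f \<in> Arr C"
  then obtain a b where f_hom: "f \<in> Hom C a b" by (auto simp: Hom_def)
  note obj = C.Hom_obj[OF f_hom]
  note \<alpha>_hom = is_nat_transD(1)[OF \<alpha>_nat] and \<beta>_hom = is_nat_transD(1)[OF \<beta>_nat]
  note F_f = is_functorD(2)[OF assms(3) f_hom] and G_f = is_functorD(2)[OF assms(4) f_hom]
    and H_f = is_functorD(2)[OF assms(5) f_hom]
  have "Cmp D (Cmp D (\<beta> b) (\<alpha> b)) (FArr F f) = Cmp D (\<beta> b) (Cmp D (\<alpha> b) (FArr F f))"
    by (rule D.comp_assoc[OF F_f \<alpha>_hom[OF obj(2)] \<beta>_hom[OF obj(2)]])
  also have "\<dots> = Cmp D (\<beta> b) (Cmp D (FArr G f) (\<alpha> a))"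
    by (simp add: is_nat_transD(2)[OF \<alpha>_nat f_hom])
  also have "\<dots> = Cmp D (Cmp D (\<beta> b) (FArr G f)) (\<alpha> a)"
    by (rule D.comp_assoc[OF \<alpha>_hom[OF obj(1)] G_f \<beta>_hom[OF obj(2)], symmetric])
  also have "\<dots> = Cmp D (Cmp D (FArr H f) (\<beta> a)) (\<alpha> a)"
    by (simp add: is_nat_transD(2)[OF \<beta>_nat f_hom])
  also have "\<dots> = Cmp D (FArr H f) (Cmp D (\<beta> a) (\<alpha> a))"
    by (rule D.comp_assoc[OF \<alpha>_hom[OF obj(1)] \<beta>_hom[OF obj(1)] H_f])
  finally show "Cmp D ((\<lambda>a\<in>Obj C. Cmp D (\<beta> a) (\<alpha> a)) (Cod C f)) (FArr F f) =
      Cmp D (FArr H f) ((\<lambda>a\<in>Obj C. Cmp D (\<beta> a) (\<alpha> a)) (Dom C f))"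
    using obj HomD[OF f_hom] by simp
qed

lemma is_category_functor_category:
  assumes "is_category C" "is_category D"
  shows "is_category (functor_category C D)"
proof (rule is_categoryI)
  interpret C: cat C by standard fact
  interpret D: cat D by standard fact
  let ?FC = "functor_category C D"
  show "Dom ?FC t \<in> Obj ?FC \<and> Cod ?FC t \<in> Obj ?FC" if "t \<in> Arr ?FC" for t
    using that by (cases t) (auto simp: Arr_functor_category)
  show "Idt ?FC F \<in> Hom ?FC F F" if "F \<in> Obj ?FC" for F
    using that nat_trans_id[OF assms, of F]
    by (auto simp: Hom_functor_category Obj_functor_category)
  show "Cmp ?FC t s \<in> Hom ?FC (Dom ?FC s) (Cod ?FC t)"
    if "s \<in> Arr ?FC" "t \<in> Arr ?FC" "Cod ?FC s = Dom ?FC t" for s t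
    using that by (cases s, cases t)
      (auto simp: Arr_functor_category Hom_functor_category Obj_functor_category
        intro: nat_trans_comp[OF assms])
  show "Cmp ?FC t (Idt ?FC (Dom ?FC t)) = t \<and> Cmp ?FC (Idt ?FC (Cod ?FC t)) t = t"
    if "t \<in> Arr ?FC" for t
    using that is_nat_transD(1)
    by (cases t) (fastforce simp: Arr_functor_category extensional_def fun_eq_iff Hom_def)
  show "Cmp ?FC u (Cmp ?FC t s) = Cmp ?FC (Cmp ?FC u t) s"
    if arrs: "s \<in> Arr ?FC" "t \<in> Arr ?FC" "u \<in> Arr ?FC"
      and composable: "Cod ?FC s = Dom ?FC t" "Cod ?FC t = Dom ?FC u" for s t u
  proof -
    obtain F \<alpha> G \<beta> H \<gamma> I where eq: "s = (F, \<alpha>, G)" "t = (G, \<beta>, H)" "u = (H, \<gamma>, I)"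
      using composable by (cases s, cases t, cases u) auto
    then have "Cmp D (\<gamma> a) (Cmp D (\<beta> a) (\<alpha> a)) = Cmp D (Cmp D (\<gamma> a) (\<beta> a)) (\<alpha> a)"
      if "a \<in> Obj C" for a
      using arrs is_nat_transD(1)[OF _ that] D.comp_assoc
      by (metis (no_types, lifting) Arr_functor_category)
    then show ?thesis by (auto simp: eq restrict_def fun_eq_iff)
  qed
qed

lemma nat_trans_inverse:
  assumes "is_category C" "is_category D" and F_functor: "is_functor C D F"
    and G_functor: "is_functor C D G"
    and \<eta>_nat: "is_nat_trans C D F G \<eta>" and iso: "\<And>a. a \<in> Obj C \<Longrightarrow> is_iso D (\<eta> a)"
  shows "is_nat_trans C D G F (\<lambda>a\<in>Obj C. cat.inv_arr D (\<eta> a))"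
  unfolding is_nat_trans_def
proof (intro conjI ballI)
  interpret D: cat D by standard fact
  fix a assume "a \<in> Obj C"
  then show "(\<lambda>a\<in>Obj C. D.inv_arr (\<eta> a)) a \<in> Hom D (FObj G a) (FObj F a)"
    using D.inv_arr_hom[OF iso is_nat_transD(1)[OF \<eta>_nat]] by simp
next
  interpret C: cat C by standard fact
  interpret D: cat D by standard fact
  fix f assume "f \<in> Arr C"
  then obtain a b where f_hom: "f \<in> Hom C a b" by (auto simp: Hom_def)
  note obj = C.Hom_obj[OF f_hom] and F_f = is_functorD(2)[OF F_functor f_hom]
    and G_f = is_functorD(2)[OF G_functor f_hom]
  note \<eta>_hom = is_nat_transD(1)[OF \<eta>_nat] and inv = D.inv_arr_hom[OF iso is_nat_transD(1)[OF \<eta>_nat]]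
  have "Cmp D (D.inv_arr (\<eta> b)) (FArr G f) = Cmp D (FArr F f) (D.inv_arr (\<eta> a))"
  proof (rule D.iso_cancel_left[OF iso \<eta>_hom])
    have "Cmp D (\<eta> b) (Cmp D (FArr F f) (D.inv_arr (\<eta> a))) =
        Cmp D (FArr G f) (Cmp D (\<eta> a) (D.inv_arr (\<eta> a)))"
      using D.comp_assoc[OF inv[OF obj(1) obj(1)] F_f \<eta>_hom[OF obj(2)]]
        D.comp_assoc[OF inv[OF obj(1) obj(1)] \<eta>_hom[OF obj(1)] G_f] is_nat_transD(2)[OF \<eta>_nat f_hom]
      by simp
    also have "\<dots> = FArr G f"
      using D.comp_inv_right[OF iso \<eta>_hom] obj(1) HomD[OF G_f] by simp
    also have "\<dots> = Cmp D (\<eta> b) (Cmp D (D.inv_arr (\<eta> b)) (FArr G f))"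
      using D.iso_comp_inv_comp[OF iso \<eta>_hom G_f] obj(2) by simp
    finally show "Cmp D (\<eta> b) (Cmp D (D.inv_arr (\<eta> b)) (FArr G f)) =
        Cmp D (\<eta> b) (Cmp D (FArr F f) (D.inv_arr (\<eta> a)))" by simp
  qed (use obj inv F_f G_f in auto)
  then show "Cmp D ((\<lambda>a\<in>Obj C. D.inv_arr (\<eta> a)) (Cod C f)) (FArr G f) =
      Cmp D (FArr F f) ((\<lambda>a\<in>Obj C. D.inv_arr (\<eta> a)) (Dom C f))"
    using obj HomD[OF f_hom] by simp
qed

lemma is_iso_functor_categoryI:
  assumes C_cat: "is_category C" and D_cat: "is_category D"
    and arr: "(F, \<eta>, G) \<in> Arr (functor_category C D)"
    and iso: "\<And>a. a \<in> Obj C \<Longrightarrow> is_iso D (\<eta> a)"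
  shows "is_iso (functor_category C D) (F, \<eta>, G)"
proof -
  interpret D: cat D by standard fact
  interpret FC: cat "functor_category C D"
    by standard (rule is_category_functor_category[OF C_cat D_cat])
  have \<eta>_nat: "is_nat_trans C D F G \<eta>" "\<eta> \<in> extensional (Obj C)"
    and functors: "is_functor C D F" "is_functor C D G"
    using arr by (auto simp: Arr_functor_category Obj_functor_category)
  let ?inv = "\<lambda>a\<in>Obj C. D.inv_arr (\<eta> a)"
  have "(G, ?inv, F) \<in> Hom (functor_category C D) G F"
    using arr nat_trans_inverse[OF C_cat D_cat functors \<eta>_nat(1) iso]
    by (auto simp: Hom_functor_category Arr_functor_category)
  then show ?thesis
    using arr D.comp_inv_left[OF iso is_nat_transD(1)[OF \<eta>_nat(1)]]
      D.comp_inv_right[OF iso is_nat_transD(1)[OF \<eta>_nat(1)]]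
    by (intro FC.is_isoI[of _ F G "(G, ?inv, F)"]) (auto simp: Hom_def intro!: restrict_ext)
qed

locale fully_faithful_dense_functor = C: cat C + D: cat D
  for C :: "('o, 'a) category" and D :: "('p, 'b) category" +
  fixes F :: "('o, 'a, 'p, 'b) fctr"
  assumes is_functor: "is_functor C D F"
    and faithful: "f \<in> Hom C a b \<Longrightarrow> g \<in> Hom C a b \<Longrightarrow> FArr F f = FArr F g \<Longrightarrow> f = g"
    and full: "a \<in> Obj C \<Longrightarrow> b \<in> Obj C \<Longrightarrow> h \<in> Hom D (FObj F a) (FObj F b) \<Longrightarrow>
      \<exists>f\<in>Hom C a b. FArr F f = h"
    and dense: "d \<in> Obj D \<Longrightarrow> \<exists>a\<in>Obj C. \<exists>h\<in>Hom D (FObj F a) d. is_iso D h"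
begin

lemmas F_obj = is_functorD(1)[OF is_functor] and F_hom = is_functorD(2)[OF is_functor]
  and F_id = is_functorD(3)[OF is_functor] and F_comp = is_functorD(4)[OF is_functor]

definition lift :: "'o \<Rightarrow> 'o \<Rightarrow> 'b \<Rightarrow> 'a" where
  "lift a b h = (SOME f. f \<in> Hom C a b \<and> FArr F f = h)"

lemma
  assumes "a \<in> Obj C" "b \<in> Obj C" "h \<in> Hom D (FObj F a) (FObj F b)"
  shows lift_hom: "lift a b h \<in> Hom C a b" and F_lift: "FArr F (lift a b h) = h"
  using someI_ex[of "\<lambda>f. f \<in> Hom C a b \<and> FArr F f = h"] full[OF assms]
  unfolding lift_def by blast+

lemma reflects_iso:
  assumes f_hom: "f \<in> Hom C a b" and iso: "is_iso D (FArr F f)"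
  shows "is_iso C f"
proof -
  note obj = C.Hom_obj[OF f_hom] and F_f = F_hom[OF f_hom]
  let ?i = "D.inv_arr (FArr F f)"
  have i_hom: "?i \<in> Hom D (FObj F b) (FObj F a)" by (rule D.inv_arr_hom[OF iso F_f])
  obtain g where g_hom: "g \<in> Hom C b a" and F_g_eq: "FArr F g = ?i" using full[OF obj(2,1) i_hom]
    by blast
  show ?thesis
  proof (rule C.is_isoI[OF f_hom g_hom])
    show "Cmp C g f = Idt C a"
      using F_comp[OF f_hom g_hom] F_id[OF obj(1)] D.comp_inv_left[OF iso F_f] obj(1) f_hom g_hom
      by (intro faithful[of _ a a]) (auto simp: F_g_eq)
    show "Cmp C f g = Idt C b"
      using F_comp[OF g_hom f_hom] F_id[OF obj(2)] D.comp_inv_right[OF iso F_f] obj(2) f_hom g_hom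
      by (intro faithful[of _ b b]) (auto simp: F_g_eq)
  qed
qed

definition preimage :: "'p \<Rightarrow> 'o" where
  "preimage d = (SOME a. a \<in> Obj C \<and> (\<exists>h\<in>Hom D (FObj F a) d. is_iso D h))"

definition counit :: "'p \<Rightarrow> 'b" where
  "counit d = (SOME h. h \<in> Hom D (FObj F (preimage d)) d \<and> is_iso D h)"

lemma
  assumes "d \<in> Obj D"
  shows preimage_obj: "preimage d \<in> Obj C"
    and counit_hom: "counit d \<in> Hom D (FObj F (preimage d)) d"
    and counit_iso: "is_iso D (counit d)"
proof -
  have "\<exists>a. a \<in> Obj C \<and> (\<exists>h\<in>Hom D (FObj F a) d. is_iso D h)" using dense[OF assms] by blast
  from someI_ex[OF this]
  have preimage_props: "preimage d \<in> Obj C"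
    "\<exists>h. h \<in> Hom D (FObj F (preimage d)) d \<and> is_iso D h"
    unfolding preimage_def[symmetric] by blast+
  show "preimage d \<in> Obj C" by fact
  from someI_ex[OF preimage_props(2)]
  show "counit d \<in> Hom D (FObj F (preimage d)) d" "is_iso D (counit d)"
    unfolding counit_def[symmetric] by blast+
qed

lemmas counit_cancel = D.iso_cancel_left[OF counit_iso counit_hom]

definition transport :: "'b \<Rightarrow> 'b" where
  "transport h = Cmp D (D.inv_arr (counit (Cod D h))) (Cmp D h (counit (Dom D h)))"

lemma
  assumes h_hom: "h \<in> Hom D d e"
  shows transport_hom: "transport h \<in> Hom D (FObj F (preimage d)) (FObj F (preimage e))"
    and counit_transport: "Cmp D (counit e) (transport h) = Cmp D h (counit d)"
proof -
  note obj = D.Hom_obj[OF h_hom]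
  have h_counit: "Cmp D h (counit d) \<in> Hom D (FObj F (preimage d)) e"
    by (rule D.comp_hom[OF counit_hom[OF obj(1)] h_hom])
  show "transport h \<in> Hom D (FObj F (preimage d)) (FObj F (preimage e))"
    using D.comp_hom[OF h_counit D.inv_arr_hom[OF counit_iso counit_hom]] obj HomD[OF h_hom]
    by (simp add: transport_def)
  show "Cmp D (counit e) (transport h) = Cmp D h (counit d)"
    using D.iso_comp_inv_comp[OF counit_iso counit_hom h_counit] obj HomD[OF h_hom]
    by (simp add: transport_def)
qed

lemma transport_id:
  assumes "d \<in> Obj D"
  shows "transport (Idt D d) = Idt D (FObj F (preimage d))"
  using assms preimage_obj[OF assms] F_obj counit_transport[OF D.id_hom[OF assms]]
    HomD[OF counit_hom[OF assms]]
  by (intro counit_cancel[OF assms assms transport_hom[OF D.id_hom[OF assms]]]) auto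

lemma transport_comp:
  assumes g_hom: "g \<in> Hom D d e" and h_hom: "h \<in> Hom D e e'"
  shows "transport (Cmp D h g) = Cmp D (transport h) (transport g)"
proof (rule counit_cancel)
  note obj = D.Hom_obj[OF g_hom] D.Hom_obj[OF h_hom]
  note transport_g = transport_hom[OF g_hom] and transport_h = transport_hom[OF h_hom]
  show "Cmp D (counit e') (transport (Cmp D h g)) =
      Cmp D (counit e') (Cmp D (transport h) (transport g))"
    using counit_transport[OF D.comp_hom[OF g_hom h_hom]] counit_transport[OF g_hom]
      counit_transport[OF h_hom] D.comp_assoc[OF transport_g transport_h counit_hom[OF obj(4)]]
      D.comp_assoc[OF transport_g counit_hom[OF obj(3)] h_hom]
      D.comp_assoc[OF counit_hom[OF obj(1)] g_hom h_hom] by simp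
qed (use g_hom h_hom transport_hom[OF g_hom] transport_hom[OF h_hom]
    transport_hom[OF D.comp_hom[OF g_hom h_hom]] D.Hom_obj[OF h_hom] in auto)

definition quasi_inverse :: "('p, 'b, 'o, 'a) fctr" where
  "quasi_inverse = \<lparr>FObj = preimage,
     FArr = (\<lambda>h. lift (preimage (Dom D h)) (preimage (Cod D h)) (transport h))\<rparr>"

lemma
  assumes "h \<in> Hom D d e"
  shows quasi_inverse_hom: "FArr quasi_inverse h \<in> Hom C (preimage d) (preimage e)"
    and F_quasi_inverse: "FArr F (FArr quasi_inverse h) = transport h"
  using lift_hom[OF preimage_obj preimage_obj transport_hom[OF assms]]
    F_lift[OF preimage_obj preimage_obj transport_hom[OF assms]] D.Hom_obj[OF assms] HomD[OF assms]
  by (simp_all add: quasi_inverse_def)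

lemma is_functor_quasi_inverse: "is_functor D C quasi_inverse"
  unfolding is_functor_def
proof (intro conjI ballI impI)
  have [simp]: "FObj quasi_inverse = preimage" by (simp add: quasi_inverse_def)
  fix d assume d_obj: "d \<in> Obj D"
  show "FObj quasi_inverse d \<in> Obj C" using preimage_obj[OF d_obj] by simp
  have "FArr quasi_inverse (Idt D d) = Idt C (preimage d)"
    using quasi_inverse_hom[OF D.id_hom[OF d_obj]] C.id_hom[OF preimage_obj[OF d_obj]]
    by (rule faithful)
      (simp add: F_quasi_inverse[OF D.id_hom[OF d_obj]] transport_id[OF d_obj]
        F_id[OF preimage_obj[OF d_obj]])
  then show "FArr quasi_inverse (Idt D d) = Idt C (FObj quasi_inverse d)" by simp
next
  fix g assume g_arr: "g \<in> Arr D"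
  have g_hom: "g \<in> Hom D (Dom D g) (Cod D g)" using g_arr by (simp add: Hom_def)
  then show "FArr quasi_inverse g \<in>
      Hom C (FObj quasi_inverse (Dom D g)) (FObj quasi_inverse (Cod D g))"
    using quasi_inverse_hom by (simp add: quasi_inverse_def)
  fix h assume "h \<in> Arr D" "Cod D g = Dom D h"
  then have h_hom: "h \<in> Hom D (Cod D g) (Cod D h)" by (simp add: Hom_def)
  note quasi_inverse_g = quasi_inverse_hom[OF g_hom]
    and quasi_inverse_h = quasi_inverse_hom[OF h_hom]
  show "FArr quasi_inverse (Cmp D h g) = Cmp C (FArr quasi_inverse h) (FArr quasi_inverse g)"
    using quasi_inverse_hom[OF D.comp_hom[OF g_hom h_hom]]
      C.comp_hom[OF quasi_inverse_g quasi_inverse_h]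
    by (rule faithful)
      (simp add: F_quasi_inverse[OF D.comp_hom[OF g_hom h_hom]]
        F_comp[OF quasi_inverse_g quasi_inverse_h]
        F_quasi_inverse[OF g_hom] F_quasi_inverse[OF h_hom] transport_comp[OF g_hom h_hom])
qed

definition unit :: "'o \<Rightarrow> 'a" where
  "unit a = lift a (preimage (FObj F a)) (D.inv_arr (counit (FObj F a)))"

lemma
  assumes "a \<in> Obj C"
  shows unit_hom: "unit a \<in> Hom C a (preimage (FObj F a))"
    and F_unit: "FArr F (unit a) = D.inv_arr (counit (FObj F a))"
    and counit_F_unit: "Cmp D (counit (FObj F a)) (FArr F (unit a)) = Idt D (FObj F a)"
    and unit_iso: "is_iso C (unit a)"
proof -
  note F_a = F_obj[OF assms]
  note e_hom = counit_hom[OF F_a] and e_iso = counit_iso[OF F_a]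
  note i_hom = D.inv_arr_hom[OF e_iso e_hom]
  show n_hom: "unit a \<in> Hom C a (preimage (FObj F a))"
    unfolding unit_def by (rule lift_hom[OF assms preimage_obj[OF F_a] i_hom])
  show F_unit: "FArr F (unit a) = D.inv_arr (counit (FObj F a))"
    unfolding unit_def by (rule F_lift[OF assms preimage_obj[OF F_a] i_hom])
  show "Cmp D (counit (FObj F a)) (FArr F (unit a)) = Idt D (FObj F a)"
    unfolding F_unit by (rule D.comp_inv_right[OF e_iso e_hom])
  have "is_iso D (FArr F (unit a))"
    unfolding F_unit
    by (rule D.is_isoI[OF i_hom e_hom D.comp_inv_right[OF e_iso e_hom]
      D.comp_inv_left[OF e_iso e_hom]])
  then show "is_iso C (unit a)" by (rule reflects_iso[OF n_hom])
qed

lemma unit_natural: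
  assumes f_hom: "f \<in> Hom C a b"
  shows "Cmp C (unit b) f = Cmp C (FArr quasi_inverse (FArr F f)) (unit a)"
proof -
  note obj = C.Hom_obj[OF f_hom] and F_f = F_hom[OF f_hom]
  note F_a = F_obj[OF obj(1)] and F_b = F_obj[OF obj(2)]
  note n_hom = unit_hom[OF obj(1)] unit_hom[OF obj(2)]
  note transport_f = transport_hom[OF F_f] and quasi_inverse_f = quasi_inverse_hom[OF F_f]
  have "Cmp D (FArr F (unit b)) (FArr F f) = Cmp D (transport (FArr F f)) (FArr F (unit a))"
  proof (rule counit_cancel[OF F_b F_b])
    have "Cmp D (counit (FObj F b)) (Cmp D (FArr F (unit b)) (FArr F f)) = FArr F f"
      using D.comp_assoc[OF F_f F_hom[OF n_hom(2)] counit_hom[OF F_b]] counit_F_unit[OF obj(2)]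
        HomD[OF F_f] by simp
    also have "\<dots> = Cmp D (counit (FObj F b)) (Cmp D (transport (FArr F f)) (FArr F (unit a)))"
      using D.comp_assoc[OF F_hom[OF n_hom(1)] transport_f counit_hom[OF F_b]]
        D.comp_assoc[OF F_hom[OF n_hom(1)] counit_hom[OF F_a] F_f] counit_transport[OF F_f]
        counit_F_unit[OF obj(1)] HomD[OF F_f] by simp
    finally show "Cmp D (counit (FObj F b)) (Cmp D (FArr F (unit b)) (FArr F f)) =
        Cmp D (counit (FObj F b)) (Cmp D (transport (FArr F f)) (FArr F (unit a)))" .
  qed (use F_f transport_f F_hom[OF n_hom(1)] F_hom[OF n_hom(2)] in auto)
  with C.comp_hom[OF f_hom n_hom(2)] C.comp_hom[OF n_hom(1) quasi_inverse_f] show ?thesis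
    by (intro faithful) (auto simp: F_comp[OF f_hom n_hom(2)] F_comp[OF n_hom(1) quasi_inverse_f]
      F_quasi_inverse[OF F_f])
qed

theorem equivalent_categories: "equivalent_categories C D"
proof -
  have "naturally_isomorphic C C id_fctr (comp_fctr quasi_inverse F)"
    unfolding naturally_isomorphic_def is_nat_trans_def
    using unit_hom unit_iso unit_natural[OF HomI]
    by (intro exI[of _ unit]) (auto simp: comp_fctr_def id_fctr_def quasi_inverse_def)
  moreover have "naturally_isomorphic D D (comp_fctr F quasi_inverse) id_fctr"
    unfolding naturally_isomorphic_def is_nat_trans_def
    using counit_hom counit_iso counit_transport[OF HomI] F_quasi_inverse[OF HomI]
    by (intro exI[of _ counit]) (auto simp: comp_fctr_def id_fctr_def quasi_inverse_def)
  ultimately show ?thesis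
    unfolding equivalent_categories_def
    using C.is_category D.is_category is_functor is_functor_quasi_inverse by blast
qed

end

section \<open>Presheaves with values in a concrete category\<close>

definition concrete_cat :: "'p set \<Rightarrow> ('p \<Rightarrow> 'e set) \<Rightarrow> ('p \<Rightarrow> 'p \<Rightarrow> ('e \<Rightarrow> 'e) \<Rightarrow> bool) \<Rightarrow>
    ('p, 'p \<times> ('e \<Rightarrow> 'e) \<times> 'p) category" where
  "concrete_cat Ob car hom = \<lparr>Obj = Ob,
     Arr = {(A, f, B). A \<in> Ob \<and> B \<in> Ob \<and> f \<in> car A \<rightarrow>\<^sub>E car B \<and> hom A B f},
     Dom = (\<lambda>(A, f, B). A),
     Cod = (\<lambda>(A, f, B). B),
     Idt = (\<lambda>A. (A, \<lambda>x\<in>car A. x, A)),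
     Cmp = (\<lambda>(B', g, D) (A, f, B). (A, compose (car A) g f, D))\<rparr>"

lemma concrete_cat_simps [simp]:
  "Obj (concrete_cat Ob car hom) = Ob"
  "Dom (concrete_cat Ob car hom) (A, f, B) = A"
  "Cod (concrete_cat Ob car hom) (A, f, B) = B"
  "Idt (concrete_cat Ob car hom) A = (A, \<lambda>x\<in>car A. x, A)"
  "Cmp (concrete_cat Ob car hom) (B', g, D) (A, f, B) = (A, compose (car A) g f, D)"
  by (simp_all add: concrete_cat_def)

lemma Arr_concrete_cat:
  "(A, f, B) \<in> Arr (concrete_cat Ob car hom) \<longleftrightarrow>
     A \<in> Ob \<and> B \<in> Ob \<and> f \<in> car A \<rightarrow>\<^sub>E car B \<and> hom A B f"
  by (simp add: concrete_cat_def)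

lemma Hom_concrete_cat:
  "t \<in> Hom (concrete_cat Ob car hom) A B \<longleftrightarrow>
     (\<exists>f. t = (A, f, B) \<and> A \<in> Ob \<and> B \<in> Ob \<and> f \<in> car A \<rightarrow>\<^sub>E car B \<and> hom A B f)"
  by (cases t) (auto simp: Hom_def Arr_concrete_cat)

lemma is_category_concrete_cat:
  assumes hom_id: "\<And>A. A \<in> Ob \<Longrightarrow> hom A A (\<lambda>x\<in>car A. x)"
    and hom_comp: "\<And>A B D f g. A \<in> Ob \<Longrightarrow> B \<in> Ob \<Longrightarrow> D \<in> Ob \<Longrightarrow> f \<in> car A \<rightarrow>\<^sub>E car B \<Longrightarrow>
      g \<in> car B \<rightarrow>\<^sub>E car D \<Longrightarrow> hom A B f \<Longrightarrow> hom B D g \<Longrightarrow> hom A D (compose (car A) g f)"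
  shows "is_category (concrete_cat Ob car hom)" (is "is_category ?K")
proof (rule is_categoryI)
  show "Dom ?K s \<in> Obj ?K \<and> Cod ?K s \<in> Obj ?K" if "s \<in> Arr ?K" for s
    using that by (cases s) (simp add: Arr_concrete_cat)
  show "Idt ?K A \<in> Hom ?K A A" if "A \<in> Obj ?K" for A
    using that hom_id by (simp add: Hom_concrete_cat)
  show "Cmp ?K t s \<in> Hom ?K (Dom ?K s) (Cod ?K t)"
    if "s \<in> Arr ?K" "t \<in> Arr ?K" "Cod ?K s = Dom ?K t" for s t
    using that hom_comp
    by (cases s; cases t) (auto simp: Arr_concrete_cat Hom_concrete_cat compose_def PiE_def)
  show "Cmp ?K s (Idt ?K (Dom ?K s)) = s \<and> Cmp ?K (Idt ?K (Cod ?K s)) s = s" if "s \<in> Arr ?K" for s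
    using that
    by (cases s) (auto simp: Arr_concrete_cat compose_def fun_eq_iff PiE_def extensional_def)
  show "Cmp ?K u (Cmp ?K t s) = Cmp ?K (Cmp ?K u t) s"
    if "s \<in> Arr ?K" "t \<in> Arr ?K" "u \<in> Arr ?K" "Cod ?K s = Dom ?K t" "Cod ?K t = Dom ?K u" for s t u
    using that by (cases s; cases t; cases u) (auto simp: Arr_concrete_cat compose_def fun_eq_iff)
qed

definition underlying :: "'p \<times> ('e \<Rightarrow> 'e) \<times> 'p \<Rightarrow> 'e \<Rightarrow> 'e" where
  "underlying = (\<lambda>(A, f, B). f)"

lemma underlying_simp [simp]: "underlying (A, f, B) = f"
  by (simp add: underlying_def)

lemma underlying_Cmp:
  "underlying (Cmp (concrete_cat Ob car hom) t s) =
     compose (car (Dom (concrete_cat Ob car hom) s)) (underlying t) (underlying s)"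
  by (cases s; cases t) simp

lemma is_iso_concrete_catI:
  assumes "(A, f, B) \<in> Arr (concrete_cat Ob car hom)" "(B, g, A) \<in> Arr (concrete_cat Ob car hom)"
    and "\<And>x. x \<in> car A \<Longrightarrow> g (f x) = x" "\<And>y. y \<in> car B \<Longrightarrow> f (g y) = y"
  shows "is_iso (concrete_cat Ob car hom) (A, f, B)"
  using assms unfolding is_iso_def
  by (auto simp: Hom_def compose_def intro!: bexI[of _ "(B, g, A)"] restrict_ext)

definition into :: "('o, 'a) category \<Rightarrow> 'o \<Rightarrow> 'a set" where
  "into C c = {f \<in> Arr C. Cod C f = c}"

lemma intoD: "f \<in> into C c \<Longrightarrow> f \<in> Arr C" "f \<in> into C c \<Longrightarrow> Cod C f = c"
  by (auto simp: into_def)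

context cat
begin

lemma into_dom [simp, intro]: "f \<in> into C c \<Longrightarrow> Dom C f \<in> Obj C"
  by (auto simp: into_def)

lemma into_obj: "f \<in> into C c \<Longrightarrow> c \<in> Obj C"
  by (auto simp: into_def)

lemma arr_into: "f \<in> Arr C \<Longrightarrow> f \<in> into C (Cod C f)"
  by (simp add: into_def)

lemma into_id [simp, intro]: "c \<in> Obj C \<Longrightarrow> Idt C c \<in> into C c"
  by (simp add: into_def)

lemma into_comp [simp, intro]:
  "f \<in> into C c \<Longrightarrow> g \<in> into C (Dom C f) \<Longrightarrow> Cmp C f g \<in> into C c"
  by (simp add: into_def)

lemma dom_comp_into [simp]:
  "f \<in> into C c \<Longrightarrow> g \<in> into C (Dom C f) \<Longrightarrow> Dom C (Cmp C f g) = Dom C g"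
  by (simp add: into_def)

lemma into_id_left [simp]: "f \<in> into C c \<Longrightarrow> Cmp C (Idt C c) f = f"
  and into_id_right [simp]: "f \<in> into C c \<Longrightarrow> Cmp C f (Idt C (Dom C f)) = f"
  by (simp_all add: into_def)

lemma comp_assoc_into [simp]:
  "f \<in> into C c \<Longrightarrow> g \<in> into C (Dom C f) \<Longrightarrow> h \<in> into C (Dom C g) \<Longrightarrow>
    Cmp C (Cmp C f g) h = Cmp C f (Cmp C g h)"
  using comp_assoc[of h "Dom C h" "Dom C g" g "Dom C f" f c] by (simp add: into_def Hom_def)

end

locale concrete_presheaf = cat C for C :: "('o, 'a) category" +
  fixes Ob :: "'p set" and car :: "'p \<Rightarrow> 'e set" and hom :: "'p \<Rightarrow> 'p \<Rightarrow> ('e \<Rightarrow> 'e) \<Rightarrow> bool"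
    and F :: "('o, 'a, 'p, 'p \<times> ('e \<Rightarrow> 'e) \<times> 'p) fctr"
  assumes presheaf: "F \<in> Obj (functor_category (op_cat C) (concrete_cat Ob car hom))"
begin

abbreviation act :: "'a \<Rightarrow> 'e \<Rightarrow> 'e" where
  "act f \<equiv> underlying (FArr F f)"

lemma is_functor: "is_functor (op_cat C) (concrete_cat Ob car hom) F"
  using presheaf by (simp add: Obj_functor_category)

lemma FObj_in [simp]: "c \<in> Obj C \<Longrightarrow> FObj F c \<in> Ob"
  using is_functorD(1)[OF is_functor] by simp

lemma
  assumes "f \<in> into C c"
  shows FArr_eq: "FArr F f = (FObj F c, act f, FObj F (Dom C f))"
    and act_funcset: "act f \<in> car (FObj F c) \<rightarrow>\<^sub>E car (FObj F (Dom C f))"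
    and act_hom: "hom (FObj F c) (FObj F (Dom C f)) (act f)"
    and Dom_FArr: "Dom (concrete_cat Ob car hom) (FArr F f) = FObj F c"
proof -
  have "FArr F f \<in> Hom (concrete_cat Ob car hom) (FObj F c) (FObj F (Dom C f))"
    using is_functorD(2)[OF is_functor] assms by (simp add: Hom_def into_def)
  then show "FArr F f = (FObj F c, act f, FObj F (Dom C f))"
    "act f \<in> car (FObj F c) \<rightarrow>\<^sub>E car (FObj F (Dom C f))"
    "hom (FObj F c) (FObj F (Dom C f)) (act f)"
    "Dom (concrete_cat Ob car hom) (FArr F f) = FObj F c"
    by (auto simp: Hom_concrete_cat)
qed

lemma act_closed [simp]:
  "f \<in> into C c \<Longrightarrow> x \<in> car (FObj F c) \<Longrightarrow> act f x \<in> car (FObj F (Dom C f))"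
  using act_funcset by blast

lemma act_id [simp]: "c \<in> Obj C \<Longrightarrow> x \<in> car (FObj F c) \<Longrightarrow> act (Idt C c) x = x"
  using is_functorD(3)[OF is_functor, of c] by simp

lemma act_comp:
  assumes f_into: "f \<in> into C c" and g_into: "g \<in> into C (Dom C f)" and "x \<in> car (FObj F c)"
  shows "act (Cmp C f g) x = act g (act f x)"
proof -
  have "FArr F (Cmp C f g) = Cmp (concrete_cat Ob car hom) (FArr F g) (FArr F f)"
    using is_functorD(4)[OF is_functor, of f c "Dom C f" g "Dom C g"] f_into g_into
    by (simp add: Hom_def into_def)
  then show ?thesis using assms by (simp add: underlying_Cmp Dom_FArr[OF f_into] compose_eq)
qed

end

definition mk_presheaf :: "('o, 'a) category \<Rightarrow> ('p \<Rightarrow> 'e set) \<Rightarrow> ('o \<Rightarrow> 'p) \<Rightarrow>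
    ('a \<Rightarrow> 'e \<Rightarrow> 'e) \<Rightarrow> ('o, 'a, 'p, 'p \<times> ('e \<Rightarrow> 'e) \<times> 'p) fctr" where
  "mk_presheaf C car X act = \<lparr>FObj = (\<lambda>c\<in>Obj C. X c),
     FArr = (\<lambda>f\<in>Arr C. (X (Cod C f), \<lambda>x\<in>car (X (Cod C f)). act f x, X (Dom C f)))\<rparr>"

lemma mk_presheaf_simps [simp]:
  "c \<in> Obj C \<Longrightarrow> FObj (mk_presheaf C car X act) c = X c"
  "f \<in> into C c \<Longrightarrow> x \<in> car (X c) \<Longrightarrow> underlying (FArr (mk_presheaf C car X act) f) x = act f x"
  by (auto simp: mk_presheaf_def into_def)

lemma mk_presheaf_Obj:
  assumes C_cat: "is_category C"
    and X_Ob: "\<And>c. c \<in> Obj C \<Longrightarrow> X c \<in> Ob"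
    and closed: "\<And>f c x. f \<in> into C c \<Longrightarrow> x \<in> car (X c) \<Longrightarrow> act f x \<in> car (X (Dom C f))"
    and hom: "\<And>f c. f \<in> into C c \<Longrightarrow> hom (X c) (X (Dom C f)) (\<lambda>x\<in>car (X c). act f x)"
    and id: "\<And>c x. c \<in> Obj C \<Longrightarrow> x \<in> car (X c) \<Longrightarrow> act (Idt C c) x = x"
    and comp: "\<And>f g c x. f \<in> into C c \<Longrightarrow> g \<in> into C (Dom C f) \<Longrightarrow> x \<in> car (X c) \<Longrightarrow>
      act (Cmp C f g) x = act g (act f x)"
  shows "mk_presheaf C car X act \<in> Obj (functor_category (op_cat C) (concrete_cat Ob car hom))"
    (is "?F \<in> Obj (functor_category _ ?K)")
proof -
  interpret cat C by standard (rule C_cat)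
  have "is_functor (op_cat C) ?K ?F"
    unfolding is_functor_def
  proof (intro conjI ballI impI)
    fix c assume "c \<in> Obj (op_cat C)"
    then show "FObj ?F c \<in> Obj ?K" "FArr ?F (Idt (op_cat C) c) = Idt ?K (FObj ?F c)"
      using X_Ob by (auto simp: mk_presheaf_def id intro!: restrict_ext)
  next
    fix f assume "f \<in> Arr (op_cat C)"
    then have f_into: "f \<in> into C (Cod C f)" by (simp add: arr_into)
    have f_obj: "Cod C f \<in> Obj C" "Dom C f \<in> Obj C" using f_into into_obj by auto
    show "FArr ?F f \<in> Hom ?K (FObj ?F (Dom (op_cat C) f)) (FObj ?F (Cod (op_cat C) f))"
      using f_obj intoD(1)[OF f_into] X_Ob closed[OF f_into] hom[OF f_into]
      by (simp add: mk_presheaf_def Hom_concrete_cat)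
    fix g assume "g \<in> Arr (op_cat C)" "Cod (op_cat C) f = Dom (op_cat C) g"
    then have g_into: "g \<in> into C (Dom C f)" by (simp add: into_def)
    show "FArr ?F (Cmp (op_cat C) g f) = Cmp ?K (FArr ?F g) (FArr ?F f)"
      using intoD[OF f_into] intoD[OF g_into] closed[OF f_into] comp[OF f_into g_into]
      by (auto simp: mk_presheaf_def compose_def intro!: restrict_ext)
  qed
  then show ?thesis by (simp add: Obj_functor_category mk_presheaf_def)
qed

definition mk_nat :: "('o, 'a) category \<Rightarrow> ('p \<Rightarrow> 'e set) \<Rightarrow> ('o, 'a, 'p, 'b) fctr \<Rightarrow>
    ('o \<Rightarrow> 'e \<Rightarrow> 'e) \<Rightarrow> ('o, 'a, 'p, 'b) fctr \<Rightarrow>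
    ('o, 'a, 'p, 'b) fctr \<times> ('o \<Rightarrow> 'p \<times> ('e \<Rightarrow> 'e) \<times> 'p) \<times> ('o, 'a, 'p, 'b) fctr" where
  "mk_nat C car F a G = (F, \<lambda>c\<in>Obj C. (FObj F c, \<lambda>x\<in>car (FObj F c). a c x, FObj G c), G)"

definition component :: "'f \<times> ('o \<Rightarrow> 'p \<times> ('e \<Rightarrow> 'e) \<times> 'p) \<times> 'f \<Rightarrow> 'o \<Rightarrow> 'e \<Rightarrow> 'e" where
  "component = (\<lambda>(F, \<eta>, G) c. underlying (\<eta> c))"

lemma component_mk_nat:
  "c \<in> Obj C \<Longrightarrow> component (mk_nat C car F a G) c = (\<lambda>x\<in>car (FObj F c). a c x)"
  by (simp add: component_def mk_nat_def)

lemma component_mk_nat_apply [simp]: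
  "c \<in> Obj C \<Longrightarrow> x \<in> car (FObj F c) \<Longrightarrow> component (mk_nat C car F a G) c x = a c x"
  by (simp add: component_mk_nat)

lemma mk_nat_cong:
  assumes "\<And>c x. c \<in> Obj C \<Longrightarrow> x \<in> car (FObj F c) \<Longrightarrow> a c x = b c x"
  shows "mk_nat C car F a G = mk_nat C car F b G"
  using assms by (auto simp: mk_nat_def intro!: restrict_ext)

lemma mk_nat_id: "Idt (functor_category (op_cat C) (concrete_cat Ob car hom)) F =
    mk_nat C car F (\<lambda>c x. x) F"
  by (simp add: mk_nat_def)

lemma mk_nat_comp:
  assumes "\<And>c x. c \<in> Obj C \<Longrightarrow> x \<in> car (FObj F c) \<Longrightarrow> a c x \<in> car (FObj G c)"
  shows "Cmp (functor_category (op_cat C) (concrete_cat Ob car hom))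
      (mk_nat C car G b H) (mk_nat C car F a G) = mk_nat C car F (\<lambda>c x. b c (a c x)) H"
  using assms by (auto simp: mk_nat_def compose_def intro!: restrict_ext)

locale concrete_presheaf_pair =
  F: concrete_presheaf C Ob car hom F + G: concrete_presheaf C Ob car hom G
  for C :: "('o, 'a) category" and Ob :: "'p set" and car :: "'p \<Rightarrow> 'e set" and hom F G
begin

lemma mk_nat_Hom:
  assumes closed: "\<And>c x. c \<in> Obj C \<Longrightarrow> x \<in> car (FObj F c) \<Longrightarrow> a c x \<in> car (FObj G c)"
    and hom: "\<And>c. c \<in> Obj C \<Longrightarrow> hom (FObj F c) (FObj G c) (\<lambda>x\<in>car (FObj F c). a c x)"
    and natural: "\<And>f c x. f \<in> into C c \<Longrightarrow> x \<in> car (FObj F c) \<Longrightarrow>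
      a (Dom C f) (F.act f x) = G.act f (a c x)"
  shows "mk_nat C car F a G \<in> Hom (functor_category (op_cat C) (concrete_cat Ob car hom)) F G"
proof -
  let ?\<eta> = "\<lambda>c\<in>Obj C. (FObj F c, \<lambda>x\<in>car (FObj F c). a c x, FObj G c)"
  have "is_nat_trans (op_cat C) (concrete_cat Ob car hom) F G ?\<eta>"
    unfolding is_nat_trans_def
  proof (intro conjI ballI)
    fix c assume "c \<in> Obj (op_cat C)"
    then show "?\<eta> c \<in> Hom (concrete_cat Ob car hom) (FObj F c) (FObj G c)"
      using closed hom by (simp add: Hom_concrete_cat)
  next
    fix f assume "f \<in> Arr (op_cat C)"
    then have f_into: "f \<in> into C (Cod C f)" by (simp add: F.arr_into)
    then show "Cmp (concrete_cat Ob car hom) (?\<eta> (Cod (op_cat C) f)) (FArr F f) =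
        Cmp (concrete_cat Ob car hom) (FArr G f) (?\<eta> (Dom (op_cat C) f))"
      using intoD(1)[OF f_into] natural[OF f_into]
      by (subst F.FArr_eq[OF f_into], subst G.FArr_eq[OF f_into])
        (auto simp: compose_def intro!: restrict_ext)
  qed
  then show ?thesis using F.presheaf G.presheaf by (simp add: mk_nat_def Hom_functor_category)
qed

lemma
  assumes "t \<in> Hom (functor_category (op_cat C) (concrete_cat Ob car hom)) F G"
  shows mk_nat_component: "mk_nat C car F (component t) G = t"
    and component_funcset: "c \<in> Obj C \<Longrightarrow> component t c \<in> car (FObj F c) \<rightarrow>\<^sub>E car (FObj G c)"
    and component_hom: "c \<in> Obj C \<Longrightarrow> hom (FObj F c) (FObj G c) (component t c)"
    and component_natural: "f \<in> into C c \<Longrightarrow> x \<in> car (FObj F c) \<Longrightarrow>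
      component t (Dom C f) (F.act f x) = G.act f (component t c x)"
proof -
  obtain \<eta> where t_eq: "t = (F, \<eta>, G)" and ext: "\<eta> \<in> extensional (Obj C)"
    and \<eta>_nat: "is_nat_trans (op_cat C) (concrete_cat Ob car hom) F G \<eta>"
    using assms by (auto simp: Hom_functor_category)
  have "\<eta> c \<in> Hom (concrete_cat Ob car hom) (FObj F c) (FObj G c)" if "c \<in> Obj C" for c
    using is_nat_transD(1)[OF \<eta>_nat] that by simp
  then have "\<eta> c = (FObj F c, component t c, FObj G c) \<and>
      component t c \<in> car (FObj F c) \<rightarrow>\<^sub>E car (FObj G c) \<and>
      hom (FObj F c) (FObj G c) (component t c)" if "c \<in> Obj C" for c
    using that by (fastforce simp: Hom_concrete_cat component_def t_eq)
  then have \<eta>_eq: "\<And>c. c \<in> Obj C \<Longrightarrow> \<eta> c = (FObj F c, component t c, FObj G c)"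
    and funcset: "\<And>c. c \<in> Obj C \<Longrightarrow> component t c \<in> car (FObj F c) \<rightarrow>\<^sub>E car (FObj G c)"
    and hom: "\<And>c. c \<in> Obj C \<Longrightarrow> hom (FObj F c) (FObj G c) (component t c)" by blast+
  show "component t c \<in> car (FObj F c) \<rightarrow>\<^sub>E car (FObj G c)" if "c \<in> Obj C"
    by (rule funcset[OF that])
  show "hom (FObj F c) (FObj G c) (component t c)" if "c \<in> Obj C"
    by (rule hom[OF that])
  have "(\<lambda>c\<in>Obj C. (FObj F c, restrict (component t c) (car (FObj F c)), FObj G c)) = \<eta>"
    by (rule extensionalityI[OF _ ext]) (simp_all add: PiE_restrict[OF funcset] \<eta>_eq[symmetric])
  then show "mk_nat C car F (component t) G = t" by (simp add: mk_nat_def t_eq)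
  show "component t (Dom C f) (F.act f x) = G.act f (component t c x)"
    if f_into: "f \<in> into C c" and x_in: "x \<in> car (FObj F c)"
  proof -
    have "Cmp (concrete_cat Ob car hom) (\<eta> (Dom C f)) (FArr F f) =
        Cmp (concrete_cat Ob car hom) (FArr G f) (\<eta> c)"
      using \<eta>_nat intoD[OF f_into] by (auto simp: is_nat_trans_def)
    from arg_cong[OF this, of underlying]
    have "compose (car (FObj F c)) (component t (Dom C f)) (F.act f) =
        compose (car (FObj F c)) (G.act f) (component t c)"
      using arg_cong[OF \<eta>_eq[OF F.into_obj[OF f_into]], of "Dom (concrete_cat Ob car hom)"]
      by (simp add: underlying_Cmp F.Dom_FArr[OF f_into] component_def t_eq)
    from fun_cong[OF this, of x] show ?thesis using x_in by (simp add: compose_def)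
  qed
qed

end

lemma set_cat_eq: "set_cat U = concrete_cat U (\<lambda>A. A) (\<lambda>A B f. True)"
  by (simp add: set_cat_def concrete_cat_def)

lemma psh_restrict_eq: "psh_restrict X f = underlying (FArr X f)"
  by (simp add: psh_restrict_def set_arr_fun_def underlying_def)

lemma psh_map_eq: "psh_map = component"
  by (auto simp: psh_map_def component_def set_arr_fun_def underlying_def)

section \<open>Frames\<close>

sublocale complete_lattice \<subseteq> bounded_lattice ..

context complete_lattice
begin

lemma Sup_eqI:
  assumes "A \<subseteq> carrier L" "s \<in> carrier L" "\<And>x. x \<in> A \<Longrightarrow> x \<sqsubseteq> s"
    and "\<And>u. u \<in> carrier L \<Longrightarrow> (\<And>x. x \<in> A \<Longrightarrow> x \<sqsubseteq> u) \<Longrightarrow> s \<sqsubseteq> u"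
  shows "\<Squnion>A = s"
  using assms by (intro le_antisym sup_least assms(4)[OF sup_closed sup_upper]) auto

lemma meet_eqI:
  assumes "a \<in> carrier L" "b \<in> carrier L" "m \<in> carrier L" "m \<sqsubseteq> a" "m \<sqsubseteq> b"
    and "\<And>x. x \<in> carrier L \<Longrightarrow> x \<sqsubseteq> a \<Longrightarrow> x \<sqsubseteq> b \<Longrightarrow> x \<sqsubseteq> m"
  shows "a \<sqinter> b = m"
  using assms by (intro le_antisym) (auto intro!: meet_le simp: meet_left meet_right)

lemma Sup_empty: "\<Squnion>{} = \<bottom>"
  using weak_sup_empty by (simp add: eq_is_equal)

lemma top_le: "t \<in> carrier L \<Longrightarrow> \<top> \<sqsubseteq> t \<Longrightarrow> t = \<top>"
  and le_bottom: "b \<in> carrier L \<Longrightarrow> b \<sqsubseteq> \<bottom> \<Longrightarrow> b = \<bottom>"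
  by (intro le_antisym; simp)+

lemma meet_top: "a \<in> carrier L \<Longrightarrow> a \<sqinter> \<top> = a"
  and bottom_meet_eq: "a \<in> carrier L \<Longrightarrow> \<bottom> \<sqinter> a = \<bottom>"
  and join_bottom: "a \<in> carrier L \<Longrightarrow> a \<squnion> \<bottom> = a"
  and join_top: "a \<in> carrier L \<Longrightarrow> a \<squnion> \<top> = \<top>"
  using top_meet bottom_meet bottom_join top_join
  by (simp_all add: eq_is_equal meet_comm[of L a] join_comm[of L a])

lemma join_mono:
  assumes "a \<in> carrier L" "b \<in> carrier L" "a' \<in> carrier L" "b' \<in> carrier L" "a \<sqsubseteq> a'" "b \<sqsubseteq> b'"
  shows "a \<squnion> b \<sqsubseteq> a' \<squnion> b'"
  using assms le_trans[OF _ join_left] le_trans[OF _ join_right] by (auto intro!: join_le)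

lemma meet_mono:
  assumes "a \<in> carrier L" "b \<in> carrier L" "a' \<in> carrier L" "b' \<in> carrier L" "a \<sqsubseteq> a'" "b \<sqsubseteq> b'"
  shows "a \<sqinter> b \<sqsubseteq> a' \<sqinter> b'"
  using assms le_trans[OF meet_left] le_trans[OF meet_right] by (auto intro!: meet_le)

lemma Sup_mono:
  assumes "A \<subseteq> carrier L" "B \<subseteq> carrier L" "\<And>x. x \<in> A \<Longrightarrow> \<exists>y\<in>B. x \<sqsubseteq> y"
  shows "\<Squnion>A \<sqsubseteq> \<Squnion>B"
proof (rule sup_least[OF assms(1)])
  fix x assume "x \<in> A"
  then obtain y where "y \<in> B" "x \<sqsubseteq> y" using assms(3) by blast
  then show "x \<sqsubseteq> \<Squnion>B"
    using assms(1,2) \<open>x \<in> A\<close> by (meson le_trans sup_upper sup_closed subsetD)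
qed (use assms in auto)

end

lemma complete_latticeI_Sup:
  assumes "partial_order L"
    and lub: "\<And>A. A \<subseteq> carrier L \<Longrightarrow> \<exists>s\<in>carrier L. (\<forall>x\<in>A. x \<sqsubseteq>\<^bsub>L\<^esub> s) \<and>
           (\<forall>u\<in>carrier L. (\<forall>x\<in>A. x \<sqsubseteq>\<^bsub>L\<^esub> u) \<longrightarrow> s \<sqsubseteq>\<^bsub>L\<^esub> u)"
  shows "complete_lattice L"
proof -
  interpret partial_order L by fact
  show ?thesis
  proof (rule complete_latticeI)
    fix A assume A_sub: "A \<subseteq> carrier L"
    then show "\<exists>s. least L s (Upper L A)"
      using lub[OF A_sub] by (force simp: least_def Upper_def)
    obtain s where "s \<in> carrier L" "\<forall>x\<in>Lower L A. x \<sqsubseteq>\<^bsub>L\<^esub> s"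
      "\<forall>u\<in>carrier L. (\<forall>x\<in>Lower L A. x \<sqsubseteq>\<^bsub>L\<^esub> u) \<longrightarrow> s \<sqsubseteq>\<^bsub>L\<^esub> u"
      using lub[of "Lower L A"] by auto
    then show "\<exists>i. greatest L i (Lower L A)"
      using A_sub by (intro exI[of _ s]) (auto simp: greatest_def Lower_def)
  qed
qed

locale frame = complete_lattice L for L :: "'u gorder" (structure) +
  assumes frame_distrib: "a \<in> carrier L \<Longrightarrow> A \<subseteq> carrier L \<Longrightarrow> a \<sqinter> \<Squnion>A = \<Squnion>((\<lambda>x. a \<sqinter> x) ` A)"

lemma is_frame_iff: "is_frame L \<longleftrightarrow> frame L"
  by (auto simp: is_frame_def frame_def frame_axioms_def)

context frame
begin

lemma meet_join_distrib:
  assumes "a \<in> carrier L" "b \<in> carrier L" "c \<in> carrier L"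
  shows "a \<sqinter> (b \<squnion> c) = (a \<sqinter> b) \<squnion> (a \<sqinter> c)"
  using frame_distrib[of a "{b, c}"] assms by (simp add: join_def)

lemma le_if_meet_bottom_join_top:
  assumes "x \<in> carrier L" "u \<in> carrier L" "w \<in> carrier L" "x \<sqinter> w = \<bottom>" "u \<squnion> w = \<top>"
  shows "x \<sqsubseteq> u"
proof -
  have "x = (x \<sqinter> u) \<squnion> (x \<sqinter> w)" using assms meet_join_distrib[of x u w] by (simp add: meet_top)
  also have "\<dots> = x \<sqinter> u" using assms by (simp add: join_bottom)
  finally show ?thesis using assms meet_right[of x u] by simp
qed

lemma meet_join_top:
  assumes "x \<in> carrier L" "x' \<in> carrier L" "y \<in> carrier L" "x \<squnion> y = \<top>" "x' \<squnion> y = \<top>"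
  shows "(x \<sqinter> x') \<squnion> y = \<top>"
proof -
  have "x' = (x' \<sqinter> x) \<squnion> (x' \<sqinter> y)" using assms meet_join_distrib[of x' x y] by (simp add: meet_top)
  also have "\<dots> \<sqsubseteq> (x \<sqinter> x') \<squnion> y"
    using assms by (intro join_mono) (auto simp: meet_right meet_comm)
  finally have "x' \<squnion> y \<sqsubseteq> (x \<sqinter> x') \<squnion> y" using assms by (intro join_le) (auto simp: join_right)
  then show ?thesis using assms by (intro top_le) auto
qed

lemma meet_join_bottom:
  assumes "a \<in> carrier L" "b \<in> carrier L" "c \<in> carrier L" "a \<sqinter> b = \<bottom>" "a \<sqinter> c = \<bottom>"
  shows "a \<sqinter> (b \<squnion> c) = \<bottom>"
  using assms by (simp add: meet_join_distrib join_bottom)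

lemma meet_bottom_mono:
  assumes "a \<in> carrier L" "b \<in> carrier L" "a' \<in> carrier L" "b' \<in> carrier L" "a \<sqsubseteq> a'" "b \<sqsubseteq> b'"
    and "a' \<sqinter> b' = \<bottom>"
  shows "a \<sqinter> b = \<bottom>"
  using meet_mono[OF assms(1-6)] assms by (intro le_bottom) auto

lemma join_top_mono:
  assumes "a \<in> carrier L" "b \<in> carrier L" "a' \<in> carrier L" "b' \<in> carrier L" "a \<sqsubseteq> a'" "b \<sqsubseteq> b'"
    and "a \<squnion> b = \<top>"
  shows "a' \<squnion> b' = \<top>"
  using join_mono[OF assms(1-6)] assms by (intro top_le) auto

lemma well_insideI: "w \<in> carrier L \<Longrightarrow> a \<sqinter> w = \<bottom> \<Longrightarrow> b \<squnion> w = \<top> \<Longrightarrow> well_inside L a b"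
  by (auto simp: well_inside_def)

lemma well_insideE:
  assumes "well_inside L a b"
  obtains w where "w \<in> carrier L" "a \<sqinter> w = \<bottom>" "b \<squnion> w = \<top>"
  using assms by (auto simp: well_inside_def)

lemma well_inside_le: "a \<in> carrier L \<Longrightarrow> b \<in> carrier L \<Longrightarrow> well_inside L a b \<Longrightarrow> a \<sqsubseteq> b"
  by (auto simp: well_inside_def intro: le_if_meet_bottom_join_top)

lemma well_inside_mono:
  assumes "a' \<in> carrier L" "a \<in> carrier L" "b \<in> carrier L" "b' \<in> carrier L"
    and "a' \<sqsubseteq> a" "b \<sqsubseteq> b'" "well_inside L a b"
  shows "well_inside L a' b'"
proof -
  obtain w where w_in: "w \<in> carrier L" "a \<sqinter> w = \<bottom>" "b \<squnion> w = \<top>" by (rule well_insideE[OF assms(7)])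
  show ?thesis
    using meet_bottom_mono[of a' w a w] join_top_mono[of b w b' w] w_in assms
    by (auto intro: well_insideI)
qed

lemma well_inside_meet:
  assumes "a \<in> carrier L" "b \<in> carrier L" "a' \<in> carrier L" "b' \<in> carrier L"
    and "well_inside L a b" "well_inside L a' b'"
  shows "well_inside L (a \<sqinter> a') (b \<sqinter> b')"
proof -
  obtain w where w_in: "w \<in> carrier L" "a \<sqinter> w = \<bottom>" "b \<squnion> w = \<top>" by (rule well_insideE[OF assms(5)])
  obtain w' where w'_in: "w' \<in> carrier L" "a' \<sqinter> w' = \<bottom>" "b' \<squnion> w' = \<top>"
    by (rule well_insideE[OF assms(6)])
  show ?thesis
  proof (rule well_insideI[of "w \<squnion> w'"])
    show "(a \<sqinter> a') \<sqinter> (w \<squnion> w') = \<bottom>"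
      using meet_bottom_mono[of "a \<sqinter> a'" w a w] meet_bottom_mono[of "a \<sqinter> a'" w' a' w'] w_in w'_in
        assms
      by (intro meet_join_bottom) (auto simp: meet_left meet_right)
    show "(b \<sqinter> b') \<squnion> (w \<squnion> w') = \<top>"
      using join_top_mono[of b w b "w \<squnion> w'"] join_top_mono[of b' w' b' "w \<squnion> w'"] w_in w'_in assms
      by (intro meet_join_top) (auto simp: join_left join_right)
  qed (use w_in w'_in in auto)
qed

lemma well_inside_join:
  assumes "a \<in> carrier L" "b \<in> carrier L" "a' \<in> carrier L"
    and "well_inside L a b" "well_inside L a' b"
  shows "well_inside L (a \<squnion> a') b"
proof -
  obtain w where w_in: "w \<in> carrier L" "a \<sqinter> w = \<bottom>" "b \<squnion> w = \<top>" by (rule well_insideE[OF assms(4)])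
  obtain w' where w'_in: "w' \<in> carrier L" "a' \<sqinter> w' = \<bottom>" "b \<squnion> w' = \<top>"
    by (rule well_insideE[OF assms(5)])
  show ?thesis
  proof (rule well_insideI[of "w \<sqinter> w'"])
    have "(w \<sqinter> w') \<sqinter> (a \<squnion> a') = \<bottom>"
      using meet_bottom_mono[of "w \<sqinter> w'" a w a] meet_bottom_mono[of "w \<sqinter> w'" a' w' a'] w_in w'_in
        assms
      by (intro meet_join_bottom) (auto simp: meet_left meet_right meet_comm[of L])
    then show "(a \<squnion> a') \<sqinter> (w \<sqinter> w') = \<bottom>" by (simp add: meet_comm[of L])
    show "b \<squnion> (w \<sqinter> w') = \<top>"
      using meet_join_top[of w w' b] w_in w'_in assms by (simp add: join_comm[of L])
  qed (use w_in w'_in in auto)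
qed

lemma well_inside_bottom: "b \<in> carrier L \<Longrightarrow> well_inside L \<bottom> b"
  by (rule well_insideI[of \<top>]) (auto simp: bottom_meet_eq join_top)

lemma well_inside_top: "well_inside L \<top> \<top>"
  by (rule well_insideI[of \<bottom>]) (auto simp: bottom_meet_eq join_bottom meet_comm[of L \<top>])

end

locale kreg_frame = frame +
  assumes compact: "compact_frame L" and regular: "regular_frame L"

locale frame_homomorphism = L: frame L + M: frame M for L M :: "'u gorder" +
  fixes h :: "'u \<Rightarrow> 'u"
  assumes hom_closed [simp]: "x \<in> carrier L \<Longrightarrow> h x \<in> carrier M"
    and frame_hom: "frame_hom L M h"
begin

lemma hom_top: "h \<top>\<^bsub>L\<^esub> = \<top>\<^bsub>M\<^esub>"
  and hom_meet: "a \<in> carrier L \<Longrightarrow> b \<in> carrier L \<Longrightarrow> h (a \<sqinter>\<^bsub>L\<^esub> b) = h a \<sqinter>\<^bsub>M\<^esub> h b"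
  and hom_Sup: "A \<subseteq> carrier L \<Longrightarrow> h (\<Squnion>\<^bsub>L\<^esub> A) = \<Squnion>\<^bsub>M\<^esub> (h ` A)"
  using frame_hom by (auto simp: frame_hom_def)

lemma hom_join: "a \<in> carrier L \<Longrightarrow> b \<in> carrier L \<Longrightarrow> h (a \<squnion>\<^bsub>L\<^esub> b) = h a \<squnion>\<^bsub>M\<^esub> h b"
  by (simp add: join_def hom_Sup)

lemma hom_bottom: "h \<bottom>\<^bsub>L\<^esub> = \<bottom>\<^bsub>M\<^esub>"
  using hom_Sup[of "{}"] by (simp add: L.Sup_empty M.Sup_empty)

lemma hom_mono: "a \<in> carrier L \<Longrightarrow> b \<in> carrier L \<Longrightarrow> a \<sqsubseteq>\<^bsub>L\<^esub> b \<Longrightarrow> h a \<sqsubseteq>\<^bsub>M\<^esub> h b"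
  using hom_join[of a b] by (simp add: L.le_iff_meet M.le_iff_meet)

lemma hom_well_inside:
  assumes "a \<in> carrier L" "b \<in> carrier L" "well_inside L a b"
  shows "well_inside M (h a) (h b)"
proof -
  obtain w where "w \<in> carrier L" "a \<sqinter>\<^bsub>L\<^esub> w = \<bottom>\<^bsub>L\<^esub>" "b \<squnion>\<^bsub>L\<^esub> w = \<top>\<^bsub>L\<^esub>"
    by (rule L.well_insideE[OF assms(3)])
  then show ?thesis
    using hom_meet[of a w] hom_join[of b w] assms hom_top hom_bottom
    by (auto intro: M.well_insideI[of "h w"])
qed

end

lemma frame_hom_cong:
  assumes "complete_lattice L" and eq: "\<And>x. x \<in> carrier L \<Longrightarrow> h x = k x"
  shows "frame_hom L M h \<longleftrightarrow> frame_hom L M k"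
proof -
  interpret complete_lattice L by fact
  have "h ` A = k ` A" if "A \<subseteq> carrier L" for A using that eq by (intro image_cong) auto
  then show ?thesis by (simp add: frame_hom_def eq)
qed

lemma (in frame) frame_hom_restrict [simp]:
  "frame_hom L M (restrict h (carrier L)) \<longleftrightarrow> frame_hom L M h"
  by (rule frame_hom_cong[OF complete_lattice_axioms]) simp

lemma frame_hom_id: "frame_hom L L (\<lambda>x. x)"
  by (simp add: frame_hom_def)

lemma frame_hom_comp:
  assumes "h \<in> carrier L \<rightarrow> carrier M" "frame_hom L M h" "frame_hom M N k"
  shows "frame_hom L N (\<lambda>x. k (h x))"
proof -
  have "h ` A \<subseteq> carrier M" if "A \<subseteq> carrier L" for A using that assms(1) by auto
  moreover have "h x \<in> carrier M" if "x \<in> carrier L" for x using that assms(1) by auto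
  ultimately show ?thesis
    using assms(2,3) by (simp add: frame_hom_def image_image[symmetric])
qed

lemma order_iso_frame_hom:
  assumes "complete_lattice L" "complete_lattice M" and bij: "bij_betw h (carrier L) (carrier M)"
    and le_iff: "\<And>x y. x \<in> carrier L \<Longrightarrow> y \<in> carrier L \<Longrightarrow> h x \<sqsubseteq>\<^bsub>M\<^esub> h y \<longleftrightarrow> x \<sqsubseteq>\<^bsub>L\<^esub> y"
  shows "frame_hom L M h"
proof -
  interpret L: complete_lattice L by fact
  interpret M: complete_lattice M by fact
  have closed: "h x \<in> carrier M" if "x \<in> carrier L" for x using bij that
    by (auto simp: bij_betw_def)
  have surj: "\<exists>x\<in>carrier L. y = h x" if "y \<in> carrier M" for y using bij that
    by (auto simp: bij_betw_def)
  have "h \<top>\<^bsub>L\<^esub> = \<top>\<^bsub>M\<^esub>"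
    by (rule M.top_eq) (auto simp: closed le_iff dest!: surj)
  moreover have "h a \<sqinter>\<^bsub>M\<^esub> h b = h (a \<sqinter>\<^bsub>L\<^esub> b)" if "a \<in> carrier L" "b \<in> carrier L" for a b
    by (rule M.meet_eqI)
      (use that in \<open>auto simp: closed le_iff L.meet_left L.meet_right dest!: surj
        intro!: L.meet_le\<close>)
  moreover have "\<Squnion>\<^bsub>M\<^esub> (h ` A) = h (\<Squnion>\<^bsub>L\<^esub> A)" if A_sub: "A \<subseteq> carrier L" for A
  proof (rule M.Sup_eqI)
    show "y \<sqsubseteq>\<^bsub>M\<^esub> h (\<Squnion>\<^bsub>L\<^esub> A)" if "y \<in> h ` A" for y
      using that A_sub L.sup_upper[OF A_sub] by (auto simp: le_iff subset_iff)
    fix u assume "u \<in> carrier M" and upper: "\<And>y. y \<in> h ` A \<Longrightarrow> y \<sqsubseteq>\<^bsub>M\<^esub> u"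
    then obtain v where v_in: "v \<in> carrier L" "u = h v" using surj by blast
    have "x \<sqsubseteq>\<^bsub>L\<^esub> v" if "x \<in> A" for x using upper[of "h x"] that A_sub v_in le_iff by auto
    then show "h (\<Squnion>\<^bsub>L\<^esub> A) \<sqsubseteq>\<^bsub>M\<^esub> u" using A_sub v_in L.sup_least[OF A_sub] by (simp add: le_iff)
  qed (use A_sub closed in auto)
  ultimately show ?thesis unfolding frame_hom_def by simp
qed

abbreviation kreg_frames :: "'u set set \<Rightarrow> 'u gorder set" where
  "kreg_frames U \<equiv> {L. carrier L \<in> U \<and> kreg_frame L}"

lemma kreg_frm_eq:
  "kreg_frm U = concrete_cat (kreg_frames U) carrier frame_hom"
  by (auto simp: kreg_frm_def Let_def concrete_cat_def is_frame_iff kreg_frame_def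
    kreg_frame_axioms_def)

lemma is_category_kreg_frm: "is_category (kreg_frm U)"
  unfolding kreg_frm_eq
proof (rule is_category_concrete_cat)
  show "frame_hom L L (\<lambda>x\<in>carrier L. x)" if "L \<in> kreg_frames U" for L
    using that by (simp add: frame.frame_hom_restrict kreg_frame.axioms frame_hom_id)
  show "frame_hom L N (compose (carrier L) k h)"
    if "L \<in> kreg_frames U" "h \<in> carrier L \<rightarrow>\<^sub>E carrier M"
      "frame_hom L M h" "frame_hom M N k" for L M N h k
    using that frame_hom_comp[of h L M N k]
    by (simp add: compose_def frame.frame_hom_restrict kreg_frame.axioms PiE_def)
qed

lemma is_iso_kreg_frmI:
  assumes L_obj: "L \<in> Obj (kreg_frm U)" and M_obj: "M \<in> Obj (kreg_frm U)"
    and h_ext: "h \<in> extensional (carrier L)" and bij: "bij_betw h (carrier L) (carrier M)"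
    and le_iff: "\<And>x y. x \<in> carrier L \<Longrightarrow> y \<in> carrier L \<Longrightarrow> h x \<sqsubseteq>\<^bsub>M\<^esub> h y \<longleftrightarrow> x \<sqsubseteq>\<^bsub>L\<^esub> y"
  shows "is_iso (kreg_frm U) (L, h, M)"
proof -
  let ?k = "restrict (inv_into (carrier L) h) (carrier M)"
  interpret L: frame L using L_obj by (simp add: kreg_frm_eq kreg_frame_def)
  interpret M: frame M using M_obj by (simp add: kreg_frm_eq kreg_frame_def)
  have k_in: "?k y \<in> carrier L" "h (?k y) = y" if "y \<in> carrier M" for y
    using bij that inv_into_into[of y h "carrier L"] by (auto simp: bij_betw_def f_inv_into_f)
  have "frame_hom L M h"
    by (rule order_iso_frame_hom[OF L.complete_lattice_axioms M.complete_lattice_axioms bij le_iff])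
  moreover have "frame_hom M L ?k"
  proof (rule order_iso_frame_hom[OF M.complete_lattice_axioms L.complete_lattice_axioms])
    show "bij_betw ?k (carrier M) (carrier L)"
      using bij_betw_inv_into[OF bij] by (simp add: bij_betw_restrict_eq)
    show "?k x \<sqsubseteq>\<^bsub>L\<^esub> ?k y \<longleftrightarrow> x \<sqsubseteq>\<^bsub>M\<^esub> y" if "x \<in> carrier M" "y \<in> carrier M" for x y
      using le_iff[OF k_in(1)[OF that(1)] k_in(1)[OF that(2)]] k_in(2) that by simp
  qed
  ultimately show ?thesis
    using L_obj M_obj h_ext k_in bij_betw_apply[OF bij] bij_betw_inv_into_left[OF bij]
    unfolding kreg_frm_eq
    by (intro is_iso_concrete_catI[of _ _ _ _ _ _ ?k]) (auto simp: Arr_concrete_cat PiE_def)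
qed

subsection \<open>Regular elements\<close>

definition reg_interior :: "'u gorder \<Rightarrow> 'u \<Rightarrow> 'u" where
  "reg_interior L u = \<Squnion>\<^bsub>L\<^esub> {v \<in> carrier L. well_inside L v u}"

definition regs :: "'u gorder \<Rightarrow> 'u set" where
  "regs L = {u \<in> carrier L. reg_interior L u = u}"

definition reg_part :: "'u gorder \<Rightarrow> 'u gorder" where
  "reg_part L = L\<lparr>carrier := regs L\<rparr>"

lemma reg_part_simps [simp]:
  "carrier (reg_part L) = regs L" "x \<sqsubseteq>\<^bsub>reg_part L\<^esub> y \<longleftrightarrow> x \<sqsubseteq>\<^bsub>L\<^esub> y" "eq (reg_part L) = eq L"
  by (simp_all add: reg_part_def)

lemma regs_subset: "regs L \<subseteq> carrier L"
  by (auto simp: regs_def)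

lemma regs_carrier: "u \<in> regs L \<Longrightarrow> u \<in> carrier L"
  by (simp add: regs_def)

lemma reg_interior_regs: "u \<in> regs L \<Longrightarrow> reg_interior L u = u"
  by (simp add: regs_def)

lemma regular_frame_iff: "regular_frame L \<longleftrightarrow> (\<forall>b\<in>carrier L. reg_interior L b = b)"
  by (auto simp: regular_frame_def reg_interior_def)

context frame
begin

lemma reg_interior_closed [simp]: "reg_interior L u \<in> carrier L"
  by (auto simp: reg_interior_def)

lemma reg_interior_least:
  assumes "x \<in> carrier L" "\<And>v. v \<in> carrier L \<Longrightarrow> well_inside L v u \<Longrightarrow> v \<sqsubseteq> x"
  shows "reg_interior L u \<sqsubseteq> x"
  using assms by (auto simp: reg_interior_def intro!: sup_least)

lemma reg_interior_le: "u \<in> carrier L \<Longrightarrow> reg_interior L u \<sqsubseteq> u"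
  by (auto intro: reg_interior_least well_inside_le)

lemma le_reg_interior: "v \<in> carrier L \<Longrightarrow> well_inside L v u \<Longrightarrow> v \<sqsubseteq> reg_interior L u"
  by (auto simp: reg_interior_def intro!: sup_upper)

lemma reg_interior_mono:
  assumes "u \<in> carrier L" "u' \<in> carrier L" "u \<sqsubseteq> u'"
  shows "reg_interior L u \<sqsubseteq> reg_interior L u'"
proof (rule reg_interior_least)
  show "v \<sqsubseteq> reg_interior L u'" if "v \<in> carrier L" "well_inside L v u" for v
    using that assms well_inside_mono[of v v u u'] by (simp add: le_reg_interior)
qed simp

lemma regsI: "u \<in> carrier L \<Longrightarrow> u \<sqsubseteq> reg_interior L u \<Longrightarrow> u \<in> regs L"
  using reg_interior_le le_antisym[of "reg_interior L u" u] by (simp add: regs_def)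

lemma reg_interior_meet:
  assumes "a \<in> carrier L" "b \<in> carrier L"
  shows "reg_interior L (a \<sqinter> b) = reg_interior L a \<sqinter> reg_interior L b"
proof (rule le_antisym)
  show "reg_interior L (a \<sqinter> b) \<sqsubseteq> reg_interior L a \<sqinter> reg_interior L b"
    using assms by (intro meet_le reg_interior_mono) (auto simp: meet_left meet_right)
  have "v \<sqinter> reg_interior L a \<sqsubseteq> reg_interior L (a \<sqinter> b)"
    if v_in: "v \<in> carrier L" "well_inside L v b" for v
    unfolding reg_interior_def[of L a]
  proof (subst frame_distrib)
    show "\<Squnion>((\<lambda>x. v \<sqinter> x) ` {u \<in> carrier L. well_inside L u a}) \<sqsubseteq> reg_interior L (a \<sqinter> b)"
      by (rule sup_least)
        (use assms v_in in \<open>auto intro!: le_reg_interior well_inside_meet simp: meet_comm[of L v]\<close>)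
  qed (use v_in in auto)
  then show "reg_interior L a \<sqinter> reg_interior L b \<sqsubseteq> reg_interior L (a \<sqinter> b)"
    unfolding reg_interior_def[of L b]
    by (subst frame_distrib) (auto intro!: sup_least simp: meet_comm[of L "reg_interior L a"])
qed (use assms in auto)

lemma Sup_regs:
  assumes "A \<subseteq> regs L"
  shows "\<Squnion>A \<in> regs L"
proof (rule regsI)
  have A_sub: "A \<subseteq> carrier L" using assms regs_subset by (rule subset_trans)
  then show "\<Squnion>A \<in> carrier L" by simp
  have "x \<sqsubseteq> reg_interior L (\<Squnion>A)" if "x \<in> A" for x
    using reg_interior_mono[of x "\<Squnion>A"] reg_interior_regs[of x] sup_upper[OF A_sub that]
      subsetD[OF A_sub that] subsetD[OF assms that] A_sub by simp
  then show "\<Squnion>A \<sqsubseteq> reg_interior L (\<Squnion>A)" using A_sub by (auto intro: sup_least)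
qed

lemma meet_regs: "a \<in> regs L \<Longrightarrow> b \<in> regs L \<Longrightarrow> a \<sqinter> b \<in> regs L"
  by (auto simp: regs_def reg_interior_meet)

lemma top_regs: "\<top> \<in> regs L"
  using le_reg_interior[OF _ well_inside_top] by (auto intro: regsI)

lemma bottom_regs: "\<bottom> \<in> regs L"
  by (auto intro: regsI)

lemma complete_lattice_reg_part: "complete_lattice (reg_part L)"
proof (rule complete_latticeI_Sup)
  show "partial_order (reg_part L)"
    by standard (auto dest!: regs_carrier simp: eq_is_equal intro: le_antisym elim: le_trans)
  fix A assume "A \<subseteq> carrier (reg_part L)"
  then have A_sub: "A \<subseteq> regs L" "A \<subseteq> carrier L" using regs_subset[of L] by auto
  show "\<exists>s\<in>carrier (reg_part L). (\<forall>x\<in>A. x \<sqsubseteq>\<^bsub>reg_part L\<^esub> s) \<and>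
           (\<forall>u\<in>carrier (reg_part L). (\<forall>x\<in>A. x \<sqsubseteq>\<^bsub>reg_part L\<^esub> u) \<longrightarrow> s \<sqsubseteq>\<^bsub>reg_part L\<^esub> u)"
    by (rule bexI[of _ "\<Squnion>A"])
      (use A_sub Sup_regs[OF A_sub(1)] in \<open>auto dest: regs_carrier intro!: sup_upper sup_least\<close>)
qed

interpretation R: complete_lattice "reg_part L"
  by (rule complete_lattice_reg_part)

lemma Sup_reg_part: "A \<subseteq> regs L \<Longrightarrow> \<Squnion>\<^bsub>reg_part L\<^esub> A = \<Squnion>A"
  by (rule R.Sup_eqI) (use Sup_regs[of A] regs_subset[of L] in \<open>auto intro!: sup_upper sup_least\<close>)

lemma meet_reg_part: "a \<in> regs L \<Longrightarrow> b \<in> regs L \<Longrightarrow> a \<sqinter>\<^bsub>reg_part L\<^esub> b = a \<sqinter> b"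
  by (rule R.meet_eqI)
    (use meet_regs regs_carrier[of _ L] in \<open>auto intro!: meet_le simp: meet_left meet_right\<close>)

lemma join_reg_part: "a \<in> regs L \<Longrightarrow> b \<in> regs L \<Longrightarrow> a \<squnion>\<^bsub>reg_part L\<^esub> b = a \<squnion> b"
  by (simp add: join_def Sup_reg_part)

lemma top_reg_part: "\<top>\<^bsub>reg_part L\<^esub> = \<top>"
  by (rule R.top_eq[symmetric]) (use top_regs regs_carrier[of _ L] in auto)

lemma bottom_reg_part: "\<bottom>\<^bsub>reg_part L\<^esub> = \<bottom>"
  by (rule R.bottom_eq[symmetric]) (use bottom_regs regs_carrier[of _ L] in auto)

lemma frame_reg_part: "frame (reg_part L)"
proof unfold_locales
  fix a A assume "a \<in> carrier (reg_part L)" "A \<subseteq> carrier (reg_part L)"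
  then have reg: "a \<in> regs L" "A \<subseteq> regs L" by auto
  have "(\<lambda>x. a \<sqinter>\<^bsub>reg_part L\<^esub> x) ` A = (\<lambda>x. a \<sqinter> x) ` A"
    using reg meet_reg_part by (intro image_cong) auto
  moreover have "(\<lambda>x. a \<sqinter> x) ` A \<subseteq> regs L" using reg meet_regs by blast
  moreover have "a \<sqinter> \<Squnion>A = \<Squnion>((\<lambda>x. a \<sqinter> x) ` A)"
    using reg regs_subset[of L] by (intro frame_distrib) auto
  ultimately show "a \<sqinter>\<^bsub>reg_part L\<^esub> \<Squnion>\<^bsub>reg_part L\<^esub> A =
      \<Squnion>\<^bsub>reg_part L\<^esub> ((\<lambda>x. a \<sqinter>\<^bsub>reg_part L\<^esub> x) ` A)"
    using reg by (simp add: Sup_reg_part meet_reg_part Sup_regs)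
qed

lemma compact_frame_reg_part:
  assumes "compact_frame L"
  shows "compact_frame (reg_part L)"
  unfolding compact_frame_def
proof (intro allI impI)
  fix A assume "A \<subseteq> carrier (reg_part L)" "directed_in (reg_part L) A"
    "\<Squnion>\<^bsub>reg_part L\<^esub> A = \<top>\<^bsub>reg_part L\<^esub>"
  then have "A \<subseteq> carrier L" "directed_in L A" "\<Squnion>A = \<top>"
    using regs_subset[of L] by (auto simp: directed_in_def Sup_reg_part top_reg_part)
  then show "\<top>\<^bsub>reg_part L\<^esub> \<in> A" using assms by (simp add: compact_frame_def top_reg_part)
qed

end

lemma (in frame_homomorphism) hom_regs:
  assumes "u \<in> regs L"
  shows "h u \<in> regs M"
proof (rule M.regsI)
  have u_in: "u \<in> carrier L" using assms by (rule regs_carrier)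
  then show "h u \<in> carrier M" by simp
  have "h u = h (reg_interior L u)" using assms by (simp add: reg_interior_regs)
  also have "\<dots> = \<Squnion>\<^bsub>M\<^esub> (h ` {v \<in> carrier L. well_inside L v u})"
    unfolding reg_interior_def by (rule hom_Sup) auto
  also have "\<dots> \<sqsubseteq>\<^bsub>M\<^esub> reg_interior M (h u)"
    by (rule M.sup_least) (auto intro!: M.le_reg_interior hom_well_inside u_in)
  finally show "h u \<sqsubseteq>\<^bsub>M\<^esub> reg_interior M (h u)" .
qed

lemma (in frame_homomorphism) frame_homomorphism_reg_part:
  "frame_homomorphism (reg_part L) (reg_part M) h"
proof (intro frame_homomorphism.intro frame_homomorphism_axioms.intro L.frame_reg_part
    M.frame_reg_part)
  show "h x \<in> carrier (reg_part M)" if "x \<in> carrier (reg_part L)" for x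
    using that hom_regs by simp
  have "h ` A \<subseteq> regs M" if "A \<subseteq> regs L" for A using that hom_regs by auto
  then show "frame_hom (reg_part L) (reg_part M) h"
    using regs_subset[of L] unfolding frame_hom_def
    by (auto simp: L.Sup_reg_part M.Sup_reg_part L.meet_reg_part M.meet_reg_part L.top_reg_part
        M.top_reg_part hom_top hom_meet hom_regs hom_Sup regs_carrier)
qed

text \<open>Normality is what regularity of an internal frame leaves behind at each stage.\<close>

locale normal_frame = frame +
  assumes normal: "u \<in> carrier L \<Longrightarrow> w \<in> carrier L \<Longrightarrow> u \<squnion> w = \<top> \<Longrightarrow>
    \<exists>v\<in>carrier L. well_inside L v u \<and> v \<squnion> w = \<top>"
begin

lemma interpolate:
  assumes "u \<in> carrier L" "well_inside L v u"
  obtains v' where "v' \<in> carrier L" "well_inside L v v'" "well_inside L v' u"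
proof -
  obtain w where w_in: "w \<in> carrier L" "v \<sqinter> w = \<bottom>" "u \<squnion> w = \<top>" by (rule well_insideE[OF assms(2)])
  then obtain v' where "v' \<in> carrier L" "well_inside L v' u" "v' \<squnion> w = \<top>"
    using normal[OF assms(1)] by blast
  then show ?thesis using that well_insideI w_in by blast
qed

lemma reg_interior_in_regs:
  assumes "u \<in> carrier L"
  shows "reg_interior L u \<in> regs L"
proof (rule regsI)
  have "v \<sqsubseteq> reg_interior L (reg_interior L u)" if v_in: "v \<in> carrier L" "well_inside L v u" for v
  proof -
    obtain v' where v'_in: "v' \<in> carrier L" "well_inside L v v'" "well_inside L v' u"
      using interpolate[OF assms v_in(2)] by blast
    then have "v' \<sqsubseteq> reg_interior L u" by (simp add: le_reg_interior)
    then have "well_inside L v (reg_interior L u)"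
      using well_inside_mono[of v v v' "reg_interior L u"] v_in v'_in by auto
    then show ?thesis by (rule le_reg_interior[OF v_in(1)])
  qed
  then show "reg_interior L u \<sqsubseteq> reg_interior L (reg_interior L u)"
    by (auto intro: reg_interior_least)
qed auto

lemma well_inside_reg_part:
  assumes v_in: "v \<in> carrier L" and u_reg: "u \<in> regs L" and "well_inside L v u"
  shows "well_inside (reg_part L) (reg_interior L v) u"
proof -
  have u_in: "u \<in> carrier L" using u_reg by (rule regs_carrier)
  obtain w where w_in: "w \<in> carrier L" "v \<sqinter> w = \<bottom>" "u \<squnion> w = \<top>" by (rule well_insideE[OF assms(3)])
  then obtain w' where w'_in: "w' \<in> carrier L" "well_inside L w' w" "w' \<squnion> u = \<top>"
    using normal[OF w_in(1) u_in] by (auto simp: join_comm[of L])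
  have "u \<squnion> reg_interior L w = \<top>"
    using join_top_mono[of u w' u "reg_interior L w"] le_reg_interior[OF w'_in(1,2)] u_in w'_in
    by (simp add: join_comm[of L])
  moreover have "reg_interior L v \<sqinter> reg_interior L w = \<bottom>"
    using meet_bottom_mono[of "reg_interior L v" "reg_interior L w" v w] v_in w_in
    by (simp add: reg_interior_le)
  ultimately show ?thesis
    using reg_interior_in_regs v_in w_in(1) u_reg unfolding well_inside_def
    by (intro bexI[of _ "reg_interior L w"])
      (simp_all add: meet_reg_part join_reg_part top_reg_part bottom_reg_part)
qed

lemma regular_frame_reg_part: "regular_frame (reg_part L)"
  unfolding regular_frame_iff
proof
  interpret R: frame "reg_part L" by (rule frame_reg_part)
  fix u assume "u \<in> carrier (reg_part L)"
  then have u_reg: "u \<in> regs L" "u \<in> carrier L" using regs_carrier[of u] by auto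
  have interior_in: "reg_interior (reg_part L) u \<in> carrier L"
    using R.reg_interior_closed[of u] regs_carrier by simp
  have "v \<sqsubseteq> reg_interior (reg_part L) u" if v_in: "v \<in> carrier L" "well_inside L v u" for v
  proof -
    obtain v' where v'_in: "v' \<in> carrier L" "well_inside L v v'" "well_inside L v' u"
      using interpolate[OF u_reg(2) v_in(2)] by blast
    have "v \<sqsubseteq> reg_interior L v'" by (rule le_reg_interior[OF v_in(1) v'_in(2)])
    moreover have "reg_interior L v' \<sqsubseteq> reg_interior (reg_part L) u"
      using R.le_reg_interior[OF _ well_inside_reg_part[OF v'_in(1) u_reg(1) v'_in(3)]]
        reg_interior_in_regs[OF v'_in(1)] by simp
    ultimately show ?thesis by (rule le_trans[OF _ _ v_in(1) reg_interior_closed interior_in])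
  qed
  then have "u \<sqsubseteq> reg_interior (reg_part L) u"
    using reg_interior_least[OF interior_in, of u] reg_interior_regs[OF u_reg(1)] by simp
  moreover have "reg_interior (reg_part L) u \<sqsubseteq> u" using R.reg_interior_le[of u] u_reg(1) by simp
  ultimately show "reg_interior (reg_part L) u = u" using interior_in u_reg(2) by (intro le_antisym)
qed

lemma kreg_frame_reg_part: "compact_frame L \<Longrightarrow> kreg_frame (reg_part L)"
  by (intro kreg_frame.intro kreg_frame_axioms.intro frame_reg_part compact_frame_reg_part
      regular_frame_reg_part)

end

section \<open>Kripke--Joyal semantics\<close>

declare forces.simps [simp del]

fun fm_vars :: "fm \<Rightarrow> nat set" where
  "fm_vars (FLe x y) = {x, y}"
| "fm_vars (FEq x y) = {x, y}"
| "fm_vars (FMem x A) = {x}"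
| "fm_vars (FAnd p q) = fm_vars p \<union> fm_vars q"
| "fm_vars (FImp p q) = fm_vars p \<union> fm_vars q"
| "fm_vars (FAll x p) = fm_vars p - {x}"
| "fm_vars (FEx x p) = fm_vars p - {x}"
| "fm_vars (FAllP A p) = fm_vars p"

fun fm_set_vars :: "fm \<Rightarrow> nat set" where
  "fm_set_vars (FLe x y) = {}"
| "fm_set_vars (FEq x y) = {}"
| "fm_set_vars (FMem x A) = {A}"
| "fm_set_vars (FAnd p q) = fm_set_vars p \<union> fm_set_vars q"
| "fm_set_vars (FImp p q) = fm_set_vars p \<union> fm_set_vars q"
| "fm_set_vars (FAll x p) = fm_set_vars p"
| "fm_set_vars (FEx x p) = fm_set_vars p"
| "fm_set_vars (FAllP A p) = fm_set_vars p - {A}"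

lemma fm_vars_simps [simp]:
  "fm_vars (p \<^bold>\<longleftrightarrow> q) = fm_vars p \<union> fm_vars q"
  "fm_vars (fm_top t) = {t}"
  "fm_vars (fm_bot z) = {z}"
  "fm_vars (fm_meet a b m) = {a, b, m}"
  "fm_vars (fm_join a b j) = {a, b, j}"
  "fm_vars (fm_Join A s) = {s}"
  "fm_vars (fm_directed A) = {}"
  by (auto simp: FIff_def fm_top_def fm_bot_def fm_meet_def fm_join_def fm_Join_def fm_directed_def
      Let_def)

lemma fm_set_vars_simps [simp]:
  "fm_set_vars (p \<^bold>\<longleftrightarrow> q) = fm_set_vars p \<union> fm_set_vars q"
  "fm_set_vars (fm_top t) = {}"
  "fm_set_vars (fm_bot z) = {}"
  "fm_set_vars (fm_meet a b m) = {}"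
  "fm_set_vars (fm_join a b j) = {}"
  "fm_set_vars (fm_Join A s) = {A}"
  "fm_set_vars (fm_directed A) = {A}"
  by (auto simp: FIff_def fm_top_def fm_bot_def fm_meet_def fm_join_def fm_Join_def fm_directed_def
      Let_def)

lemma fm_vars_well_inside [simp]:
  "fm_vars (fm_well_inside a b) = {a, b}" "fm_set_vars (fm_well_inside a b) = {}"
  by (simp_all add: fm_well_inside_def Let_def insert_Diff_if insert_commute)

lemma forces_cong:
  assumes "\<And>x. x \<in> fm_vars p \<Longrightarrow> \<rho> x = \<rho>' x" "\<And>A. A \<in> fm_set_vars p \<Longrightarrow> \<sigma> A = \<sigma>' A"
  shows "forces C L c \<rho> \<sigma> p \<longleftrightarrow> forces C L c \<rho>' \<sigma>' p"
  using assms
proof (induction p arbitrary: c \<rho> \<rho>' \<sigma> \<sigma>')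
  case (FAnd p q)
  have "forces C L c \<rho> \<sigma> p \<longleftrightarrow> forces C L c \<rho>' \<sigma>' p" "forces C L c \<rho> \<sigma> q \<longleftrightarrow> forces C L c \<rho>' \<sigma>' q"
    by (rule FAnd.IH; simp add: FAnd.prems)+
  then show ?case by (simp only: forces.simps)
next
  case (FImp p q)
  have "forces C L d (r \<circ> \<rho>) (s \<circ> \<sigma>) p \<longleftrightarrow> forces C L d (r \<circ> \<rho>') (s \<circ> \<sigma>') p"
    "forces C L d (r \<circ> \<rho>) (s \<circ> \<sigma>) q \<longleftrightarrow> forces C L d (r \<circ> \<rho>') (s \<circ> \<sigma>') q" for d r s
    by (rule FImp.IH; simp add: FImp.prems)+
  then show ?case by (simp only: forces.simps)
next
  case (FAll x p)
  have "forces C L d ((r \<circ> \<rho>)(x := a)) (s \<circ> \<sigma>) p \<longleftrightarrow> forces C L d ((r \<circ> \<rho>')(x := a)) (s \<circ> \<sigma>') p"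
    for d r s a by (rule FAll.IH) (simp_all add: FAll.prems)
  then show ?case by (simp only: forces.simps)
next
  case (FEx x p)
  have "forces C L c (\<rho>(x := a)) \<sigma> p \<longleftrightarrow> forces C L c (\<rho>'(x := a)) \<sigma>' p" for a
    by (rule FEx.IH) (simp_all add: FEx.prems)
  then show ?case by (simp only: forces.simps)
next
  case (FAllP A p)
  have "forces C L d (r \<circ> \<rho>) ((s \<circ> \<sigma>)(A := S)) p \<longleftrightarrow> forces C L d (r \<circ> \<rho>') ((s \<circ> \<sigma>')(A := S)) p"
    for d r s S by (rule FAllP.IH) (simp_all add: FAllP.prems)
  then show ?case by (simp only: forces.simps)
qed (simp_all add: forces.simps)

locale psh_relation = cat C for C :: "('o, 'a) category" +
  fixes U :: "'u set set" and L :: "('o, 'a, 'u) psh_rel"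
  assumes psh: "fst L \<in> Obj (presheaf_topos U C)"
    and rel_subset: "c \<in> Obj C \<Longrightarrow> snd L c \<subseteq> FObj (fst L) c \<times> FObj (fst L) c"
    and rel_restrict: "f \<in> Arr C \<Longrightarrow> (x, y) \<in> snd L (Cod C f) \<Longrightarrow>
      (psh_restrict (fst L) f x, psh_restrict (fst L) f y) \<in> snd L (Dom C f)"
begin

abbreviation X :: "'o \<Rightarrow> 'u set" where "X c \<equiv> FObj (fst L) c"
abbreviation res :: "'a \<Rightarrow> 'u \<Rightarrow> 'u" where "res f \<equiv> psh_restrict (fst L) f"
abbreviation le :: "'o \<Rightarrow> 'u \<Rightarrow> 'u \<Rightarrow> bool" where "le c x y \<equiv> (x, y) \<in> snd L c"
abbreviation Pw :: "'o \<Rightarrow> ('a \<times> 'u) set set" where "Pw c \<equiv> psh_power C (fst L) c"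
abbreviation pres :: "'a \<Rightarrow> ('a \<times> 'u) set \<Rightarrow> ('a \<times> 'u) set" where "pres f \<equiv> power_restrict C f"

sublocale presheaf: concrete_presheaf C U "\<lambda>A. A" "\<lambda>A B f. True" "fst L"
  using psh by unfold_locales (simp add: presheaf_topos_def set_cat_eq)

lemma X_in_U: "c \<in> Obj C \<Longrightarrow> X c \<in> U"
  by simp

lemma res_closed [simp, intro]: "f \<in> into C c \<Longrightarrow> x \<in> X c \<Longrightarrow> res f x \<in> X (Dom C f)"
  unfolding psh_restrict_eq by (rule presheaf.act_closed)

lemma res_id [simp]: "c \<in> Obj C \<Longrightarrow> x \<in> X c \<Longrightarrow> res (Idt C c) x = x"
  unfolding psh_restrict_eq by (rule presheaf.act_id)

lemma res_comp [simp]: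
  "f \<in> into C c \<Longrightarrow> g \<in> into C (Dom C f) \<Longrightarrow> x \<in> X c \<Longrightarrow> res (Cmp C f g) x = res g (res f x)"
  unfolding psh_restrict_eq by (rule presheaf.act_comp)

lemma le_in_X:
  assumes "c \<in> Obj C" "le c x y"
  shows "x \<in> X c" "y \<in> X c"
  using rel_subset assms by blast+

lemma le_res: "f \<in> into C c \<Longrightarrow> le c x y \<Longrightarrow> le (Dom C f) (res f x) (res f y)"
  using rel_restrict by (auto simp: into_def)

lemma PwD:
  assumes "S \<in> Pw c" "(f, x) \<in> S"
  shows "f \<in> into C c" "x \<in> X (Dom C f)"
    and "g \<in> into C (Dom C f) \<Longrightarrow> (Cmp C f g, res g x) \<in> S"
  using assms by (auto simp: psh_power_def into_def)

lemma PwI: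
  assumes "\<And>f x. (f, x) \<in> S \<Longrightarrow> f \<in> into C c \<and> x \<in> X (Dom C f)"
    and "\<And>f x g. (f, x) \<in> S \<Longrightarrow> g \<in> into C (Dom C f) \<Longrightarrow> (Cmp C f g, res g x) \<in> S"
  shows "S \<in> Pw c"
  using assms by (fastforce simp: psh_power_def into_def)

lemma empty_Pw [simp]: "{} \<in> Pw c"
  by (simp add: psh_power_def)

lemma mem_pres: "(g, x) \<in> pres f S \<longleftrightarrow> g \<in> into C (Dom C f) \<and> (Cmp C f g, x) \<in> S"
  by (auto simp: power_restrict_def into_def)

lemma pres_closed [simp, intro]:
  assumes "f \<in> into C c" "S \<in> Pw c"
  shows "pres f S \<in> Pw (Dom C f)"
proof (rule PwI)
  fix g x assume "(g, x) \<in> pres f S"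
  then have g_into: "g \<in> into C (Dom C f)" "(Cmp C f g, x) \<in> S" by (auto simp: mem_pres)
  then show "g \<in> into C (Dom C f) \<and> x \<in> X (Dom C g)"
    using PwD(2)[OF assms(2) g_into(2)] assms by simp
  show "(Cmp C g h, res h x) \<in> pres f S" if "h \<in> into C (Dom C g)" for h
    using PwD(3)[OF assms(2) g_into(2), of h] g_into assms that by (simp add: mem_pres)
qed

lemma pres_id [simp]:
  assumes "c \<in> Obj C" "S \<in> Pw c"
  shows "pres (Idt C c) S = S"
proof -
  have "(g, x) \<in> pres (Idt C c) S \<longleftrightarrow> (g, x) \<in> S" for g x
    using assms PwD(1)[OF assms(2), of g x] by (auto simp: mem_pres)
  then show ?thesis by auto
qed

lemma pres_comp [simp]:
  assumes "f \<in> into C c" "g \<in> into C (Dom C f)"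
  shows "pres (Cmp C f g) S = pres g (pres f S)"
proof -
  have "(h, x) \<in> pres (Cmp C f g) S \<longleftrightarrow> (h, x) \<in> pres g (pres f S)" for h x
    using assms by (auto simp: mem_pres)
  then show ?thesis by auto
qed

lemma ball_into: "(\<forall>f\<in>Arr C. Cod C f = c \<longrightarrow> P f) \<longleftrightarrow> (\<forall>f\<in>into C c. P f)"
  by (auto simp: into_def)

lemma forces_FAll: "forces C L c \<rho> \<sigma> (FAll x p) \<longleftrightarrow> (\<forall>f\<in>into C c. \<forall>a\<in>X (Dom C f).
     forces C L (Dom C f) ((res f \<circ> \<rho>)(x := a)) (pres f \<circ> \<sigma>) p)"
  by (simp add: ball_into forces.simps)

lemma forces_FImp: "forces C L c \<rho> \<sigma> (FImp p q) \<longleftrightarrow> (\<forall>f\<in>into C c.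
     forces C L (Dom C f) (res f \<circ> \<rho>) (pres f \<circ> \<sigma>) p \<longrightarrow>
     forces C L (Dom C f) (res f \<circ> \<rho>) (pres f \<circ> \<sigma>) q)"
  by (simp add: ball_into forces.simps)

lemma forces_FAllP: "forces C L c \<rho> \<sigma> (FAllP A p) \<longleftrightarrow> (\<forall>f\<in>into C c. \<forall>S\<in>Pw (Dom C f).
     forces C L (Dom C f) (res f \<circ> \<rho>) ((pres f \<circ> \<sigma>)(A := S)) p)"
  by (simp add: ball_into forces.simps)

lemmas forces_simps = forces.simps(1-4,7) forces_FAll forces_FImp forces_FAllP

definition valuation :: "'o \<Rightarrow> (nat \<Rightarrow> 'u) \<Rightarrow> (nat \<Rightarrow> ('a \<times> 'u) set) \<Rightarrow> fm \<Rightarrow> bool" where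
  "valuation c \<rho> \<sigma> p \<longleftrightarrow> (\<forall>x\<in>fm_vars p. \<rho> x \<in> X c) \<and> (\<forall>A\<in>fm_set_vars p. \<sigma> A \<in> Pw c)"

lemma valuation_FAnd [simp]:
  "valuation c \<rho> \<sigma> (p \<^bold>\<and> q) \<longleftrightarrow> valuation c \<rho> \<sigma> p \<and> valuation c \<rho> \<sigma> q"
  by (auto simp: valuation_def)

lemma valuation_FImp [simp]:
  "valuation c \<rho> \<sigma> (p \<^bold>\<longrightarrow> q) \<longleftrightarrow> valuation c \<rho> \<sigma> p \<and> valuation c \<rho> \<sigma> q"
  by (auto simp: valuation_def)

lemma valuation_FAll:
  "valuation c \<rho> \<sigma> (FAll x p) \<longleftrightarrow>
     (\<forall>y\<in>fm_vars p. y \<noteq> x \<longrightarrow> \<rho> y \<in> X c) \<and> (\<forall>A\<in>fm_set_vars p. \<sigma> A \<in> Pw c)"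
  by (auto simp: valuation_def)

lemma forces_FAllD:
  assumes "c \<in> Obj C" "forces C L c \<rho> \<sigma> (FAll x p)" "a \<in> X c" "valuation c (\<rho>(x := a)) \<sigma> p"
  shows "forces C L c (\<rho>(x := a)) \<sigma> p"
proof -
  have "forces C L c ((res (Idt C c) \<circ> \<rho>)(x := a)) (pres (Idt C c) \<circ> \<sigma>) p"
    using assms(1-3) by (auto simp: forces_FAll dest!: bspec[OF _ into_id])
  moreover have "forces C L c ((res (Idt C c) \<circ> \<rho>)(x := a)) (pres (Idt C c) \<circ> \<sigma>) p \<longleftrightarrow>
      forces C L c (\<rho>(x := a)) \<sigma> p"
    by (rule forces_cong) (use assms(1,4) in \<open>auto simp: valuation_def\<close>)
  ultimately show ?thesis by blast
qed

lemma forces_FAllPD: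
  assumes "c \<in> Obj C" "forces C L c \<rho> \<sigma> (FAllP A p)" "S \<in> Pw c" "valuation c \<rho> (\<sigma>(A := S)) p"
  shows "forces C L c \<rho> (\<sigma>(A := S)) p"
proof -
  have "forces C L c (res (Idt C c) \<circ> \<rho>) ((pres (Idt C c) \<circ> \<sigma>)(A := S)) p"
    using assms(1-3) by (auto simp: forces_FAllP dest!: bspec[OF _ into_id])
  moreover have "forces C L c (res (Idt C c) \<circ> \<rho>) ((pres (Idt C c) \<circ> \<sigma>)(A := S)) p \<longleftrightarrow>
      forces C L c \<rho> (\<sigma>(A := S)) p"
    by (rule forces_cong) (use assms(1,4) in \<open>auto simp: valuation_def\<close>)
  ultimately show ?thesis by blast
qed

lemma forces_FImpD:
  assumes c_obj: "c \<in> Obj C" and "forces C L c \<rho> \<sigma> (p \<^bold>\<longrightarrow> q)" "forces C L c \<rho> \<sigma> p"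
    and "valuation c \<rho> \<sigma> p" "valuation c \<rho> \<sigma> q"
  shows "forces C L c \<rho> \<sigma> q"
proof -
  have "forces C L c (res (Idt C c) \<circ> \<rho>) (pres (Idt C c) \<circ> \<sigma>) r \<longleftrightarrow> forces C L c \<rho> \<sigma> r"
    if "valuation c \<rho> \<sigma> r" for r
    by (rule forces_cong) (use c_obj that in \<open>auto simp: valuation_def\<close>)
  then show ?thesis using assms by (auto simp: forces_FImp dest!: bspec[OF _ into_id])
qed

lemma forces_FAll_FImp:
  assumes val: "valuation c \<rho> \<sigma> (FAll x (p \<^bold>\<longrightarrow> q))"
  shows "forces C L c \<rho> \<sigma> (FAll x (p \<^bold>\<longrightarrow> q)) \<longleftrightarrow> (\<forall>f\<in>into C c. \<forall>a\<in>X (Dom C f).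
    forces C L (Dom C f) ((res f \<circ> \<rho>)(x := a)) (pres f \<circ> \<sigma>) p \<longrightarrow>
    forces C L (Dom C f) ((res f \<circ> \<rho>)(x := a)) (pres f \<circ> \<sigma>) q)" (is "?lhs \<longleftrightarrow> ?rhs")
proof
  assume lhs: ?lhs
  show ?rhs
  proof (intro ballI impI)
    fix f a assume f_into: "f \<in> into C c" and a_in: "a \<in> X (Dom C f)"
      and p_forced: "forces C L (Dom C f) ((res f \<circ> \<rho>)(x := a)) (pres f \<circ> \<sigma>) p"
    have "forces C L (Dom C f) ((res f \<circ> \<rho>)(x := a)) (pres f \<circ> \<sigma>) (p \<^bold>\<longrightarrow> q)"
      using lhs f_into a_in unfolding forces_FAll by blast
    then show "forces C L (Dom C f) ((res f \<circ> \<rho>)(x := a)) (pres f \<circ> \<sigma>) q"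
      by (rule forces_FImpD[OF into_dom[OF f_into] _ p_forced])
        (use val f_into a_in in \<open>auto simp: valuation_def\<close>)
  qed
next
  assume rhs: ?rhs
  show ?lhs unfolding forces_FAll forces_FImp
  proof (intro ballI)
    fix f a g assume f_into: "f \<in> into C c" and a_in: "a \<in> X (Dom C f)"
      and g_into: "g \<in> into C (Dom C f)"
    have "forces C L (Dom C g) (res g \<circ> (res f \<circ> \<rho>)(x := a)) (pres g \<circ> (pres f \<circ> \<sigma>)) s \<longleftrightarrow>
        forces C L (Dom C g) ((res (Cmp C f g) \<circ> \<rho>)(x := res g a)) (pres (Cmp C f g) \<circ> \<sigma>) s"
      if "s = p \<or> s = q" for s
      by (rule forces_cong) (use that val f_into g_into in \<open>auto simp: valuation_def\<close>)
    then show "forces C L (Dom C g) (res g \<circ> (res f \<circ> \<rho>)(x := a)) (pres g \<circ> (pres f \<circ> \<sigma>)) p \<longrightarrow>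
        forces C L (Dom C g) (res g \<circ> (res f \<circ> \<rho>)(x := a)) (pres g \<circ> (pres f \<circ> \<sigma>)) q"
      using rhs[THEN bspec, OF into_comp[OF f_into g_into], THEN bspec, of "res g a"] f_into a_in
        g_into by simp
  qed
qed

lemma forces_FAll_FIff:
  assumes "valuation c \<rho> \<sigma> (FAll x (p \<^bold>\<longleftrightarrow> q))"
  shows "forces C L c \<rho> \<sigma> (FAll x (p \<^bold>\<longleftrightarrow> q)) \<longleftrightarrow> (\<forall>f\<in>into C c. \<forall>a\<in>X (Dom C f).
    forces C L (Dom C f) ((res f \<circ> \<rho>)(x := a)) (pres f \<circ> \<sigma>) p \<longleftrightarrow>
    forces C L (Dom C f) ((res f \<circ> \<rho>)(x := a)) (pres f \<circ> \<sigma>) q)"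
proof -
  have "forces C L c \<rho> \<sigma> (FAll x (p \<^bold>\<longleftrightarrow> q)) \<longleftrightarrow>
      forces C L c \<rho> \<sigma> (FAll x (p \<^bold>\<longrightarrow> q)) \<and> forces C L c \<rho> \<sigma> (FAll x (q \<^bold>\<longrightarrow> p))"
    by (auto simp: FIff_def forces_FAll forces.simps(4))
  moreover have "valuation c \<rho> \<sigma> (FAll x (p \<^bold>\<longrightarrow> q))" "valuation c \<rho> \<sigma> (FAll x (q \<^bold>\<longrightarrow> p))"
    using assms by (auto simp: valuation_def)
  ultimately show ?thesis by (auto simp: forces_FAll_FImp)
qed

lemma forces_FImp_mono:
  assumes "f \<in> into C c" "valuation c \<rho> \<sigma> (p \<^bold>\<longrightarrow> q)" "forces C L c \<rho> \<sigma> (p \<^bold>\<longrightarrow> q)"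
  shows "forces C L (Dom C f) (res f \<circ> \<rho>) (pres f \<circ> \<sigma>) (p \<^bold>\<longrightarrow> q)"
  unfolding forces_FImp
proof
  fix g assume g_into: "g \<in> into C (Dom C f)"
  have "forces C L d (res g \<circ> (res f \<circ> \<rho>)) (pres g \<circ> (pres f \<circ> \<sigma>)) r \<longleftrightarrow>
      forces C L d (res (Cmp C f g) \<circ> \<rho>) (pres (Cmp C f g) \<circ> \<sigma>) r" if "r = p \<or> r = q" for d r
    by (rule forces_cong) (use that g_into assms(1,2) in \<open>auto simp: valuation_def\<close>)
  then show "forces C L (Dom C g) (res g \<circ> (res f \<circ> \<rho>)) (pres g \<circ> (pres f \<circ> \<sigma>)) p \<longrightarrow>
      forces C L (Dom C g) (res g \<circ> (res f \<circ> \<rho>)) (pres g \<circ> (pres f \<circ> \<sigma>)) q"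
    using assms(3)[unfolded forces_FImp, THEN bspec, OF into_comp[OF assms(1) g_into]]
      assms(1) g_into by simp
qed

lemma forces_FAll_mono:
  assumes "f \<in> into C c" "valuation c \<rho> \<sigma> (FAll x p)" "forces C L c \<rho> \<sigma> (FAll x p)"
  shows "forces C L (Dom C f) (res f \<circ> \<rho>) (pres f \<circ> \<sigma>) (FAll x p)"
  unfolding forces_FAll
proof (intro ballI)
  fix g a assume g_into: "g \<in> into C (Dom C f)" and a_in: "a \<in> X (Dom C g)"
  have "forces C L d ((res g \<circ> (res f \<circ> \<rho>))(x := a)) (pres g \<circ> (pres f \<circ> \<sigma>)) p \<longleftrightarrow>
      forces C L d ((res (Cmp C f g) \<circ> \<rho>)(x := a)) (pres (Cmp C f g) \<circ> \<sigma>) p" for d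
    by (rule forces_cong) (use g_into assms(1,2) in \<open>auto simp: valuation_def\<close>)
  then show "forces C L (Dom C g) ((res g \<circ> (res f \<circ> \<rho>))(x := a)) (pres g \<circ> (pres f \<circ> \<sigma>)) p"
    using assms(3)[unfolded forces_FAll, THEN bspec, OF into_comp[OF assms(1) g_into]]
      assms(1) g_into a_in by simp
qed

lemma forces_FAllP_mono:
  assumes "f \<in> into C c" "valuation c \<rho> \<sigma> (FAllP A p)" "forces C L c \<rho> \<sigma> (FAllP A p)"
  shows "forces C L (Dom C f) (res f \<circ> \<rho>) (pres f \<circ> \<sigma>) (FAllP A p)"
  unfolding forces_FAllP
proof (intro ballI)
  fix g S assume g_into: "g \<in> into C (Dom C f)" and S_Pw: "S \<in> Pw (Dom C g)"
  have "forces C L (Dom C g) (res (Cmp C f g) \<circ> \<rho>) ((pres (Cmp C f g) \<circ> \<sigma>)(A := S)) p"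
    using assms(3)[unfolded forces_FAllP, THEN bspec, OF into_comp[OF assms(1) g_into],
        THEN bspec, of S] assms(1) g_into S_Pw by simp
  also have "forces C L (Dom C g) (res (Cmp C f g) \<circ> \<rho>) ((pres (Cmp C f g) \<circ> \<sigma>)(A := S)) p \<longleftrightarrow>
      forces C L (Dom C g) (res g \<circ> (res f \<circ> \<rho>)) ((pres g \<circ> (pres f \<circ> \<sigma>))(A := S)) p"
    by (rule forces_cong) (use g_into assms(1,2) in \<open>simp_all add: valuation_def\<close>)
  finally show "forces C L (Dom C g) (res g \<circ> (res f \<circ> \<rho>)) ((pres g \<circ> (pres f \<circ> \<sigma>))(A := S)) p" .
qed

lemma forces_mono:
  assumes "f \<in> into C c" "valuation c \<rho> \<sigma> p" "forces C L c \<rho> \<sigma> p"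
  shows "forces C L (Dom C f) (res f \<circ> \<rho>) (pres f \<circ> \<sigma>) p"
  using assms
proof (induction p arbitrary: c \<rho> \<sigma>)
  case (FLe x y)
  then show ?case by (simp add: forces.simps le_res)
next
  case (FEq x y)
  then show ?case by (simp add: forces.simps(2))
next
  case (FMem x A)
  then show ?case
    using PwD(3)[of "\<sigma> A" c "Idt C c" "\<rho> x" f] into_obj[OF FMem.prems(1)]
    by (simp add: forces.simps mem_pres valuation_def)
next
  case (FAnd p q)
  then have "valuation c \<rho> \<sigma> p" "valuation c \<rho> \<sigma> q" by (auto simp: valuation_def)
  moreover have "forces C L c \<rho> \<sigma> p" "forces C L c \<rho> \<sigma> q"
    using FAnd.prems(3) by (simp_all add: forces.simps(4))
  ultimately show ?case
    unfolding forces.simps(4) using FAnd.IH FAnd.prems(1) by blast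
next
  case (FImp p q)
  then show ?case by (blast intro: forces_FImp_mono)
next
  case (FAll x p)
  then show ?case by (blast intro: forces_FAll_mono)
next
  case (FEx x p)
  then obtain a where a_in: "a \<in> X c" "forces C L c (\<rho>(x := a)) \<sigma> p" by (auto simp: forces.simps)
  moreover have "valuation c (\<rho>(x := a)) \<sigma> p" using FEx.prems(2) a_in(1)
    by (auto simp: valuation_def)
  ultimately have "forces C L (Dom C f) (res f \<circ> \<rho>(x := a)) (pres f \<circ> \<sigma>) p"
    using FEx.IH FEx.prems(1) by blast
  then have "forces C L (Dom C f) ((res f \<circ> \<rho>)(x := res f a)) (pres f \<circ> \<sigma>) p"
    by (simp only: fun_upd_comp)
  then show ?case
    unfolding forces.simps(7) by (rule bexI[OF _ res_closed[OF FEx.prems(1) a_in(1)]])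
next
  case (FAllP A p)
  then show ?case by (blast intro: forces_FAllP_mono)
qed

definition universally_forced :: "fm \<Rightarrow> bool" where
  "universally_forced p \<longleftrightarrow>
     (\<forall>c\<in>Obj C. \<forall>\<rho> \<sigma>. valuation c \<rho> \<sigma> p \<longrightarrow> forces C L c \<rho> \<sigma> p)"

definition entails :: "fm \<Rightarrow> fm \<Rightarrow> bool" where
  "entails p q \<longleftrightarrow> (\<forall>c\<in>Obj C. \<forall>\<rho> \<sigma>. valuation c \<rho> \<sigma> p \<longrightarrow> valuation c \<rho> \<sigma> q \<longrightarrow>
     forces C L c \<rho> \<sigma> p \<longrightarrow> forces C L c \<rho> \<sigma> q)"

lemma valid_iff_universally_forced:
  "fm_vars p = {} \<Longrightarrow> fm_set_vars p = {} \<Longrightarrow> valid C L p \<longleftrightarrow> universally_forced p"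
  by (simp add: valid_def universally_forced_def valuation_def)

lemma universally_forced_FAll:
  assumes "x \<in> fm_vars p"
  shows "universally_forced (FAll x p) \<longleftrightarrow> universally_forced p" (is "?lhs \<longleftrightarrow> ?rhs")
proof
  assume lhs: ?lhs
  have "forces C L c (\<rho>(x := \<rho> x)) \<sigma> p" if "c \<in> Obj C" "valuation c \<rho> \<sigma> p" for c \<rho> \<sigma>
    by (rule forces_FAllD)
      (use lhs that assms in \<open>auto simp: universally_forced_def valuation_def\<close>)
  then show ?rhs by (simp add: universally_forced_def)
next
  assume rhs: ?rhs
  have "valuation (Dom C f) ((res f \<circ> \<rho>)(x := a)) (pres f \<circ> \<sigma>) p"
    if "valuation c \<rho> \<sigma> (FAll x p)" "f \<in> into C c" "a \<in> X (Dom C f)" for c \<rho> \<sigma> f a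
    using that by (auto simp: valuation_def)
  then show ?lhs using rhs unfolding universally_forced_def forces_FAll by (meson into_dom)
qed

lemma universally_forced_FAllP:
  assumes "A \<in> fm_set_vars p"
  shows "universally_forced (FAllP A p) \<longleftrightarrow> universally_forced p" (is "?lhs \<longleftrightarrow> ?rhs")
proof
  assume lhs: ?lhs
  have "forces C L c \<rho> (\<sigma>(A := \<sigma> A)) p" if "c \<in> Obj C" "valuation c \<rho> \<sigma> p" for c \<rho> \<sigma>
    by (rule forces_FAllPD)
      (use lhs that assms in \<open>auto simp: universally_forced_def valuation_def\<close>)
  then show ?rhs by (simp add: universally_forced_def)
next
  assume rhs: ?rhs
  have "valuation (Dom C f) (res f \<circ> \<rho>) ((pres f \<circ> \<sigma>)(A := S)) p"
    if "valuation c \<rho> \<sigma> (FAllP A p)" "f \<in> into C c" "S \<in> Pw (Dom C f)" for c \<rho> \<sigma> f S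
    using that by (auto simp: valuation_def)
  then show ?lhs using rhs unfolding universally_forced_def forces_FAllP by (meson into_dom)
qed

lemma universally_forced_FImp: "universally_forced (p \<^bold>\<longrightarrow> q) \<longleftrightarrow> entails p q" (is "?lhs \<longleftrightarrow> ?rhs")
proof
  assume lhs: ?lhs
  have "forces C L c \<rho> \<sigma> q"
    if "c \<in> Obj C" "valuation c \<rho> \<sigma> p" "valuation c \<rho> \<sigma> q" "forces C L c \<rho> \<sigma> p"
    for c \<rho> \<sigma>
    by (rule forces_FImpD[OF that(1) _ that(4,2,3)])
      (use lhs that in \<open>simp_all add: universally_forced_def\<close>)
  then show ?rhs by (simp add: entails_def)
next
  assume rhs: ?rhs
  have "valuation (Dom C f) (res f \<circ> \<rho>) (pres f \<circ> \<sigma>) p \<and>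
      valuation (Dom C f) (res f \<circ> \<rho>) (pres f \<circ> \<sigma>) q"
    if "valuation c \<rho> \<sigma> (p \<^bold>\<longrightarrow> q)" "f \<in> into C c" for c \<rho> \<sigma> f using that by (auto simp: valuation_def)
  then show ?lhs using rhs unfolding universally_forced_def entails_def forces_FImp
    by (meson into_dom)
qed

lemma entails_FImp: "entails p (q \<^bold>\<longrightarrow> r) \<longleftrightarrow> entails (p \<^bold>\<and> q) r" (is "?lhs \<longleftrightarrow> ?rhs")
proof
  assume lhs: ?lhs
  have "forces C L c \<rho> \<sigma> r" if "c \<in> Obj C" "valuation c \<rho> \<sigma> (p \<^bold>\<and> q)" "valuation c \<rho> \<sigma> r"
    "forces C L c \<rho> \<sigma> (p \<^bold>\<and> q)" for c \<rho> \<sigma>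
    by (rule forces_FImpD[of c \<rho> \<sigma> q])
      (use lhs that in \<open>simp_all add: entails_def forces.simps(4)\<close>)
  then show ?rhs by (simp add: entails_def)
next
  assume rhs: ?rhs
  have "forces C L (Dom C f) (res f \<circ> \<rho>) (pres f \<circ> \<sigma>) r"
    if "valuation c \<rho> \<sigma> p" "valuation c \<rho> \<sigma> (q \<^bold>\<longrightarrow> r)" "forces C L c \<rho> \<sigma> p"
      "f \<in> into C c" "forces C L (Dom C f) (res f \<circ> \<rho>) (pres f \<circ> \<sigma>) q" for c \<rho> \<sigma> f
  proof -
    have "valuation (Dom C f) (res f \<circ> \<rho>) (pres f \<circ> \<sigma>) (p \<^bold>\<and> q)"
      "valuation (Dom C f) (res f \<circ> \<rho>) (pres f \<circ> \<sigma>) r" using that by (auto simp: valuation_def)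
    then show ?thesis
      using rhs that(4,5) forces_mono[OF that(4,1,3)] by (simp add: entails_def forces.simps(4))
  qed
  then show ?lhs unfolding entails_def forces_FImp by blast
qed

lemma entails_FAllP:
  assumes "A \<notin> fm_set_vars p" "A \<in> fm_set_vars q"
  shows "entails p (FAllP A q) \<longleftrightarrow> entails p q" (is "?lhs \<longleftrightarrow> ?rhs")
proof
  assume lhs: ?lhs
  have "forces C L c \<rho> (\<sigma>(A := \<sigma> A)) q"
    if "c \<in> Obj C" "valuation c \<rho> \<sigma> p" "valuation c \<rho> \<sigma> q" "forces C L c \<rho> \<sigma> p" for c \<rho> \<sigma>
    by (rule forces_FAllPD) (use lhs that assms in \<open>auto simp: entails_def valuation_def\<close>)
  then show ?rhs by (simp add: entails_def)
next
  assume rhs: ?rhs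
  have "forces C L (Dom C f) (res f \<circ> \<rho>) ((pres f \<circ> \<sigma>)(A := S)) q"
    if val: "valuation c \<rho> \<sigma> p" "valuation c \<rho> \<sigma> (FAllP A q)" and p_forced: "forces C L c \<rho> \<sigma> p"
      and f_into: "f \<in> into C c" and S_Pw: "S \<in> Pw (Dom C f)" for c \<rho> \<sigma> f S
  proof -
    let ?\<sigma> = "(pres f \<circ> \<sigma>)(A := S)"
    have "forces C L (Dom C f) (res f \<circ> \<rho>) ?\<sigma> p \<longleftrightarrow> forces C L (Dom C f) (res f \<circ> \<rho>) (pres f \<circ> \<sigma>) p"
      by (rule forces_cong) (use assms(1) in auto)
    moreover have "valuation (Dom C f) (res f \<circ> \<rho>) ?\<sigma> p" "valuation (Dom C f) (res f \<circ> \<rho>) ?\<sigma> q"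
      using val f_into S_Pw by (auto simp: valuation_def)
    ultimately show ?thesis
      using rhs f_into forces_mono[OF f_into val(1) p_forced] unfolding entails_def by blast
  qed
  then show ?lhs unfolding entails_def forces_FAllP by blast
qed

end

context psh_relation
begin

definition top_at :: "'o \<Rightarrow> 'u \<Rightarrow> bool" where
  "top_at c t \<longleftrightarrow> (\<forall>f\<in>into C c. \<forall>x\<in>X (Dom C f). le (Dom C f) x (res f t))"

definition bot_at :: "'o \<Rightarrow> 'u \<Rightarrow> bool" where
  "bot_at c z \<longleftrightarrow> (\<forall>f\<in>into C c. \<forall>x\<in>X (Dom C f). le (Dom C f) (res f z) x)"

definition meet_at :: "'o \<Rightarrow> 'u \<Rightarrow> 'u \<Rightarrow> 'u \<Rightarrow> bool" where
  "meet_at c a b m \<longleftrightarrow> le c m a \<and> le c m b \<and> (\<forall>f\<in>into C c. \<forall>x\<in>X (Dom C f).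
     le (Dom C f) x (res f a) \<longrightarrow> le (Dom C f) x (res f b) \<longrightarrow> le (Dom C f) x (res f m))"

definition join_at :: "'o \<Rightarrow> 'u \<Rightarrow> 'u \<Rightarrow> 'u \<Rightarrow> bool" where
  "join_at c a b j \<longleftrightarrow> le c a j \<and> le c b j \<and> (\<forall>f\<in>into C c. \<forall>x\<in>X (Dom C f).
     le (Dom C f) (res f a) x \<longrightarrow> le (Dom C f) (res f b) x \<longrightarrow> le (Dom C f) (res f j) x)"

definition ub_at :: "'o \<Rightarrow> ('a \<times> 'u) set \<Rightarrow> 'u \<Rightarrow> bool" where
  "ub_at c S u \<longleftrightarrow> (\<forall>f x. (f, x) \<in> S \<longrightarrow> le (Dom C f) x (res f u))"

definition Join_at :: "'o \<Rightarrow> ('a \<times> 'u) set \<Rightarrow> 'u \<Rightarrow> bool" where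
  "Join_at c S s \<longleftrightarrow> ub_at c S s \<and>
     (\<forall>f\<in>into C c. \<forall>u\<in>X (Dom C f). ub_at (Dom C f) (pres f S) u \<longrightarrow> le (Dom C f) (res f s) u)"

definition well_inside_at :: "'o \<Rightarrow> 'u \<Rightarrow> 'u \<Rightarrow> bool" where
  "well_inside_at c a b \<longleftrightarrow>
     (\<exists>w\<in>X c. \<exists>z\<in>X c. \<exists>t\<in>X c. bot_at c z \<and> top_at c t \<and> meet_at c a w z \<and> join_at c b w t)"

definition directed_at :: "'o \<Rightarrow> ('a \<times> 'u) set \<Rightarrow> bool" where
  "directed_at c S \<longleftrightarrow> (\<exists>x\<in>X c. (Idt C c, x) \<in> S) \<and>
     (\<forall>f x y. (f, x) \<in> S \<longrightarrow> (f, y) \<in> S \<longrightarrow>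
       (\<exists>z. (f, z) \<in> S \<and> le (Dom C f) x z \<and> le (Dom C f) y z))"

lemma id_mem_pres [simp]:
  "f \<in> into C c \<Longrightarrow> (Idt C (Dom C f), x) \<in> pres f S \<longleftrightarrow> (f, x) \<in> S"
  by (simp add: mem_pres)

lemma forces_top: "\<rho> t \<in> X c \<Longrightarrow> forces C L c \<rho> \<sigma> (fm_top t) \<longleftrightarrow> top_at c (\<rho> t)"
  by (simp add: fm_top_def top_at_def forces_simps)

lemma forces_bot: "\<rho> z \<in> X c \<Longrightarrow> forces C L c \<rho> \<sigma> (fm_bot z) \<longleftrightarrow> bot_at c (\<rho> z)"
  by (simp add: fm_bot_def bot_at_def forces_simps)

lemma forces_meet:
  assumes "\<rho> a \<in> X c" "\<rho> b \<in> X c" "\<rho> m \<in> X c"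
  shows "forces C L c \<rho> \<sigma> (fm_meet a b m) \<longleftrightarrow> meet_at c (\<rho> a) (\<rho> b) (\<rho> m)"
  using assms
  by (simp add: fm_meet_def meet_at_def Let_def forces_FAll_FImp valuation_FAll forces.simps(1,4)
      imp_conjL)

lemma forces_join:
  assumes "\<rho> a \<in> X c" "\<rho> b \<in> X c" "\<rho> j \<in> X c"
  shows "forces C L c \<rho> \<sigma> (fm_join a b j) \<longleftrightarrow> join_at c (\<rho> a) (\<rho> b) (\<rho> j)"
  using assms
  by (simp add: fm_join_def join_at_def Let_def forces_FAll_FImp valuation_FAll forces.simps(1,4)
      imp_conjL)

lemma forces_ub:
  assumes "\<rho> u \<in> X c" "\<sigma> A \<in> Pw c" "x \<noteq> u"
  shows "forces C L c \<rho> \<sigma> (FAll x (x \<^bold>\<in> A \<^bold>\<longrightarrow> x \<^bold>\<le> u)) \<longleftrightarrow> ub_at c (\<sigma> A) (\<rho> u)"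
proof -
  have "forces C L c \<rho> \<sigma> (FAll x (x \<^bold>\<in> A \<^bold>\<longrightarrow> x \<^bold>\<le> u)) \<longleftrightarrow>
      (\<forall>f\<in>into C c. \<forall>y\<in>X (Dom C f). (f, y) \<in> \<sigma> A \<longrightarrow> le (Dom C f) y (res f (\<rho> u)))"
    using assms by (simp add: forces_FAll_FImp valuation_FAll forces.simps(1,3))
  then show ?thesis using PwD[OF assms(2)] by (auto simp: ub_at_def)
qed

lemma forces_Join:
  assumes "\<rho> s \<in> X c" "\<sigma> A \<in> Pw c"
  shows "forces C L c \<rho> \<sigma> (fm_Join A s) \<longleftrightarrow> Join_at c (\<sigma> A) (\<rho> s)"
proof -
  let ?ub = "FAll (s + 1) ((s + 1) \<^bold>\<in> A \<^bold>\<longrightarrow> (s + 1) \<^bold>\<le> (s + 2))"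
  have "forces C L c \<rho> \<sigma> (FAll (s + 2) (?ub \<^bold>\<longrightarrow> s \<^bold>\<le> (s + 2))) \<longleftrightarrow>
     (\<forall>f\<in>into C c. \<forall>u\<in>X (Dom C f). ub_at (Dom C f) (pres f (\<sigma> A)) u \<longrightarrow>
        le (Dom C f) (res f (\<rho> s)) u)"
    using assms by (subst forces_FAll_FImp) (auto simp: valuation_FAll forces_ub forces.simps(1))
  then show ?thesis
    using assms forces_ub[of \<rho> s c \<sigma> A "s + 1"]
    by (simp add: fm_Join_def Join_at_def Let_def forces.simps(4))
qed

lemma forces_well_inside:
  assumes "\<rho> a \<in> X c" "\<rho> b \<in> X c"
  shows "forces C L c \<rho> \<sigma> (fm_well_inside a b) \<longleftrightarrow> well_inside_at c (\<rho> a) (\<rho> b)"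
  using assms
  by (simp add: fm_well_inside_def well_inside_at_def Let_def forces_top forces_bot forces_meet
      forces_join forces.simps(4,7) cong: bex_cong)

lemma forces_directed:
  assumes "\<sigma> A \<in> Pw c"
  shows "forces C L c \<rho> \<sigma> (fm_directed A) \<longleftrightarrow> directed_at c (\<sigma> A)"
proof -
  have "forces C L c \<rho> \<sigma>
      (FAll 0 (FAll 1 (0 \<^bold>\<in> A \<^bold>\<and> 1 \<^bold>\<in> A \<^bold>\<longrightarrow> FEx 2 (2 \<^bold>\<in> A \<^bold>\<and> 0 \<^bold>\<le> 2 \<^bold>\<and> 1 \<^bold>\<le> 2)))) \<longleftrightarrow>
    (\<forall>f\<in>into C c. \<forall>x\<in>X (Dom C f). \<forall>g\<in>into C (Dom C f). \<forall>y\<in>X (Dom C g).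
       (g, res g x) \<in> pres f (\<sigma> A) \<longrightarrow> (g, y) \<in> pres f (\<sigma> A) \<longrightarrow>
       (\<exists>z\<in>X (Dom C g). (g, z) \<in> pres f (\<sigma> A) \<and> le (Dom C g) (res g x) z \<and> le (Dom C g) y z))"
    using assms
    by (simp add: forces_FAll[of c \<rho> \<sigma> 0] forces_FAll_FImp valuation_FAll forces.simps(1,3,4,7)
        imp_conjL insert_Diff_if del: One_nat_def)
  also have "\<dots> \<longleftrightarrow> (\<forall>f x y. (f, x) \<in> \<sigma> A \<longrightarrow> (f, y) \<in> \<sigma> A \<longrightarrow>
       (\<exists>z. (f, z) \<in> \<sigma> A \<and> le (Dom C f) x z \<and> le (Dom C f) y z))" (is "?lhs \<longleftrightarrow> ?rhs")
  proof
    assume lhs: ?lhs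
    show ?rhs
    proof (intro allI impI)
      fix f x y assume fx_in: "(f, x) \<in> \<sigma> A" and fy_in: "(f, y) \<in> \<sigma> A"
      note f_x_in = PwD(1,2)[OF assms fx_in] and y_closed = PwD(2)[OF assms fy_in]
      show "\<exists>z. (f, z) \<in> \<sigma> A \<and> le (Dom C f) x z \<and> le (Dom C f) y z"
        using lhs[rule_format, OF f_x_in, of "Idt C (Dom C f)" y] f_x_in y_closed fx_in fy_in
        by auto
    qed
  next
    assume rhs: ?rhs
    show ?lhs
    proof (intro ballI impI)
      fix f x g y assume f_into: "f \<in> into C c" and g_into: "g \<in> into C (Dom C f)"
        and "(g, res g x) \<in> pres f (\<sigma> A)" "(g, y) \<in> pres f (\<sigma> A)"
      then obtain z where "(Cmp C f g, z) \<in> \<sigma> A" "le (Dom C g) (res g x) z" "le (Dom C g) y z"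
        using rhs unfolding mem_pres by (metis dom_comp_into)
      moreover from this(1) have "z \<in> X (Dom C g)" using PwD(2)[OF assms] f_into g_into by fastforce
      ultimately show "\<exists>z\<in>X (Dom C g). (g, z) \<in> pres f (\<sigma> A) \<and>
          le (Dom C g) (res g x) z \<and> le (Dom C g) y z"
        using g_into by (auto simp: mem_pres)
    qed
  qed
  finally show ?thesis by (simp add: fm_directed_def directed_at_def forces.simps(3,4,7))
qed

lemma top_at_res: "f \<in> into C c \<Longrightarrow> t \<in> X c \<Longrightarrow> top_at c t \<Longrightarrow> top_at (Dom C f) (res f t)"
  using forces_mono[of f c "\<lambda>_. t" undefined "fm_top 0"] by (simp add: valuation_def forces_top)

lemma meet_at_res:
  assumes "f \<in> into C c" "a \<in> X c" "b \<in> X c" "m \<in> X c" "meet_at c a b m"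
  shows "meet_at (Dom C f) (res f a) (res f b) (res f m)"
  using forces_mono[of f c "(\<lambda>_. m)(0 := a, 1 := b)" undefined "fm_meet 0 1 2"] assms
  by (simp add: valuation_def forces_meet del: One_nat_def)

lemma Join_at_res:
  assumes "f \<in> into C c" "S \<in> Pw c" "s \<in> X c" "Join_at c S s"
  shows "Join_at (Dom C f) (pres f S) (res f s)"
  using forces_mono[of f c "\<lambda>_. s" "\<lambda>_. S" "fm_Join 0 0"] assms
  by (simp add: valuation_def forces_Join)

lemma well_inside_at_res:
  assumes "f \<in> into C c" "a \<in> X c" "b \<in> X c" "well_inside_at c a b"
  shows "well_inside_at (Dom C f) (res f a) (res f b)"
  using forces_mono[of f c "(\<lambda>_. b)(0 := a)" undefined "fm_well_inside 0 1"] assms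
  by (simp add: valuation_def forces_well_inside del: One_nat_def)

definition meet_family :: "'o \<Rightarrow> 'u \<Rightarrow> ('a \<times> 'u) set \<Rightarrow> ('a \<times> 'u) set" where
  "meet_family c a S = {(f, y). f \<in> into C c \<and> y \<in> X (Dom C f) \<and>
     (\<exists>x\<in>X (Dom C f). (f, x) \<in> S \<and> meet_at (Dom C f) (res f a) x y)}"

definition interior_family :: "'o \<Rightarrow> 'u \<Rightarrow> ('a \<times> 'u) set" where
  "interior_family c b = {(f, x). f \<in> into C c \<and> x \<in> X (Dom C f) \<and>
     well_inside_at (Dom C f) x (res f b)}"

lemma meet_family_Pw [simp]:
  assumes "a \<in> X c" "S \<in> Pw c"
  shows "meet_family c a S \<in> Pw c"
proof (rule PwI)
  fix f y g assume "(f, y) \<in> meet_family c a S" and g_into: "g \<in> into C (Dom C f)"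
  then obtain x where f_into: "f \<in> into C c" and y_in: "y \<in> X (Dom C f)"
    and x_in: "x \<in> X (Dom C f)" "(f, x) \<in> S"
    and "meet_at (Dom C f) (res f a) x y" by (auto simp: meet_family_def)
  then have "meet_at (Dom C g) (res g (res f a)) (res g x) (res g y)"
    using g_into assms(1) by (intro meet_at_res) auto
  then show "(Cmp C f g, res g y) \<in> meet_family c a S"
    using f_into g_into x_in y_in assms(1) PwD(3)[OF assms(2) x_in(2) g_into]
    by (auto simp: meet_family_def)
qed (auto simp: meet_family_def)

lemma interior_family_Pw [simp]:
  assumes "b \<in> X c"
  shows "interior_family c b \<in> Pw c"
proof (rule PwI)
  fix f x g assume "(f, x) \<in> interior_family c b" "g \<in> into C (Dom C f)"
  then show "(Cmp C f g, res g x) \<in> interior_family c b"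
    using assms well_inside_at_res[of g "Dom C f" x "res f b"] by (auto simp: interior_family_def)
qed (auto simp: interior_family_def)

lemma Pw_eq_iff:
  assumes "S \<in> Pw c" "T \<in> Pw c"
  shows "S = T \<longleftrightarrow> (\<forall>f\<in>into C c. \<forall>x\<in>X (Dom C f). (f, x) \<in> S \<longleftrightarrow> (f, x) \<in> T)"
proof
  assume eq: "\<forall>f\<in>into C c. \<forall>x\<in>X (Dom C f). (f, x) \<in> S \<longleftrightarrow> (f, x) \<in> T"
  have "(f, x) \<in> S \<longleftrightarrow> (f, x) \<in> T" for f x
    using eq PwD(1,2)[OF assms(1), of f x] PwD(1,2)[OF assms(2), of f x] by blast
  then show "S = T" by auto
qed simp

lemma forces_meet_family:
  assumes "\<rho> 0 \<in> X c" "\<sigma> 0 \<in> Pw c" "\<sigma> 1 \<in> Pw c"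
  shows "forces C L c \<rho> \<sigma> (FAll 3 (3 \<^bold>\<in> 1 \<^bold>\<longleftrightarrow> FEx 4 (4 \<^bold>\<in> 0 \<^bold>\<and> fm_meet 0 4 3))) \<longleftrightarrow>
    \<sigma> 1 = meet_family c (\<rho> 0) (\<sigma> 0)"
proof -
  have "forces C L c \<rho> \<sigma> (FAll 3 (3 \<^bold>\<in> 1 \<^bold>\<longleftrightarrow> FEx 4 (4 \<^bold>\<in> 0 \<^bold>\<and> fm_meet 0 4 3))) \<longleftrightarrow>
    (\<forall>f\<in>into C c. \<forall>y\<in>X (Dom C f). (f, y) \<in> \<sigma> 1 \<longleftrightarrow>
       (\<exists>x\<in>X (Dom C f). (f, x) \<in> \<sigma> 0 \<and> meet_at (Dom C f) (res f (\<rho> 0)) x y))"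
    using assms
    by (subst forces_FAll_FIff)
      (simp_all add: valuation_FAll forces.simps(3,4,7) forces_meet insert_Diff_if cong: bex_cong
        del: One_nat_def)
  also have "\<dots> \<longleftrightarrow> \<sigma> 1 = meet_family c (\<rho> 0) (\<sigma> 0)"
    by (subst Pw_eq_iff[OF assms(3) meet_family_Pw[OF assms(1,2)]]) (auto simp: meet_family_def)
  finally show ?thesis .
qed

lemma forces_interior_family:
  assumes "\<rho> 0 \<in> X c" "\<sigma> 0 \<in> Pw c"
  shows "forces C L c \<rho> \<sigma> (FAll 1 (1 \<^bold>\<in> 0 \<^bold>\<longleftrightarrow> fm_well_inside 1 0)) \<longleftrightarrow>
    \<sigma> 0 = interior_family c (\<rho> 0)"
proof -
  have "forces C L c \<rho> \<sigma> (FAll 1 (1 \<^bold>\<in> 0 \<^bold>\<longleftrightarrow> fm_well_inside 1 0)) \<longleftrightarrow>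
    (\<forall>f\<in>into C c. \<forall>x\<in>X (Dom C f). (f, x) \<in> \<sigma> 0 \<longleftrightarrow> well_inside_at (Dom C f) x (res f (\<rho> 0)))"
    using assms
    by (subst forces_FAll_FIff)
      (simp_all add: valuation_FAll forces.simps(3) forces_well_inside del: One_nat_def)
  also have "\<dots> \<longleftrightarrow> \<sigma> 0 = interior_family c (\<rho> 0)"
    by (subst Pw_eq_iff[OF assms(2) interior_family_Pw[OF assms(1)]])
      (auto simp: interior_family_def)
  finally show ?thesis .
qed

lemmas valid_calculus = valid_iff_universally_forced universally_forced_FAll
  universally_forced_FAllP universally_forced_FImp entails_FImp entails_FAllP insert_Diff_if

lemma valid_FAnd: "valid C L (p \<^bold>\<and> q) \<longleftrightarrow> valid C L p \<and> valid C L q"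
  by (auto simp: valid_def forces.simps(4))

lemma valid_refl: "valid C L (FAll 0 (0 \<^bold>\<le> 0)) \<longleftrightarrow> (\<forall>c\<in>Obj C. \<forall>x\<in>X c. le c x x)" (is "_ \<longleftrightarrow> ?rhs")
proof -
  have "universally_forced (0 \<^bold>\<le> 0) \<longleftrightarrow> ?rhs"
    by (auto simp: universally_forced_def valuation_def forces.simps(1) dest!: spec[of _ "\<lambda>_. _"])
  then show ?thesis by (simp add: valid_calculus)
qed

lemma valid_antisym: "valid C L (FAll 0 (FAll 1 (0 \<^bold>\<le> 1 \<^bold>\<and> 1 \<^bold>\<le> 0 \<^bold>\<longrightarrow> 0 \<^bold>= 1))) \<longleftrightarrow>
    (\<forall>c\<in>Obj C. \<forall>x y. le c x y \<longrightarrow> le c y x \<longrightarrow> x = y)" (is "_ \<longleftrightarrow> ?rhs")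
proof -
  have "entails (0 \<^bold>\<le> 1 \<^bold>\<and> 1 \<^bold>\<le> 0) (0 \<^bold>= 1) \<longleftrightarrow> ?rhs"
  proof
    assume entails: "entails (0 \<^bold>\<le> 1 \<^bold>\<and> 1 \<^bold>\<le> 0) (0 \<^bold>= 1)"
    have "x = y" if "c \<in> Obj C" "le c x y" "le c y x" for c x y
      using entails[unfolded entails_def, rule_format, of c "(\<lambda>_. y)(0 := x)" undefined] that
        le_in_X[OF that(1,2)] by (simp add: valuation_def forces.simps(1,2,4))
    then show ?rhs by blast
  qed (auto simp: entails_def forces.simps(1,2,4))
  then show ?thesis by (simp add: valid_calculus del: One_nat_def)
qed

lemma valid_trans: "valid C L (FAll 0 (FAll 1 (FAll 2 (0 \<^bold>\<le> 1 \<^bold>\<and> 1 \<^bold>\<le> 2 \<^bold>\<longrightarrow> 0 \<^bold>\<le> 2)))) \<longleftrightarrow>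
    (\<forall>c\<in>Obj C. \<forall>x y z. le c x y \<longrightarrow> le c y z \<longrightarrow> le c x z)" (is "_ \<longleftrightarrow> ?rhs")
proof -
  have "entails (0 \<^bold>\<le> 1 \<^bold>\<and> 1 \<^bold>\<le> 2) (0 \<^bold>\<le> 2) \<longleftrightarrow> ?rhs"
  proof
    assume entails: "entails (0 \<^bold>\<le> 1 \<^bold>\<and> 1 \<^bold>\<le> 2) (0 \<^bold>\<le> 2)"
    have "le c x z" if "c \<in> Obj C" "le c x y" "le c y z" for c x y z
      using entails[unfolded entails_def, rule_format, of c "(\<lambda>_. z)(0 := x, 1 := y)" undefined]
        that le_in_X[OF that(1,2)] le_in_X[OF that(1,3)]
      by (simp add: valuation_def forces.simps(1,4) del: One_nat_def)
    then show ?rhs by blast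
  next
    assume ?rhs
    then show "entails (0 \<^bold>\<le> 1 \<^bold>\<and> 1 \<^bold>\<le> 2) (0 \<^bold>\<le> 2)"
      unfolding entails_def forces.simps(1,4) by blast
  qed
  then show ?thesis by (simp add: valid_calculus del: One_nat_def)
qed

lemma valid_complete: "valid C L fm_complete \<longleftrightarrow> (\<forall>c\<in>Obj C. \<forall>S\<in>Pw c. \<exists>s\<in>X c. Join_at c S s)"
    (is "_ \<longleftrightarrow> ?rhs")
proof -
  have "universally_forced (FEx 0 (fm_Join 0 0)) \<longleftrightarrow> ?rhs"
    by (auto simp: universally_forced_def valuation_def forces.simps(7) forces_Join cong: bex_cong
        dest!: spec[of _ "\<lambda>_. _"])
  then show ?thesis by (simp add: fm_complete_def valid_calculus)
qed

lemma valid_distrib: "valid C L fm_distrib \<longleftrightarrow>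
    (\<forall>c\<in>Obj C. \<forall>S\<in>Pw c. \<forall>a\<in>X c. \<forall>s\<in>X c. \<forall>m\<in>X c.
       Join_at c S s \<longrightarrow> meet_at c a s m \<longrightarrow> Join_at c (meet_family c a S) m)" (is "_ \<longleftrightarrow> ?rhs")
proof -
  let ?B = "FAll 3 (3 \<^bold>\<in> 1 \<^bold>\<longleftrightarrow> FEx 4 (4 \<^bold>\<in> 0 \<^bold>\<and> fm_meet 0 4 3))"
  let ?hyp = "(fm_Join 0 1 \<^bold>\<and> fm_meet 0 1 2) \<^bold>\<and> ?B"
  have val: "valuation c \<rho> \<sigma> ?hyp \<and> valuation c \<rho> \<sigma> (fm_Join 1 2) \<longleftrightarrow>
      \<rho> 0 \<in> X c \<and> \<rho> 1 \<in> X c \<and> \<rho> 2 \<in> X c \<and> \<sigma> 0 \<in> Pw c \<and> \<sigma> 1 \<in> Pw c" for c \<rho> \<sigma>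
    by (auto simp: valuation_def insert_Diff_if simp del: One_nat_def)
  have "entails ?hyp (fm_Join 1 2) \<longleftrightarrow> ?rhs"
  proof
    assume entails: "entails ?hyp (fm_Join 1 2)"
    have "Join_at c (meet_family c a S) m"
      if "c \<in> Obj C" "S \<in> Pw c" "a \<in> X c" "s \<in> X c" "m \<in> X c" "Join_at c S s" "meet_at c a s m"
      for c S a s m
      using entails[unfolded entails_def, rule_format, of c "(\<lambda>_. m)(0 := a, 1 := s)"
          "(\<lambda>_. meet_family c a S)(0 := S)"] val[of c "(\<lambda>_. m)(0 := a, 1 := s)"
          "(\<lambda>_. meet_family c a S)(0 := S)"] that
      by (simp add: forces.simps(4) forces_Join forces_meet forces_meet_family del: One_nat_def)
    then show ?rhs by blast
  next
    assume rhs: ?rhs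
    have "forces C L c \<rho> \<sigma> (fm_Join 1 2)"
      if c_obj: "c \<in> Obj C" and "valuation c \<rho> \<sigma> ?hyp" "valuation c \<rho> \<sigma> (fm_Join 1 2)"
        and "forces C L c \<rho> \<sigma> ?hyp" for c \<rho> \<sigma>
      using rhs[rule_format, OF c_obj, of "\<sigma> 0" "\<rho> 0" "\<rho> 1" "\<rho> 2"] val[of c \<rho> \<sigma>] that
      by (simp add: forces.simps(4) forces_Join forces_meet forces_meet_family del: One_nat_def)
    then show "entails ?hyp (fm_Join 1 2)" by (simp add: entails_def)
  qed
  then show ?thesis unfolding fm_distrib_def by (simp add: valid_calculus del: One_nat_def)
qed

lemma valid_compact: "valid C L fm_compact \<longleftrightarrow> (\<forall>c\<in>Obj C. \<forall>S\<in>Pw c. \<forall>t\<in>X c.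
    directed_at c S \<longrightarrow> top_at c t \<longrightarrow> Join_at c S t \<longrightarrow> (Idt C c, t) \<in> S)" (is "_ \<longleftrightarrow> ?rhs")
proof -
  let ?hyp = "fm_directed 0 \<^bold>\<and> fm_top 0 \<^bold>\<and> fm_Join 0 0"
  have "entails ?hyp (0 \<^bold>\<in> 0) \<longleftrightarrow> ?rhs"
  proof
    assume entails: "entails ?hyp (0 \<^bold>\<in> 0)"
    have "(Idt C c, t) \<in> S"
      if "c \<in> Obj C" "S \<in> Pw c" "t \<in> X c" "directed_at c S" "top_at c t" "Join_at c S t" for c S t
      using entails[unfolded entails_def, rule_format, of c "\<lambda>_. t" "\<lambda>_. S"] that
      by (simp add: valuation_def forces.simps(3,4) forces_directed forces_top forces_Join)
    then show ?rhs by blast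
  qed (simp add: entails_def valuation_def forces.simps(3,4) forces_directed forces_top forces_Join)
  then show ?thesis by (simp add: fm_compact_def valid_calculus)
qed

lemma valid_regular:
  "valid C L fm_regular \<longleftrightarrow> (\<forall>c\<in>Obj C. \<forall>b\<in>X c. Join_at c (interior_family c b) b)" (is "_ \<longleftrightarrow> ?rhs")
proof -
  let ?B = "FAll 1 (1 \<^bold>\<in> 0 \<^bold>\<longleftrightarrow> fm_well_inside 1 0)"
  have val: "valuation c \<rho> \<sigma> ?B \<longleftrightarrow> \<rho> 0 \<in> X c \<and> \<sigma> 0 \<in> Pw c" for c \<rho> \<sigma>
    by (auto simp: valuation_def)
  have "entails ?B (fm_Join 0 0) \<longleftrightarrow> ?rhs"
  proof
    assume entails: "entails ?B (fm_Join 0 0)"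
    have "Join_at c (interior_family c b) b" if "c \<in> Obj C" "b \<in> X c" for c b
      using entails[unfolded entails_def, rule_format, of c "\<lambda>_. b" "\<lambda>_. interior_family c b"] that
      by (simp add: val valuation_def[of _ _ _ "fm_Join _ _"] forces_Join forces_interior_family
        del: One_nat_def)
    then show ?rhs by blast
  qed (simp add: entails_def val forces_Join forces_interior_family del: One_nat_def)
  then show ?thesis unfolding fm_regular_def by (simp add: valid_calculus del: One_nat_def)
qed

end

section \<open>The stages of an internal compact regular frame\<close>

locale internal_poset = psh_relation C U L
  for C :: "('o, 'a) category" and U :: "'u set set" and L +
  assumes le_refl: "c \<in> Obj C \<Longrightarrow> x \<in> X c \<Longrightarrow> le c x x"
    and le_antisym: "c \<in> Obj C \<Longrightarrow> le c x y \<Longrightarrow> le c y x \<Longrightarrow> x = y"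
    and le_trans: "c \<in> Obj C \<Longrightarrow> le c x y \<Longrightarrow> le c y z \<Longrightarrow> le c x z"

locale internal_frame = internal_poset C U L
  for C :: "('o, 'a) category" and U :: "'u set set" and L +
  assumes complete: "c \<in> Obj C \<Longrightarrow> S \<in> Pw c \<Longrightarrow> \<exists>s\<in>X c. Join_at c S s"
    and distrib: "c \<in> Obj C \<Longrightarrow> S \<in> Pw c \<Longrightarrow> a \<in> X c \<Longrightarrow> s \<in> X c \<Longrightarrow> m \<in> X c \<Longrightarrow>
      Join_at c S s \<Longrightarrow> meet_at c a s m \<Longrightarrow> Join_at c (meet_family c a S) m"

locale internal_kreg = internal_frame C U L
  for C :: "('o, 'a) category" and U :: "'u set set" and L +
  assumes compact: "c \<in> Obj C \<Longrightarrow> S \<in> Pw c \<Longrightarrow> t \<in> X c \<Longrightarrow> directed_at c S \<Longrightarrow> top_at c t \<Longrightarrow>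
      Join_at c S t \<Longrightarrow> (Idt C c, t) \<in> S"
    and regular: "c \<in> Obj C \<Longrightarrow> b \<in> X c \<Longrightarrow> Join_at c (interior_family c b) b"

lemma (in psh_relation) valid_poset_iff: "valid C L fm_poset \<longleftrightarrow> internal_poset C U L"
  unfolding fm_poset_def valid_FAnd valid_refl valid_antisym valid_trans
    internal_poset_def internal_poset_axioms_def
  using psh_relation_axioms by blast

lemma (in psh_relation) valid_iff_internal_kreg:
  "valid C L fm_frame \<and> valid C L fm_compact \<and> valid C L fm_regular \<longleftrightarrow> internal_kreg C U L"
  unfolding fm_frame_def valid_FAnd valid_poset_iff valid_complete valid_distrib valid_compact
    valid_regular internal_kreg_def internal_kreg_axioms_def internal_frame_def
        internal_frame_axioms_def
  by blast

lemma internal_kreg_frame_iff: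
  assumes "is_category C"
  shows "internal_kreg_frame U C L \<longleftrightarrow> internal_kreg C U L"
proof
  assume kreg: "internal_kreg_frame U C L"
  interpret psh_relation C U L
    by unfold_locales (use assms kreg in \<open>auto simp: internal_kreg_frame_def\<close>)
  show "internal_kreg C U L"
    using kreg valid_iff_internal_kreg by (simp add: internal_kreg_frame_def)
next
  assume "internal_kreg C U L"
  then interpret internal_kreg C U L .
  show "internal_kreg_frame U C L"
    using psh rel_subset rel_restrict valid_iff_internal_kreg internal_kreg_axioms
    unfolding internal_kreg_frame_def by blast
qed

definition stage :: "('o, 'a, 'u) psh_rel \<Rightarrow> 'o \<Rightarrow> 'u gorder" where
  "stage L c = \<lparr>carrier = FObj (fst L) c, eq = (=), le = (\<lambda>x y. (x, y) \<in> snd L c)\<rparr>"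

lemma stage_simps [simp]:
  "carrier (stage L c) = FObj (fst L) c" "x \<sqsubseteq>\<^bsub>stage L c\<^esub> y \<longleftrightarrow> (x, y) \<in> snd L c"
  by (simp_all add: stage_def)

context psh_relation
begin

abbreviation St :: "'o \<Rightarrow> 'u gorder" where "St c \<equiv> stage L c"

definition generated :: "'o \<Rightarrow> 'u set \<Rightarrow> ('a \<times> 'u) set" where
  "generated c A = {(f, y). f \<in> into C c \<and> (\<exists>x\<in>A. y = res f x)}"

lemma mem_generated: "(f, y) \<in> generated c A \<longleftrightarrow> f \<in> into C c \<and> (\<exists>x\<in>A. y = res f x)"
  by (simp add: generated_def)

lemma generated_Pw:
  assumes "A \<subseteq> X c"
  shows "generated c A \<in> Pw c"
proof (rule PwI)
  fix f y g assume "(f, y) \<in> generated c A" and g_into: "g \<in> into C (Dom C f)"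
  then obtain x where "f \<in> into C c" "x \<in> A" "y = res f x" by (auto simp: mem_generated)
  then show "(Cmp C f g, res g y) \<in> generated c A"
    using assms g_into by (auto simp: mem_generated intro!: bexI[of _ x])
qed (use assms in \<open>auto simp: mem_generated\<close>)

lemma ub_generated:
  assumes "c \<in> Obj C" "A \<subseteq> X c" "u \<in> X c"
  shows "ub_at c (generated c A) u \<longleftrightarrow> (\<forall>x\<in>A. le c x u)"
proof
  assume upper: "ub_at c (generated c A) u"
  show "\<forall>x\<in>A. le c x u"
  proof
    fix x assume "x \<in> A"
    then have "(Idt C c, x) \<in> generated c A" using assms by (force simp: mem_generated)
    then show "le c x u" using upper[unfolded ub_at_def, rule_format, of "Idt C c" x] assms by simp
  qed
qed (auto simp: ub_at_def mem_generated le_res)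

lemma pres_generated:
  assumes "f \<in> into C c" "A \<subseteq> X c"
  shows "pres f (generated c A) = generated (Dom C f) (res f ` A)"
proof -
  have "(g, y) \<in> pres f (generated c A) \<longleftrightarrow> (g, y) \<in> generated (Dom C f) (res f ` A)" for g y
    using assms by (auto simp: mem_pres mem_generated subset_iff)
  then show ?thesis by auto
qed

lemma join_at_iff_Join_at:
  assumes "c \<in> Obj C" "a \<in> X c" "b \<in> X c" "j \<in> X c"
  shows "join_at c a b j \<longleftrightarrow> Join_at c (generated c {a, b}) j"
proof -
  have "ub_at (Dom C f) (pres f (generated c {a, b})) u \<longleftrightarrow>
      le (Dom C f) (res f a) u \<and> le (Dom C f) (res f b) u"
    if "f \<in> into C c" "u \<in> X (Dom C f)" for f u
    using assms that by (simp add: pres_generated ub_generated)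
  then show ?thesis using assms by (auto simp: ub_generated join_at_def Join_at_def)
qed

lemma bot_at_iff_Join_at: "bot_at c z \<longleftrightarrow> Join_at c {} z"
  by (auto simp: bot_at_def Join_at_def ub_at_def mem_pres)

end

context internal_poset
begin

lemma partial_order_stage: "c \<in> Obj C \<Longrightarrow> partial_order (St c)"
  by standard (auto simp: stage_def le_refl intro: le_antisym elim: le_trans)

lemma Join_at_least:
  assumes "c \<in> Obj C" "S \<in> Pw c" "s \<in> X c" "u \<in> X c" "Join_at c S s" "ub_at c S u"
  shows "le c s u"
  using assms(5)[unfolded Join_at_def, THEN conjunct2, THEN bspec, OF into_id[OF assms(1)],
      THEN bspec, of u] assms by simp

lemma Join_at_unique:
  assumes "c \<in> Obj C" "S \<in> Pw c" "s \<in> X c" "s' \<in> X c" "Join_at c S s" "Join_at c S s'"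
  shows "s = s'"
  using assms Join_at_least[OF assms(1-4)] Join_at_least[OF assms(1,2,4,3)]
  by (auto simp: Join_at_def intro: le_antisym)

lemma top_at_greatest: "c \<in> Obj C \<Longrightarrow> t \<in> X c \<Longrightarrow> x \<in> X c \<Longrightarrow> top_at c t \<Longrightarrow> le c x t"
  by (force simp: top_at_def dest: bspec[OF _ into_id])

lemma top_at_unique: "c \<in> Obj C \<Longrightarrow> t \<in> X c \<Longrightarrow> t' \<in> X c \<Longrightarrow> top_at c t \<Longrightarrow> top_at c t' \<Longrightarrow> t = t'"
  by (intro le_antisym top_at_greatest)

lemma meet_at_greatest:
  assumes "c \<in> Obj C" "a \<in> X c" "b \<in> X c" "m \<in> X c" "meet_at c a b m" "le c x a" "le c x b"
  shows "le c x m"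
  using assms(5)[unfolded meet_at_def, THEN conjunct2, THEN conjunct2, THEN bspec,
      OF into_id[OF assms(1)], THEN bspec, of x] assms le_in_X[OF assms(1,6)] by simp

lemma meet_at_unique:
  assumes "c \<in> Obj C" "a \<in> X c" "b \<in> X c" "m \<in> X c" "m' \<in> X c" "meet_at c a b m" "meet_at c a b m'"
  shows "m = m'"
  using assms meet_at_greatest[OF assms(1-4,6)] meet_at_greatest[OF assms(1-3,5,7)]
  by (auto simp: meet_at_def intro: le_antisym)

end

context internal_frame
begin

text \<open>Since joins exist and are stable under restriction, they can be tested at the stage itself.\<close>

lemma Join_at_iff_least:
  assumes "c \<in> Obj C" "S \<in> Pw c" "s \<in> X c"
  shows "Join_at c S s \<longleftrightarrow> ub_at c S s \<and> (\<forall>u\<in>X c. ub_at c S u \<longrightarrow> le c s u)" (is "_ \<longleftrightarrow> ?rhs")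
proof
  show ?rhs if "Join_at c S s"
    using that assms Join_at_least by (auto simp: Join_at_def)
  assume least: ?rhs
  obtain s' where s'_in: "s' \<in> X c" "Join_at c S s'" using complete assms by blast
  then have "s = s'"
    using least Join_at_least[OF assms(1,2) s'_in(1) assms(3) s'_in(2)] assms(1)
    by (intro le_antisym) (auto simp: Join_at_def)
  then show "Join_at c S s" using s'_in by simp
qed

lemma Join_generated_iff_lub:
  assumes "c \<in> Obj C" "A \<subseteq> X c" "s \<in> X c"
  shows "Join_at c (generated c A) s \<longleftrightarrow>
    (\<forall>x\<in>A. le c x s) \<and> (\<forall>u\<in>X c. (\<forall>x\<in>A. le c x u) \<longrightarrow> le c s u)"
  using assms by (simp add: Join_at_iff_least generated_Pw ub_generated)

lemma complete_lattice_stage: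
  assumes "c \<in> Obj C"
  shows "complete_lattice (St c)"
proof (rule complete_latticeI_Sup[OF partial_order_stage[OF assms]])
  fix A assume "A \<subseteq> carrier (St c)"
  then have A_sub: "A \<subseteq> X c" by simp
  show "\<exists>s\<in>carrier (St c). (\<forall>x\<in>A. x \<sqsubseteq>\<^bsub>St c\<^esub> s) \<and>
     (\<forall>u\<in>carrier (St c). (\<forall>x\<in>A. x \<sqsubseteq>\<^bsub>St c\<^esub> u) \<longrightarrow> s \<sqsubseteq>\<^bsub>St c\<^esub> u)"
    using complete[OF assms generated_Pw[OF A_sub]] Join_generated_iff_lub[OF assms A_sub] by auto
qed

lemma
  assumes "c \<in> Obj C"
  shows stage_Sup_closed [simp]: "A \<subseteq> X c \<Longrightarrow> \<Squnion>\<^bsub>St c\<^esub> A \<in> X c"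
    and stage_top_closed [simp]: "\<top>\<^bsub>St c\<^esub> \<in> X c"
    and stage_bottom_closed [simp]: "\<bottom>\<^bsub>St c\<^esub> \<in> X c"
    and stage_meet_closed [simp]: "x \<in> X c \<Longrightarrow> y \<in> X c \<Longrightarrow> x \<sqinter>\<^bsub>St c\<^esub> y \<in> X c"
    and stage_join_closed [simp]: "x \<in> X c \<Longrightarrow> y \<in> X c \<Longrightarrow> x \<squnion>\<^bsub>St c\<^esub> y \<in> X c"
    and stage_join_left: "x \<in> X c \<Longrightarrow> y \<in> X c \<Longrightarrow> le c x (x \<squnion>\<^bsub>St c\<^esub> y)"
    and stage_join_right: "x \<in> X c \<Longrightarrow> y \<in> X c \<Longrightarrow> le c y (x \<squnion>\<^bsub>St c\<^esub> y)"
    and stage_join_least: "le c x z \<Longrightarrow> le c y z \<Longrightarrow> le c (x \<squnion>\<^bsub>St c\<^esub> y) z"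
proof -
  interpret complete_lattice "St c" by (rule complete_lattice_stage[OF assms])
  show "A \<subseteq> X c \<Longrightarrow> \<Squnion>\<^bsub>St c\<^esub> A \<in> X c" using sup_closed[of A] by simp
  show "\<top>\<^bsub>St c\<^esub> \<in> X c" "\<bottom>\<^bsub>St c\<^esub> \<in> X c" using top_closed bottom_closed by simp_all
  show "x \<in> X c \<Longrightarrow> y \<in> X c \<Longrightarrow> x \<sqinter>\<^bsub>St c\<^esub> y \<in> X c" using meet_closed[of x y] by simp
  show "x \<in> X c \<Longrightarrow> y \<in> X c \<Longrightarrow> x \<squnion>\<^bsub>St c\<^esub> y \<in> X c" using join_closed[of x y] by simp
  show "x \<in> X c \<Longrightarrow> y \<in> X c \<Longrightarrow> le c x (x \<squnion>\<^bsub>St c\<^esub> y)" using join_left[of x y] by simp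
  show "x \<in> X c \<Longrightarrow> y \<in> X c \<Longrightarrow> le c y (x \<squnion>\<^bsub>St c\<^esub> y)" using join_right[of x y] by simp
  show "le c x z \<Longrightarrow> le c y z \<Longrightarrow> le c (x \<squnion>\<^bsub>St c\<^esub> y) z"
    using join_le[of x z y] le_in_X[OF assms] by simp
qed

lemma Join_generated_iff:
  assumes "c \<in> Obj C" "A \<subseteq> X c" "s \<in> X c"
  shows "Join_at c (generated c A) s \<longleftrightarrow> s = \<Squnion>\<^bsub>St c\<^esub> A"
proof -
  interpret complete_lattice "St c" by (rule complete_lattice_stage[OF assms(1)])
  have "Join_at c (generated c A) (\<Squnion>\<^bsub>St c\<^esub> A)"
    using assms sup_upper[of A] sup_least[of A] by (simp add: Join_generated_iff_lub)
  then show ?thesis using assms Join_at_unique[OF assms(1) generated_Pw[OF assms(2)]] by auto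
qed

lemma top_at_iff:
  assumes "c \<in> Obj C" "t \<in> X c"
  shows "top_at c t \<longleftrightarrow> t = \<top>\<^bsub>St c\<^esub>"
proof -
  interpret complete_lattice "St c" by (rule complete_lattice_stage[OF assms(1)])
  let ?all = "{(f, x). f \<in> into C c \<and> x \<in> X (Dom C f)}"
  have "?all \<in> Pw c" by (rule PwI) auto
  then obtain t' where "t' \<in> X c" "Join_at c ?all t'" using complete[OF assms(1)] by blast
  then have t'_in: "t' \<in> X c" "top_at c t'" by (auto simp: Join_at_def ub_at_def top_at_def)
  then have "t' = \<top>\<^bsub>St c\<^esub>"
    using top_at_greatest[OF assms(1) t'_in(1)] by (intro top_eq) auto
  then show ?thesis using t'_in top_at_unique[OF assms t'_in(1)] by auto
qed

lemma meet_at_iff: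
  assumes "c \<in> Obj C" "a \<in> X c" "b \<in> X c" "m \<in> X c"
  shows "meet_at c a b m \<longleftrightarrow> m = a \<sqinter>\<^bsub>St c\<^esub> b"
proof -
  interpret complete_lattice "St c" by (rule complete_lattice_stage[OF assms(1)])
  let ?lower = "{(f, x). f \<in> into C c \<and> le (Dom C f) x (res f a) \<and> le (Dom C f) x (res f b)}"
  have lower: "?lower \<in> Pw c"
    by (rule PwI) (use assms in \<open>auto simp: le_res dest: le_in_X(1)[rotated]\<close>)
  obtain m' where m'_in: "m' \<in> X c" "Join_at c ?lower m'" using complete[OF assms(1) lower] by blast
  then have "le c m' a" "le c m' b"
    using assms lower by (auto simp: ub_at_def intro: Join_at_least)
  then have meet: "meet_at c a b m'" using m'_in by (auto simp: Join_at_def ub_at_def meet_at_def)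
  then have "a \<sqinter>\<^bsub>St c\<^esub> b = m'"
    using assms m'_in(1) meet_at_greatest[OF assms(1-3) m'_in(1) meet]
    by (intro meet_eqI) (auto simp: meet_at_def)
  then show ?thesis using meet meet_at_unique[OF assms(1-4) m'_in(1) _ meet] by blast
qed

lemma bot_at_iff:
  assumes "c \<in> Obj C" "z \<in> X c"
  shows "bot_at c z \<longleftrightarrow> z = \<bottom>\<^bsub>St c\<^esub>"
proof -
  interpret complete_lattice "St c" by (rule complete_lattice_stage[OF assms(1)])
  have "generated c {} = {}" by (simp add: generated_def)
  then show ?thesis
    using Join_generated_iff[OF assms(1) _ assms(2), of "{}"]
    by (simp add: bot_at_iff_Join_at Sup_empty)
qed

lemma join_at_iff:
  assumes "c \<in> Obj C" "a \<in> X c" "b \<in> X c" "j \<in> X c"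
  shows "join_at c a b j \<longleftrightarrow> j = a \<squnion>\<^bsub>St c\<^esub> b"
  using assms by (simp add: join_at_iff_Join_at Join_generated_iff join_def)

lemma well_inside_at_iff:
  assumes "c \<in> Obj C" "a \<in> X c" "b \<in> X c"
  shows "well_inside_at c a b \<longleftrightarrow> well_inside (St c) a b"
  using assms unfolding well_inside_at_def well_inside_def
  by (auto simp: top_at_iff bot_at_iff meet_at_iff join_at_iff eq_commute[of "\<bottom>\<^bsub>St c\<^esub>"]
      eq_commute[of "\<top>\<^bsub>St c\<^esub>"] cong: bex_cong)

lemma res_top: "f \<in> into C c \<Longrightarrow> res f \<top>\<^bsub>St c\<^esub> = \<top>\<^bsub>St (Dom C f)\<^esub>"
  using top_at_res[of f c "\<top>\<^bsub>St c\<^esub>"] into_obj[of f c] by (simp add: top_at_iff)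

lemma res_meet:
  assumes "f \<in> into C c" "a \<in> X c" "b \<in> X c"
  shows "res f (a \<sqinter>\<^bsub>St c\<^esub> b) = res f a \<sqinter>\<^bsub>St (Dom C f)\<^esub> res f b"
  using meet_at_res[OF assms, of "a \<sqinter>\<^bsub>St c\<^esub> b"] assms into_obj[OF assms(1)] by (simp add: meet_at_iff)

lemma res_Sup:
  assumes "f \<in> into C c" "A \<subseteq> X c"
  shows "res f (\<Squnion>\<^bsub>St c\<^esub> A) = \<Squnion>\<^bsub>St (Dom C f)\<^esub> (res f ` A)"
proof -
  have "res f ` A \<subseteq> X (Dom C f)" using assms by auto
  then show ?thesis
    using Join_at_res[OF assms(1) generated_Pw[OF assms(2)], of "\<Squnion>\<^bsub>St c\<^esub> A"] assms
      into_obj[OF assms(1)]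
    by (simp add: pres_generated Join_generated_iff)
qed

lemma meet_family_generated:
  assumes "c \<in> Obj C" "a \<in> X c" "A \<subseteq> X c"
  shows "meet_family c a (generated c A) = generated c ((\<lambda>x. a \<sqinter>\<^bsub>St c\<^esub> x) ` A)"
proof -
  have "(f, y) \<in> meet_family c a (generated c A) \<longleftrightarrow> (f, y) \<in> generated c ((\<lambda>x. a \<sqinter>\<^bsub>St c\<^esub> x) ` A)"
    for f y
  proof (cases "f \<in> into C c")
    case f_into: True
    have "(\<exists>z\<in>X (Dom C f). (\<exists>x\<in>A. z = res f x) \<and> meet_at (Dom C f) (res f a) z y) \<longleftrightarrow>
        (\<exists>x\<in>A. y = res f (a \<sqinter>\<^bsub>St c\<^esub> x))" if "y \<in> X (Dom C f)"
      using that f_into assms by (auto simp: res_meet meet_at_iff subset_iff)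
    moreover have "y \<in> X (Dom C f)" if "\<exists>x\<in>A. y = res f (a \<sqinter>\<^bsub>St c\<^esub> x)"
      using that f_into assms by auto
    ultimately show ?thesis using f_into by (auto simp: meet_family_def mem_generated)
  qed (simp add: meet_family_def mem_generated)
  then show ?thesis by auto
qed

lemma frame_stage:
  assumes "c \<in> Obj C"
  shows "frame (St c)"
proof -
  interpret complete_lattice "St c" by (rule complete_lattice_stage[OF assms])
  show ?thesis
  proof unfold_locales
    fix a A assume "a \<in> carrier (St c)" "A \<subseteq> carrier (St c)"
    then have aA_in: "a \<in> X c" "A \<subseteq> X c" by auto
    have "Join_at c (meet_family c a (generated c A)) (a \<sqinter>\<^bsub>St c\<^esub> \<Squnion>\<^bsub>St c\<^esub> A)"
      using assms aA_in
      by (intro distrib[of _ _ _ "\<Squnion>\<^bsub>St c\<^esub> A"])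
        (simp_all add: generated_Pw Join_generated_iff meet_at_iff)
    moreover have "(\<lambda>x. a \<sqinter>\<^bsub>St c\<^esub> x) ` A \<subseteq> X c" using assms aA_in by auto
    ultimately show "a \<sqinter>\<^bsub>St c\<^esub> \<Squnion>\<^bsub>St c\<^esub> A = \<Squnion>\<^bsub>St c\<^esub> ((\<lambda>x. a \<sqinter>\<^bsub>St c\<^esub> x) ` A)"
      using assms aA_in by (simp add: meet_family_generated Join_generated_iff)
  qed
qed

lemma frame_homomorphism_res:
  assumes "f \<in> into C c"
  shows "frame_homomorphism (St c) (St (Dom C f)) (res f)"
  using assms into_obj[OF assms]
  by (intro frame_homomorphism.intro frame_homomorphism_axioms.intro frame_stage)
    (auto simp: frame_hom_def res_top res_meet res_Sup)

lemma mem_interior_family: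
  assumes "u \<in> X c"
  shows "(f, x) \<in> interior_family c u \<longleftrightarrow>
    f \<in> into C c \<and> x \<in> X (Dom C f) \<and> well_inside (St (Dom C f)) x (res f u)"
  using assms by (auto simp: interior_family_def well_inside_at_iff)

end

context internal_kreg
begin

lemma compact_frame_stage:
  assumes "c \<in> Obj C"
  shows "compact_frame (St c)"
  unfolding compact_frame_def
proof (intro allI impI)
  fix A assume "A \<subseteq> carrier (St c)" and directed: "directed_in (St c) A" and Sup: "\<Squnion>\<^bsub>St c\<^esub> A = \<top>\<^bsub>St c\<^esub>"
  then have A_sub: "A \<subseteq> X c" by simp
  have "directed_at c (generated c A)" unfolding directed_at_def
  proof (intro conjI allI impI)
    obtain x where "x \<in> A" using directed by (auto simp: directed_in_def)
    then show "\<exists>x\<in>X c. (Idt C c, x) \<in> generated c A"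
      using A_sub assms by (force simp: mem_generated)
    fix f y y' assume "(f, y) \<in> generated c A" "(f, y') \<in> generated c A"
    then obtain x x' where f_into: "f \<in> into C c" and "x \<in> A" "x' \<in> A"
      and eq: "y = res f x" "y' = res f x'"
      by (auto simp: mem_generated)
    then obtain z where "z \<in> A" "le c x z" "le c x' z" using directed
      by (auto simp: directed_in_def)
    then show "\<exists>z. (f, z) \<in> generated c A \<and> le (Dom C f) y z \<and> le (Dom C f) y' z"
      using f_into by (intro exI[of _ "res f z"]) (auto simp: eq mem_generated le_res)
  qed
  then have "(Idt C c, \<top>\<^bsub>St c\<^esub>) \<in> generated c A"
    using assms A_sub Sup
    by (intro compact) (simp_all add: generated_Pw top_at_iff Join_generated_iff)
  then show "\<top>\<^bsub>St c\<^esub> \<in> A" using A_sub assms by (auto simp: mem_generated)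
qed

definition join_family :: "('a \<times> 'u) set \<Rightarrow> 'u \<Rightarrow> ('a \<times> 'u) set" where
  "join_family S w = {(f, y). \<exists>x. (f, x) \<in> S \<and> y = x \<squnion>\<^bsub>St (Dom C f)\<^esub> res f w}"

lemma join_family_Pw:
  assumes "S \<in> Pw c" "w \<in> X c"
  shows "join_family S w \<in> Pw c"
proof (rule PwI)
  fix f y assume "(f, y) \<in> join_family S w"
  then obtain x where x_in: "(f, x) \<in> S" and y_eq: "y = x \<squnion>\<^bsub>St (Dom C f)\<^esub> res f w"
    by (auto simp: join_family_def)
  note f_x_in = PwD(1,2)[OF assms(1) x_in]
  show "f \<in> into C c \<and> y \<in> X (Dom C f)" using f_x_in y_eq assms by auto
  fix g assume g_into: "g \<in> into C (Dom C f)"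
  interpret frame_homomorphism "St (Dom C f)" "St (Dom C g)" "res g"
    by (rule frame_homomorphism_res[OF g_into])
  show "(Cmp C f g, res g y) \<in> join_family S w"
    using PwD(3)[OF assms(1) x_in g_into] hom_join[of x "res f w"] f_x_in g_into y_eq assms(2)
    by (auto simp: join_family_def)
qed

lemma directed_join_family:
  assumes "c \<in> Obj C" "S \<in> Pw c" "w \<in> X c" and directed: "directed_at c S"
  shows "directed_at c (join_family S w)"
  unfolding directed_at_def
proof (intro conjI allI impI)
  obtain x where "x \<in> X c" "(Idt C c, x) \<in> S" using directed by (auto simp: directed_at_def)
  then show "\<exists>x\<in>X c. (Idt C c, x) \<in> join_family S w"
    using assms by (intro bexI[of _ "x \<squnion>\<^bsub>St c\<^esub> w"]) (auto simp: join_family_def)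
  fix f y y' assume "(f, y) \<in> join_family S w" "(f, y') \<in> join_family S w"
  then obtain x x' where x_in: "(f, x) \<in> S" "(f, x') \<in> S"
    and y_eq: "y = x \<squnion>\<^bsub>St (Dom C f)\<^esub> res f w" "y' = x' \<squnion>\<^bsub>St (Dom C f)\<^esub> res f w"
    by (auto simp: join_family_def)
  note f_x_in = PwD(1,2)[OF assms(2) x_in(1)] PwD(2)[OF assms(2) x_in(2)]
  interpret frame "St (Dom C f)" by (rule frame_stage[OF into_dom[OF f_x_in(1)]])
  obtain z where z_in: "(f, z) \<in> S" "le (Dom C f) x z" "le (Dom C f) x' z"
    using directed x_in unfolding directed_at_def by blast
  then show "\<exists>z. (f, z) \<in> join_family S w \<and> le (Dom C f) y z \<and> le (Dom C f) y' z"
    using join_mono[of x "res f w" z "res f w"] join_mono[of x' "res f w" z "res f w"]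
      f_x_in assms(3) PwD(2)[OF assms(2) z_in(1)] weak_refl[of "res f w"]
    by (intro exI[of _ "z \<squnion>\<^bsub>St (Dom C f)\<^esub> res f w"]) (auto simp: join_family_def y_eq)
qed

text \<open>Unlike compactness of the stage at \<open>c\<close>, this concerns joins of elements at all the
  stages above \<open>c\<close>.\<close>

lemma compact_cover:
  assumes c_obj: "c \<in> Obj C" and S_Pw: "S \<in> Pw c" "directed_at c S"
    and s_in: "s \<in> X c" "Join_at c S s"
    and w_in: "w \<in> X c" "s \<squnion>\<^bsub>St c\<^esub> w = \<top>\<^bsub>St c\<^esub>"
  obtains x where "x \<in> X c" "(Idt C c, x) \<in> S" "x \<squnion>\<^bsub>St c\<^esub> w = \<top>\<^bsub>St c\<^esub>"
proof -
  note T_Pw = join_family_Pw[OF S_Pw(1) w_in(1)]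
  obtain t where t_in: "t \<in> X c" "Join_at c (join_family S w) t" using complete[OF c_obj T_Pw]
    by blast
  have le_t: "le (Dom C f) (x \<squnion>\<^bsub>St (Dom C f)\<^esub> res f w) (res f t)" if "(f, x) \<in> S" for f x
    using t_in(2) that by (auto simp: Join_at_def ub_at_def join_family_def)
  have "ub_at c S t"
    unfolding ub_at_def
  proof (intro allI impI)
    fix f x assume fx_in: "(f, x) \<in> S"
    note f_x_in = PwD(1,2)[OF S_Pw(1) fx_in]
    show "le (Dom C f) x (res f t)"
      using le_trans[OF into_dom[OF f_x_in(1)] stage_join_left le_t[OF fx_in]] f_x_in w_in(1)
      by auto
  qed
  then have "le c s t" using Join_at_least c_obj S_Pw(1) s_in t_in(1) by blast
  moreover have "le c w t"
  proof -
    obtain x where "x \<in> X c" "(Idt C c, x) \<in> S" using S_Pw(2) by (auto simp: directed_at_def)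
    then show ?thesis
      using le_trans[OF c_obj stage_join_right[OF c_obj, of x w], of t] le_t[of "Idt C c" x] c_obj
        w_in(1) t_in(1) by simp
  qed
  ultimately have "le c \<top>\<^bsub>St c\<^esub> t" using stage_join_least[OF c_obj] w_in(2) by metis
  then have "t = \<top>\<^bsub>St c\<^esub>"
    using complete_lattice.top_le[OF complete_lattice_stage[OF c_obj], of t] t_in(1) by simp
  then have "(Idt C c, \<top>\<^bsub>St c\<^esub>) \<in> join_family S w"
    using c_obj t_in T_Pw directed_join_family[OF c_obj S_Pw(1) w_in(1) S_Pw(2)]
    by (intro compact) (auto simp: top_at_iff)
  then show ?thesis using that PwD(2)[OF S_Pw(1), of "Idt C c"] c_obj w_in(1)
    by (auto simp: join_family_def)
qed

lemma directed_interior_family: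
  assumes "c \<in> Obj C" "u \<in> X c"
  shows "directed_at c (interior_family c u)"
  unfolding directed_at_def
proof (intro conjI allI impI)
  interpret frame "St c" by (rule frame_stage[OF assms(1)])
  show "\<exists>x\<in>X c. (Idt C c, x) \<in> interior_family c u"
    using assms well_inside_bottom[of u]
    by (intro bexI[of _ "\<bottom>\<^bsub>St c\<^esub>"]) (auto simp: mem_interior_family)
next
  fix f x y assume "(f, x) \<in> interior_family c u" "(f, y) \<in> interior_family c u"
  then have f_into: "f \<in> into C c"
    and x_in: "x \<in> X (Dom C f)" "well_inside (St (Dom C f)) x (res f u)"
    and y_in: "y \<in> X (Dom C f)" "well_inside (St (Dom C f)) y (res f u)"
    using assms(2) by (auto simp: mem_interior_family)
  interpret frame "St (Dom C f)" by (rule frame_stage[OF into_dom[OF f_into]])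
  show "\<exists>z. (f, z) \<in> interior_family c u \<and> le (Dom C f) x z \<and> le (Dom C f) y z"
    using f_into x_in y_in assms(2) well_inside_join[of x "res f u" y] stage_join_left
      stage_join_right
    by (intro exI[of _ "x \<squnion>\<^bsub>St (Dom C f)\<^esub> y"]) (auto simp: mem_interior_family)
qed

lemma normal_frame_stage:
  assumes "c \<in> Obj C"
  shows "normal_frame (St c)"
proof (intro normal_frame.intro normal_frame_axioms.intro frame_stage assms)
  fix u w assume "u \<in> carrier (St c)" "w \<in> carrier (St c)" "u \<squnion>\<^bsub>St c\<^esub> w = \<top>\<^bsub>St c\<^esub>"
  then obtain v where "(Idt C c, v) \<in> interior_family c u" "v \<squnion>\<^bsub>St c\<^esub> w = \<top>\<^bsub>St c\<^esub>"
    using compact_cover[OF assms interior_family_Pw directed_interior_family _ regular, of u w]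
      assms by auto
  then show "\<exists>v\<in>carrier (St c). well_inside (St c) v u \<and> v \<squnion>\<^bsub>St c\<^esub> w = \<top>\<^bsub>St c\<^esub>"
    using assms \<open>u \<in> carrier (St c)\<close> by (auto simp: mem_interior_family)
qed

lemma kreg_frame_reg_stage: "c \<in> Obj C \<Longrightarrow> kreg_frame (reg_part (St c))"
  by (intro normal_frame.kreg_frame_reg_part normal_frame_stage compact_frame_stage)

lemma reg_interior_closed [simp]: "c \<in> Obj C \<Longrightarrow> reg_interior (St c) x \<in> X c"
  using frame.reg_interior_closed[OF frame_stage, of c x] by simp

lemma le_iff_reg_interior:
  assumes c_obj: "c \<in> Obj C" and x_in: "x \<in> X c" and y_in: "y \<in> X c"
  shows "le c x y \<longleftrightarrow> (\<forall>f\<in>into C c.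
    le (Dom C f) (reg_interior (St (Dom C f)) (res f x)) (reg_interior (St (Dom C f)) (res f y)))"
    (is "_ \<longleftrightarrow> (\<forall>f\<in>_. le _ (?int f x) (?int f y))")
proof
  show "\<forall>f\<in>into C c. le (Dom C f) (?int f x) (?int f y)" if "le c x y"
  proof
    fix f assume f_into: "f \<in> into C c"
    interpret frame "St (Dom C f)" by (rule frame_stage[OF into_dom[OF f_into]])
    show "le (Dom C f) (?int f x) (?int f y)"
      using reg_interior_mono[of "res f x" "res f y"] f_into x_in y_in le_res[OF f_into that]
      by simp
  qed
next
  assume int_le: "\<forall>f\<in>into C c. le (Dom C f) (?int f x) (?int f y)"
  have "ub_at c (interior_family c x) y"
    unfolding ub_at_def
  proof (intro allI impI)
    fix f v assume "(f, v) \<in> interior_family c x"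
    then have f_into: "f \<in> into C c"
      and v_in: "v \<in> X (Dom C f)" "well_inside (St (Dom C f)) v (res f x)"
      using x_in by (auto simp: mem_interior_family)
    interpret frame "St (Dom C f)" by (rule frame_stage[OF into_dom[OF f_into]])
    have "le (Dom C f) v (?int f x)" using le_reg_interior[of v "res f x"] v_in by simp
    moreover have "le (Dom C f) (?int f x) (?int f y)" using int_le f_into by blast
    moreover have "le (Dom C f) (?int f y) (res f y)"
      using reg_interior_le[of "res f y"] f_into y_in by simp
    ultimately show "le (Dom C f) v (res f y)"
      using internal_poset.le_trans[OF internal_poset_axioms into_dom[OF f_into]] by blast
  qed
  then show "le c x y"
    using Join_at_least[OF c_obj interior_family_Pw[OF x_in] x_in y_in regular[OF c_obj x_in]]
    by blast
qed

definition downset_family :: "'o \<Rightarrow> ('a \<Rightarrow> 'u) \<Rightarrow> ('a \<times> 'u) set" where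
  "downset_family c u = {(f, x). f \<in> into C c \<and> le (Dom C f) x (u f)}"

lemma downset_family_Pw:
  assumes "\<And>f g. f \<in> into C c \<Longrightarrow> g \<in> into C (Dom C f) \<Longrightarrow> le (Dom C g) (res g (u f)) (u (Cmp C f g))"
  shows "downset_family c u \<in> Pw c"
proof (rule PwI)
  fix f x assume "(f, x) \<in> downset_family c u"
  then have f_into: "f \<in> into C c" "le (Dom C f) x (u f)" by (auto simp: downset_family_def)
  then show "f \<in> into C c \<and> x \<in> X (Dom C f)" using le_in_X by blast
  show "(Cmp C f g, res g x) \<in> downset_family c u" if g_into: "g \<in> into C (Dom C f)" for g
    using le_trans[OF into_dom[OF g_into] le_res[OF g_into f_into(2)] assms[OF f_into(1) g_into]]
      f_into g_into
    by (simp add: downset_family_def)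
qed

lemma pres_downset_family:
  "f \<in> into C c \<Longrightarrow> pres f (downset_family c u) = downset_family (Dom C f) (\<lambda>g. u (Cmp C f g))"
  by (auto simp: downset_family_def mem_pres)

lemma directed_downset_family:
  assumes "c \<in> Obj C" "\<And>f. f \<in> into C c \<Longrightarrow> u f \<in> X (Dom C f)"
  shows "directed_at c (downset_family c u)"
  unfolding directed_at_def
proof (intro conjI allI impI)
  show "\<exists>x\<in>X c. (Idt C c, x) \<in> downset_family c u"
    using assms assms(2)[OF into_id]
    by (intro bexI[of _ "u (Idt C c)"]) (auto simp: downset_family_def le_refl)
  fix f y z assume "(f, y) \<in> downset_family c u" "(f, z) \<in> downset_family c u"
  then show "\<exists>b. (f, b) \<in> downset_family c u \<and> le (Dom C f) y b \<and> le (Dom C f) z b"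
    using assms by (intro exI[of _ "u f"]) (auto simp: downset_family_def le_refl)
qed

lemma reg_interior_Join_downset_family:
  assumes c_obj: "c \<in> Obj C" and x_in: "x \<in> X c" "Join_at c (downset_family c u) x"
    and u_reg: "\<And>f. f \<in> into C c \<Longrightarrow> u f \<in> regs (St (Dom C f))"
    and lax: "\<And>f g. f \<in> into C c \<Longrightarrow> g \<in> into C (Dom C f) \<Longrightarrow>
      le (Dom C g) (res g (u f)) (u (Cmp C f g))"
  shows "reg_interior (St c) x = u (Idt C c)"
proof (rule le_antisym[OF c_obj])
  have u_closed: "u f \<in> X (Dom C f)" if "f \<in> into C c" for f using regs_carrier[OF u_reg[OF that]]
    by simp
  have u_reg: "u (Idt C c) \<in> regs (St c)" using u_reg[OF into_id[OF c_obj]] c_obj by simp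
  have u_id: "u (Idt C c) \<in> X c" using regs_carrier[OF u_reg] by simp
  have u_le_refl: "le c (u (Idt C c)) (u (Idt C c))" by (rule le_refl[OF c_obj u_id])
  interpret frame "St c" by (rule frame_stage[OF c_obj])
  have "le c (u (Idt C c)) x"
    using x_in(2)[unfolded Join_at_def ub_at_def, THEN conjunct1, rule_format,
        of "Idt C c" "u (Idt C c)"] c_obj x_in(1) u_id u_le_refl by (simp add: downset_family_def)
  then show "le c (u (Idt C c)) (reg_interior (St c) x)"
    using reg_interior_mono[of "u (Idt C c)" x] reg_interior_regs[OF u_reg] x_in(1) u_id by simp
  have "le c v (u (Idt C c))" if v_in: "v \<in> X c" "well_inside (St c) v x" for v
  proof -
    obtain w where w_in: "w \<in> X c" "v \<sqinter>\<^bsub>St c\<^esub> w = \<bottom>\<^bsub>St c\<^esub>" "x \<squnion>\<^bsub>St c\<^esub> w = \<top>\<^bsub>St c\<^esub>"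
      using well_insideE[OF v_in(2)] by auto
    obtain y where y_in: "y \<in> X c" "(Idt C c, y) \<in> downset_family c u" "y \<squnion>\<^bsub>St c\<^esub> w = \<top>\<^bsub>St c\<^esub>"
      using compact_cover[OF c_obj downset_family_Pw[OF lax]
        directed_downset_family[OF c_obj u_closed] x_in w_in(1,3)] by blast
    have "u (Idt C c) \<squnion>\<^bsub>St c\<^esub> w = \<top>\<^bsub>St c\<^esub>"
      using join_top_mono[of y w "u (Idt C c)" w] y_in c_obj w_in(1) u_id weak_refl[of w]
      by (simp add: downset_family_def)
    then show ?thesis using le_if_meet_bottom_join_top[of v "u (Idt C c)" w] v_in w_in u_id by simp
  qed
  then show "le c (reg_interior (St c) x) (u (Idt C c))"
    using reg_interior_least[of "u (Idt C c)" x] u_id by simp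
qed

lemma lax_family_realized:
  assumes c_obj: "c \<in> Obj C" and u_reg: "\<And>f. f \<in> into C c \<Longrightarrow> u f \<in> regs (St (Dom C f))"
    and lax: "\<And>f g. f \<in> into C c \<Longrightarrow> g \<in> into C (Dom C f) \<Longrightarrow>
      le (Dom C g) (res g (u f)) (u (Cmp C f g))"
  obtains x where "x \<in> X c" "\<And>f. f \<in> into C c \<Longrightarrow> reg_interior (St (Dom C f)) (res f x) = u f"
proof -
  note Pw = downset_family_Pw[OF lax]
  obtain x where x_in: "x \<in> X c" "Join_at c (downset_family c u) x" using complete[OF c_obj Pw]
    by blast
  have "reg_interior (St (Dom C f)) (res f x) = u (Cmp C f (Idt C (Dom C f)))"
    if f_into: "f \<in> into C c" for f
  proof (rule reg_interior_Join_downset_family)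
    show "Join_at (Dom C f) (downset_family (Dom C f) (\<lambda>g. u (Cmp C f g))) (res f x)"
      using Join_at_res[OF f_into Pw x_in] by (simp add: pres_downset_family[OF f_into])
    show "u (Cmp C f g) \<in> regs (St (Dom C g))" if "g \<in> into C (Dom C f)" for g
      using u_reg[OF into_comp[OF f_into that]] f_into that by simp
    show "le (Dom C h) (res h (u (Cmp C f g))) (u (Cmp C f (Cmp C g h)))"
      if "g \<in> into C (Dom C f)" "h \<in> into C (Dom C g)" for g h
      using lax[OF into_comp[OF f_into that(1)], of h] f_into that by simp
  qed (use f_into x_in(1) in auto)
  then show ?thesis using that x_in(1) by simp
qed

definition regs_below :: "'o \<Rightarrow> 'u \<Rightarrow> ('a \<times> 'u) set" where
  "regs_below c x = {(f, v). f \<in> into C c \<and> v \<in> regs (St (Dom C f)) \<and> le (Dom C f) v (res f x)}"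

lemma regs_below_Pw:
  assumes "x \<in> X c"
  shows "regs_below c x \<in> Pw c"
proof (rule PwI)
  fix f v g assume "(f, v) \<in> regs_below c x" and g_into: "g \<in> into C (Dom C f)"
  then have f_into: "f \<in> into C c" "v \<in> regs (St (Dom C f))" "le (Dom C f) v (res f x)"
    by (auto simp: regs_below_def)
  interpret frame_homomorphism "St (Dom C f)" "St (Dom C g)" "res g"
    by (rule frame_homomorphism_res[OF g_into])
  show "(Cmp C f g, res g v) \<in> regs_below c x"
    using f_into g_into assms hom_regs[OF f_into(2)] le_res[OF g_into f_into(3)]
    by (auto simp: regs_below_def)
qed (auto simp: regs_below_def dest: regs_carrier)

lemma Join_regs_below:
  assumes c_obj: "c \<in> Obj C" and x_in: "x \<in> X c"
  shows "Join_at c (regs_below c x) x"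
  unfolding Join_at_iff_least[OF c_obj regs_below_Pw[OF x_in] x_in]
proof (intro conjI ballI impI)
  show "ub_at c (regs_below c x) x" by (auto simp: ub_at_def regs_below_def)
  fix u assume u_in: "u \<in> X c" and upper: "ub_at c (regs_below c x) u"
  have "ub_at c (interior_family c x) u"
    unfolding ub_at_def
  proof (intro allI impI)
    fix f v assume "(f, v) \<in> interior_family c x"
    then have f_into: "f \<in> into C c"
      and v_in: "v \<in> X (Dom C f)" "well_inside (St (Dom C f)) v (res f x)"
      using x_in by (auto simp: mem_interior_family)
    interpret normal_frame "St (Dom C f)" by (rule normal_frame_stage[OF into_dom[OF f_into]])
    let ?i = "reg_interior (St (Dom C f)) (res f x)"
    have "(f, ?i) \<in> regs_below c x"
      using f_into x_in reg_interior_in_regs[of "res f x"] reg_interior_le[of "res f x"]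
      by (simp add: regs_below_def)
    then have "le (Dom C f) ?i (res f u)" using upper by (simp add: ub_at_def)
    moreover have "le (Dom C f) v ?i" using le_reg_interior[of v "res f x"] v_in by simp
    ultimately show "le (Dom C f) v (res f u)"
      using internal_poset.le_trans[OF internal_poset_axioms into_dom[OF f_into]] by blast
  qed
  then show "le c x u"
    using Join_at_least[OF c_obj interior_family_Pw[OF x_in] x_in u_in regular[OF c_obj x_in]]
    by blast
qed

end

section \<open>Representation by lax families\<close>

locale kreg_presheaf = cat C for C :: "('o, 'a) category" +
  fixes K :: "'o \<Rightarrow> 'u gorder" and kr :: "'a \<Rightarrow> 'u \<Rightarrow> 'u"
  assumes K_kreg: "c \<in> Obj C \<Longrightarrow> kreg_frame (K c)"
    and kr_hom: "f \<in> into C c \<Longrightarrow> frame_homomorphism (K c) (K (Dom C f)) (kr f)"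
    and kr_id [simp]: "c \<in> Obj C \<Longrightarrow> k \<in> carrier (K c) \<Longrightarrow> kr (Idt C c) k = k"
    and kr_comp: "f \<in> into C c \<Longrightarrow> g \<in> into C (Dom C f) \<Longrightarrow> k \<in> carrier (K c) \<Longrightarrow>
      kr (Cmp C f g) k = kr g (kr f k)"
begin

lemma K_frame: "c \<in> Obj C \<Longrightarrow> frame (K c)"
  by (rule kreg_frame.axioms(1)[OF K_kreg])

lemma kr_closed [simp]: "f \<in> into C c \<Longrightarrow> k \<in> carrier (K c) \<Longrightarrow> kr f k \<in> carrier (K (Dom C f))"
  using frame_homomorphism.hom_closed[OF kr_hom] .

lemma K_refl:
  assumes "c \<in> Obj C" "k \<in> carrier (K c)"
  shows "k \<sqsubseteq>\<^bsub>K c\<^esub> k"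
proof -
  interpret frame "K c" by (rule K_frame[OF assms(1)])
  show ?thesis using assms(2) by simp
qed

definition lax_families :: "'o \<Rightarrow> ('a \<Rightarrow> 'u) set" where
  "lax_families c = {u \<in> (\<Pi>\<^sub>E f\<in>into C c. carrier (K (Dom C f))).
     \<forall>f\<in>into C c. \<forall>g\<in>into C (Dom C f). kr g (u f) \<sqsubseteq>\<^bsub>K (Dom C g)\<^esub> u (Cmp C f g)}"

lemma restrict_lax_families:
  "(\<lambda>f\<in>into C c. u f) \<in> lax_families c \<longleftrightarrow>
     (\<forall>f\<in>into C c. u f \<in> carrier (K (Dom C f)) \<and>
        (\<forall>g\<in>into C (Dom C f). kr g (u f) \<sqsubseteq>\<^bsub>K (Dom C g)\<^esub> u (Cmp C f g)))"
  by (auto simp: lax_families_def)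

end

text \<open>\<open>L\<close> is lax-represented by a presheaf \<open>K\<close> of compact regular frames if \<open>L(c)\<close> is, via
  \<open>x \<mapsto> (r (f\<^sup>* x))\<^sub>f\<close>, the poset of families \<open>(u\<^sub>f)\<close> indexed by the arrows \<open>f : d \<rightarrow> c\<close> with
  \<open>u\<^sub>f \<in> K(d)\<close> and \<open>g\<^sup>* u\<^sub>f \<le> u\<^bsub>fg\<^esub>\<close>. The families with equality here, which are
  determined by \<open>u\<^bsub>id\<^esub> \<in> K(c)\<close>, are then the regular elements of \<open>L(c)\<close>.\<close>

locale lax_rep = psh_relation C U L + kreg_presheaf C K kr
  for C :: "('o, 'a) category" and U :: "'u set set" and L
    and K :: "'o \<Rightarrow> 'u gorder" and kr :: "'a \<Rightarrow> 'u \<Rightarrow> 'u" +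
  fixes r :: "'o \<Rightarrow> 'u \<Rightarrow> 'u"
  assumes rep_bij: "c \<in> Obj C \<Longrightarrow>
      bij_betw (\<lambda>x. \<lambda>f\<in>into C c. r (Dom C f) (res f x)) (X c) (lax_families c)"
    and rep_le: "c \<in> Obj C \<Longrightarrow> x \<in> X c \<Longrightarrow> y \<in> X c \<Longrightarrow>
      le c x y \<longleftrightarrow> (\<forall>f\<in>into C c. r (Dom C f) (res f x) \<sqsubseteq>\<^bsub>K (Dom C f)\<^esub> r (Dom C f) (res f y))"
begin

definition coord :: "'u \<Rightarrow> 'a \<Rightarrow> 'u" where
  "coord x f = r (Dom C f) (res f x)"

lemma coord_res [simp]: "f \<in> into C c \<Longrightarrow> g \<in> into C (Dom C f) \<Longrightarrow> x \<in> X c \<Longrightarrow>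
    coord (res f x) g = coord x (Cmp C f g)"
  by (simp add: coord_def)

lemma coord_id: "c \<in> Obj C \<Longrightarrow> x \<in> X c \<Longrightarrow> coord x (Idt C c) = r c x"
  by (simp add: coord_def)

lemma coords_lax: "c \<in> Obj C \<Longrightarrow> x \<in> X c \<Longrightarrow> (\<lambda>f\<in>into C c. coord x f) \<in> lax_families c"
  using bij_betw_apply[OF rep_bij] by (simp add: coord_def)

lemma coord_closed [simp]: "f \<in> into C c \<Longrightarrow> x \<in> X c \<Longrightarrow> coord x f \<in> carrier (K (Dom C f))"
  and coord_lax: "f \<in> into C c \<Longrightarrow> g \<in> into C (Dom C f) \<Longrightarrow> x \<in> X c \<Longrightarrow>
    kr g (coord x f) \<sqsubseteq>\<^bsub>K (Dom C g)\<^esub> coord x (Cmp C f g)"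
  using coords_lax[OF into_obj] by (auto simp: restrict_lax_families)

lemma r_closed [simp]: "c \<in> Obj C \<Longrightarrow> x \<in> X c \<Longrightarrow> r c x \<in> carrier (K c)"
  using coord_closed[of "Idt C c" c x] by (simp add: coord_id)

lemma kr_r_le: "f \<in> into C c \<Longrightarrow> x \<in> X c \<Longrightarrow> kr f (r c x) \<sqsubseteq>\<^bsub>K (Dom C f)\<^esub> coord x f"
  using coord_lax[of "Idt C c" c f x] into_obj[of f c] by (simp add: coord_id)

lemma le_iff_coord: "c \<in> Obj C \<Longrightarrow> x \<in> X c \<Longrightarrow> y \<in> X c \<Longrightarrow>
    le c x y \<longleftrightarrow> (\<forall>f\<in>into C c. coord x f \<sqsubseteq>\<^bsub>K (Dom C f)\<^esub> coord y f)"
  by (simp add: rep_le coord_def)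

lemma coord_mono: "f \<in> into C c \<Longrightarrow> le c x y \<Longrightarrow> coord x f \<sqsubseteq>\<^bsub>K (Dom C f)\<^esub> coord y f"
  using le_iff_coord[OF into_obj] le_in_X[OF into_obj] by blast

lemma r_mono: "c \<in> Obj C \<Longrightarrow> le c x y \<Longrightarrow> r c x \<sqsubseteq>\<^bsub>K c\<^esub> r c y"
  using coord_mono[of "Idt C c" c x y] by (simp add: coord_id le_in_X)

lemma eq_if_coord_eq:
  assumes "c \<in> Obj C" "x \<in> X c" "y \<in> X c" "\<And>f. f \<in> into C c \<Longrightarrow> coord x f = coord y f"
  shows "x = y"
  using bij_betw_imp_inj_on[OF rep_bij[OF assms(1)]] assms(2-4)
  by (auto simp: coord_def[symmetric] inj_on_def intro!: restrict_ext)

definition realize :: "'o \<Rightarrow> ('a \<Rightarrow> 'u) \<Rightarrow> 'u" where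
  "realize c u = inv_into (X c) (\<lambda>x. \<lambda>f\<in>into C c. coord x f) (\<lambda>f\<in>into C c. u f)"

lemma
  assumes "c \<in> Obj C" "(\<lambda>f\<in>into C c. u f) \<in> lax_families c"
  shows realize_closed: "realize c u \<in> X c"
    and coord_realize: "f \<in> into C c \<Longrightarrow> coord (realize c u) f = u f"
proof -
  have bij: "bij_betw (\<lambda>x. \<lambda>f\<in>into C c. coord x f) (X c) (lax_families c)"
    using rep_bij[OF assms(1)] by (simp add: coord_def)
  show "realize c u \<in> X c"
    unfolding realize_def using bij_betw_apply[OF bij_betw_inv_into[OF bij] assms(2)] .
  have "(\<lambda>f\<in>into C c. coord (realize c u) f) = (\<lambda>f\<in>into C c. u f)"
    unfolding realize_def by (rule bij_betw_inv_into_right[OF bij assms(2)])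
  then show "coord (realize c u) f = u f" if "f \<in> into C c" using that by (metis restrict_apply')
qed

sublocale internal_poset C U L
proof
  fix c assume c_obj: "c \<in> Obj C"
  show "le c x x" if "x \<in> X c" for x
    using that c_obj by (simp add: le_iff_coord K_refl)
  show "x = y" if "le c x y" "le c y x" for x y
  proof (rule eq_if_coord_eq[OF c_obj le_in_X[OF c_obj that(1)]])
    fix f assume f_into: "f \<in> into C c"
    interpret frame "K (Dom C f)" by (rule K_frame[OF into_dom[OF f_into]])
    show "coord x f = coord y f"
      using coord_mono[OF f_into] that f_into le_in_X[OF c_obj that(1)] by (intro le_antisym) auto
  qed
  show "le c x z" if "le c x y" "le c y z" for x y z
  proof -
    have X_in: "x \<in> X c" "y \<in> X c" "z \<in> X c" using le_in_X[OF c_obj] that by blast+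
    have "coord x f \<sqsubseteq>\<^bsub>K (Dom C f)\<^esub> coord z f" if f_into: "f \<in> into C c" for f
    proof -
      interpret frame "K (Dom C f)" by (rule K_frame[OF into_dom[OF f_into]])
      show ?thesis
        using coord_mono[OF f_into] \<open>le c x y\<close> \<open>le c y z\<close> f_into X_in
        by (auto intro: le_trans[of _ "coord y f"])
    qed
    then show ?thesis using X_in c_obj by (simp add: le_iff_coord)
  qed
qed

abbreviation vals :: "('a \<times> 'u) set \<Rightarrow> 'a \<Rightarrow> 'u set" where
  "vals S f \<equiv> r (Dom C f) ` {x. (f, x) \<in> S}"

lemma vals_closed: "S \<in> Pw c \<Longrightarrow> f \<in> into C c \<Longrightarrow> vals S f \<subseteq> carrier (K (Dom C f))"
  by (auto dest: PwD)

lemma Sup_vals_lax: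
  assumes "S \<in> Pw c"
  shows "(\<lambda>f\<in>into C c. \<Squnion>\<^bsub>K (Dom C f)\<^esub> vals S f) \<in> lax_families c"
  unfolding restrict_lax_families
proof (intro ballI conjI)
  fix f assume f_into: "f \<in> into C c"
  interpret F: frame "K (Dom C f)" by (rule K_frame[OF into_dom[OF f_into]])
  show "\<Squnion>\<^bsub>K (Dom C f)\<^esub> vals S f \<in> carrier (K (Dom C f))" using vals_closed[OF assms f_into] by simp
  fix g assume g_into: "g \<in> into C (Dom C f)"
  interpret frame_homomorphism "K (Dom C f)" "K (Dom C g)" "kr g" by (rule kr_hom[OF g_into])
  have "kr g (\<Squnion>\<^bsub>K (Dom C f)\<^esub> vals S f) = \<Squnion>\<^bsub>K (Dom C g)\<^esub> (kr g ` vals S f)"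
    by (rule hom_Sup[OF vals_closed[OF assms f_into]])
  also have "\<dots> \<sqsubseteq>\<^bsub>K (Dom C g)\<^esub> \<Squnion>\<^bsub>K (Dom C g)\<^esub> vals S (Cmp C f g)"
  proof (rule M.Sup_mono)
    fix k assume "k \<in> kr g ` vals S f"
    then obtain x where x_in: "(f, x) \<in> S" "k = kr g (r (Dom C f) x)" by auto
    show "\<exists>k'\<in>vals S (Cmp C f g). k \<sqsubseteq>\<^bsub>K (Dom C g)\<^esub> k'"
      using PwD[OF assms x_in(1)] g_into f_into kr_r_le[OF g_into, of x] x_in(2)
      by (auto simp: coord_def)
  qed (use vals_closed[OF assms f_into] vals_closed[OF assms into_comp[OF f_into g_into]] f_into
      g_into in auto)
  finally show "kr g (\<Squnion>\<^bsub>K (Dom C f)\<^esub> vals S f) \<sqsubseteq>\<^bsub>K (Dom C g)\<^esub>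
      \<Squnion>\<^bsub>K (Dom C (Cmp C f g))\<^esub> vals S (Cmp C f g)" using f_into g_into by simp
qed

lemma Join_at_if_coord:
  assumes S_Pw: "S \<in> Pw c" and s_in: "s \<in> X c"
    and coord_s: "\<And>f. f \<in> into C c \<Longrightarrow> coord s f = \<Squnion>\<^bsub>K (Dom C f)\<^esub> vals S f"
  shows "Join_at c S s"
  unfolding Join_at_def ub_at_def
proof (intro conjI allI ballI impI)
  fix f x assume fx_in: "(f, x) \<in> S"
  note f_x_in = PwD[OF S_Pw fx_in]
  have "coord x g \<sqsubseteq>\<^bsub>K (Dom C g)\<^esub> coord s (Cmp C f g)" if g_into: "g \<in> into C (Dom C f)" for g
  proof -
    interpret frame "K (Dom C g)" by (rule K_frame[OF into_dom[OF g_into]])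
    have fg_into: "Cmp C f g \<in> into C c" using f_x_in(1) g_into by simp
    have "coord x g \<in> vals S (Cmp C f g)" using f_x_in(1,3) g_into by (auto simp: coord_def)
    then show ?thesis
      using sup_upper[of "vals S (Cmp C f g)" "coord x g"] vals_closed[OF S_Pw fg_into] f_x_in(1)
        g_into coord_s[OF fg_into]
      by simp
  qed
  then show "le (Dom C f) x (res f s)" using f_x_in s_in by (simp add: le_iff_coord)
next
  fix f u assume f_into: "f \<in> into C c" and u_in: "u \<in> X (Dom C f)"
    and upper: "\<forall>g x. (g, x) \<in> pres f S \<longrightarrow> le (Dom C g) x (res g u)"
  have "coord s (Cmp C f g) \<sqsubseteq>\<^bsub>K (Dom C g)\<^esub> coord u g" if g_into: "g \<in> into C (Dom C f)" for g
  proof -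
    interpret frame "K (Dom C g)" by (rule K_frame[OF into_dom[OF g_into]])
    have fg_into: "Cmp C f g \<in> into C c" using f_into g_into by simp
    have "\<Squnion>\<^bsub>K (Dom C g)\<^esub> vals S (Cmp C f g) \<sqsubseteq>\<^bsub>K (Dom C g)\<^esub> coord u g"
    proof (rule sup_least)
      fix k assume "k \<in> vals S (Cmp C f g)"
      then obtain x where "(Cmp C f g, x) \<in> S" "k = r (Dom C g) x" using f_into g_into by auto
      then show "k \<sqsubseteq>\<^bsub>K (Dom C g)\<^esub> coord u g"
        using r_mono[OF into_dom[OF g_into], of x "res g u"] upper g_into
        by (auto simp: mem_pres coord_def)
    qed (use vals_closed[OF S_Pw fg_into] f_into g_into u_in in auto)
    then show ?thesis using coord_s[OF fg_into] f_into g_into by simp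
  qed
  then show "le (Dom C f) (res f s) u" using f_into s_in u_in by (simp add: le_iff_coord)
qed

lemma
  assumes "c \<in> Obj C" "S \<in> Pw c"
  shows realize_Sup_closed: "realize c (\<lambda>f. \<Squnion>\<^bsub>K (Dom C f)\<^esub> vals S f) \<in> X c" (is "?s \<in> _")
    and coord_realize_Sup: "f \<in> into C c \<Longrightarrow>
      coord (realize c (\<lambda>f. \<Squnion>\<^bsub>K (Dom C f)\<^esub> vals S f)) f = \<Squnion>\<^bsub>K (Dom C f)\<^esub> vals S f"
    and Join_at_realize_Sup: "Join_at c S (realize c (\<lambda>f. \<Squnion>\<^bsub>K (Dom C f)\<^esub> vals S f))"
proof -
  show s_in: "?s \<in> X c" by (rule realize_closed[OF assms(1) Sup_vals_lax[OF assms(2)]])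
  show coord_s: "coord ?s f = \<Squnion>\<^bsub>K (Dom C f)\<^esub> vals S f" if "f \<in> into C c" for f
    by (rule coord_realize[OF assms(1) Sup_vals_lax[OF assms(2)] that])
  show "Join_at c S ?s" by (rule Join_at_if_coord[OF assms(2) s_in coord_s])
qed

lemma Join_at_iff_coord:
  assumes "c \<in> Obj C" "S \<in> Pw c" "s \<in> X c"
  shows "Join_at c S s \<longleftrightarrow> (\<forall>f\<in>into C c. coord s f = \<Squnion>\<^bsub>K (Dom C f)\<^esub> vals S f)"
  using Join_at_if_coord[OF assms(2,3)] coord_realize_Sup[OF assms(1,2)]
    Join_at_unique[OF assms realize_Sup_closed[OF assms(1,2)] _ Join_at_realize_Sup[OF assms(1,2)]]
  by auto

lemma bot_at_iff_coord:
  assumes "c \<in> Obj C" "z \<in> X c"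
  shows "bot_at c z \<longleftrightarrow> (\<forall>f\<in>into C c. coord z f = \<bottom>\<^bsub>K (Dom C f)\<^esub>)"
  using complete_lattice.Sup_empty[OF frame.axioms(1)[OF K_frame]]
  by (simp add: bot_at_iff_Join_at Join_at_iff_coord[OF assms(1) empty_Pw assms(2)])

lemma join_at_iff_coord:
  assumes "c \<in> Obj C" "a \<in> X c" "b \<in> X c" "j \<in> X c"
  shows "join_at c a b j \<longleftrightarrow> (\<forall>f\<in>into C c. coord j f = coord a f \<squnion>\<^bsub>K (Dom C f)\<^esub> coord b f)"
proof -
  have ab_sub: "{a, b} \<subseteq> X c" using assms by simp
  have "vals (generated c {a, b}) f = {coord a f, coord b f}" if "f \<in> into C c" for f
    using that by (auto simp: generated_def coord_def)
  then show ?thesis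
    by (simp add: join_at_iff_Join_at[OF assms]
      Join_at_iff_coord[OF assms(1) generated_Pw[OF ab_sub] assms(4)] join_def)
qed

lemma top_at_if_coord:
  assumes "t \<in> X c" and coord_t: "\<And>f. f \<in> into C c \<Longrightarrow> coord t f = \<top>\<^bsub>K (Dom C f)\<^esub>"
  shows "top_at c t"
  unfolding top_at_def
proof (intro ballI)
  fix f x assume f_into: "f \<in> into C c" and x_in: "x \<in> X (Dom C f)"
  have "coord x g \<sqsubseteq>\<^bsub>K (Dom C g)\<^esub> coord t (Cmp C f g)" if g_into: "g \<in> into C (Dom C f)" for g
  proof -
    interpret frame "K (Dom C g)" by (rule K_frame[OF into_dom[OF g_into]])
    show ?thesis using coord_t[OF into_comp[OF f_into g_into]] f_into g_into x_in by simp
  qed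
  then show "le (Dom C f) x (res f t)" using f_into assms(1) x_in by (simp add: le_iff_coord)
qed

lemma meet_at_if_coord:
  assumes "c \<in> Obj C" "a \<in> X c" "b \<in> X c" "m \<in> X c"
    and coord_m: "\<And>f. f \<in> into C c \<Longrightarrow> coord m f = coord a f \<sqinter>\<^bsub>K (Dom C f)\<^esub> coord b f"
  shows "meet_at c a b m"
  unfolding meet_at_def
proof (intro conjI ballI impI)
  have "coord m f \<sqsubseteq>\<^bsub>K (Dom C f)\<^esub> coord a f \<and> coord m f \<sqsubseteq>\<^bsub>K (Dom C f)\<^esub> coord b f"
    if f_into: "f \<in> into C c" for f
  proof -
    interpret frame "K (Dom C f)" by (rule K_frame[OF into_dom[OF f_into]])
    show ?thesis using coord_m[OF f_into] f_into assms by (simp add: meet_left meet_right)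
  qed
  then show "le c m a" "le c m b" using assms by (auto simp: le_iff_coord)
  fix f x assume f_into: "f \<in> into C c" and x_in: "x \<in> X (Dom C f)"
    and below: "le (Dom C f) x (res f a)" "le (Dom C f) x (res f b)"
  have "coord x g \<sqsubseteq>\<^bsub>K (Dom C g)\<^esub> coord m (Cmp C f g)" if g_into: "g \<in> into C (Dom C f)" for g
  proof -
    interpret frame "K (Dom C g)" by (rule K_frame[OF into_dom[OF g_into]])
    show ?thesis
      using coord_mono[OF g_into below(1)] coord_mono[OF g_into below(2)]
        coord_m[OF into_comp[OF f_into g_into]]
        coord_closed[OF into_comp[OF f_into g_into]] f_into g_into x_in assms by (simp add: meet_le)
  qed
  then show "le (Dom C f) x (res f m)" using f_into assms x_in by (simp add: le_iff_coord)
qed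

lemma top_lax: "(\<lambda>f\<in>into C c. \<top>\<^bsub>K (Dom C f)\<^esub>) \<in> lax_families c"
  unfolding restrict_lax_families
proof (intro ballI conjI)
  fix f assume f_into: "f \<in> into C c"
  interpret F: frame "K (Dom C f)" by (rule K_frame[OF into_dom[OF f_into]])
  show "\<top>\<^bsub>K (Dom C f)\<^esub> \<in> carrier (K (Dom C f))" by simp
  fix g assume g_into: "g \<in> into C (Dom C f)"
  interpret frame_homomorphism "K (Dom C f)" "K (Dom C g)" "kr g" by (rule kr_hom[OF g_into])
  show "kr g \<top>\<^bsub>K (Dom C f)\<^esub> \<sqsubseteq>\<^bsub>K (Dom C g)\<^esub> \<top>\<^bsub>K (Dom C (Cmp C f g))\<^esub>"
    using f_into g_into by (simp add: hom_top)
qed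

lemma meet_lax:
  assumes "a \<in> X c" "b \<in> X c"
  shows "(\<lambda>f\<in>into C c. coord a f \<sqinter>\<^bsub>K (Dom C f)\<^esub> coord b f) \<in> lax_families c"
  unfolding restrict_lax_families
proof (intro ballI conjI)
  fix f assume f_into: "f \<in> into C c"
  interpret F: frame "K (Dom C f)" by (rule K_frame[OF into_dom[OF f_into]])
  show "coord a f \<sqinter>\<^bsub>K (Dom C f)\<^esub> coord b f \<in> carrier (K (Dom C f))" using f_into assms by simp
  fix g assume g_into: "g \<in> into C (Dom C f)"
  interpret frame_homomorphism "K (Dom C f)" "K (Dom C g)" "kr g" by (rule kr_hom[OF g_into])
  show "kr g (coord a f \<sqinter>\<^bsub>K (Dom C f)\<^esub> coord b f) \<sqsubseteq>\<^bsub>K (Dom C g)\<^esub>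
      coord a (Cmp C f g) \<sqinter>\<^bsub>K (Dom C (Cmp C f g))\<^esub> coord b (Cmp C f g)"
    using f_into g_into assms coord_lax[OF f_into g_into]
      coord_closed[OF into_comp[OF f_into g_into]]
    by (simp add: hom_meet M.meet_mono)
qed

lemma top_at_iff_coord:
  assumes "c \<in> Obj C" "t \<in> X c"
  shows "top_at c t \<longleftrightarrow> (\<forall>f\<in>into C c. coord t f = \<top>\<^bsub>K (Dom C f)\<^esub>)"
proof -
  let ?t = "realize c (\<lambda>f. \<top>\<^bsub>K (Dom C f)\<^esub>)"
  have t_in: "?t \<in> X c" "\<And>f. f \<in> into C c \<Longrightarrow> coord ?t f = \<top>\<^bsub>K (Dom C f)\<^esub>"
    using realize_closed[OF assms(1) top_lax] coord_realize[OF assms(1) top_lax] by auto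
  show ?thesis
    using top_at_unique[OF assms t_in(1) _ top_at_if_coord[OF t_in]] t_in(2)
      top_at_if_coord[OF assms(2)] by auto
qed

lemma
  assumes "c \<in> Obj C" "a \<in> X c" "b \<in> X c"
  shows meet_at_iff_coord: "m \<in> X c \<Longrightarrow>
      meet_at c a b m \<longleftrightarrow> (\<forall>f\<in>into C c. coord m f = coord a f \<sqinter>\<^bsub>K (Dom C f)\<^esub> coord b f)"
    and meet_at_exists: "\<exists>m\<in>X c. meet_at c a b m"
proof -
  let ?m = "realize c (\<lambda>f. coord a f \<sqinter>\<^bsub>K (Dom C f)\<^esub> coord b f)"
  note lax = meet_lax[OF assms(2,3)]
  have m_in: "?m \<in> X c" "\<And>f. f \<in> into C c \<Longrightarrow> coord ?m f = coord a f \<sqinter>\<^bsub>K (Dom C f)\<^esub> coord b f"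
    using realize_closed[OF assms(1) lax] coord_realize[OF assms(1) lax] by auto
  have meet: "meet_at c a b ?m" by (rule meet_at_if_coord[OF assms m_in])
  then show "\<exists>m\<in>X c. meet_at c a b m" using m_in by blast
  show "meet_at c a b m \<longleftrightarrow> (\<forall>f\<in>into C c. coord m f = coord a f \<sqinter>\<^bsub>K (Dom C f)\<^esub> coord b f)"
    if "m \<in> X c"
    using meet_at_unique[OF assms that m_in(1) _ meet] m_in(2) meet_at_if_coord[OF assms that]
    by auto
qed

lemma r_meet:
  assumes "c \<in> Obj C" "a \<in> X c" "b \<in> X c" "m \<in> X c" "meet_at c a b m"
  shows "r c m = r c a \<sqinter>\<^bsub>K c\<^esub> r c b"
  using meet_at_iff_coord[OF assms(1-4), THEN iffD1, OF assms(5), THEN bspec, of "Idt C c"] assms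
  by (simp add: coord_id)

definition strict :: "'o \<Rightarrow> 'u \<Rightarrow> 'u" where
  "strict c k = realize c (\<lambda>f. kr f k)"

lemma
  assumes c_obj: "c \<in> Obj C" and k_in: "k \<in> carrier (K c)"
  shows strict_closed [simp]: "strict c k \<in> X c"
    and coord_strict: "f \<in> into C c \<Longrightarrow> coord (strict c k) f = kr f k"
    and r_strict: "r c (strict c k) = k"
proof -
  have "(\<lambda>f\<in>into C c. kr f k) \<in> lax_families c"
    using k_in by (simp add: restrict_lax_families kr_comp K_refl)
  then show strict: "strict c k \<in> X c" and coord: "f \<in> into C c \<Longrightarrow> coord (strict c k) f = kr f k"
    for f
    using realize_closed coord_realize c_obj by (auto simp: strict_def)
  show "r c (strict c k) = k" using coord[of "Idt C c"] strict c_obj k_in by (simp add: coord_id)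
qed

lemma strict_mono:
  assumes "c \<in> Obj C" "j \<in> carrier (K c)" "k \<in> carrier (K c)" "j \<sqsubseteq>\<^bsub>K c\<^esub> k"
  shows "le c (strict c j) (strict c k)"
  using assms frame_homomorphism.hom_mono[OF kr_hom] by (simp add: le_iff_coord coord_strict)

lemma strict_r_le: "c \<in> Obj C \<Longrightarrow> x \<in> X c \<Longrightarrow> le c (strict c (r c x)) x"
  using kr_r_le by (simp add: le_iff_coord coord_strict)

lemma kr_join_coord_top:
  assumes f_into: "f \<in> into C c" and b_in: "b \<in> X c" and k_in: "k \<in> carrier (K c)"
    and "r c b \<squnion>\<^bsub>K c\<^esub> k = \<top>\<^bsub>K c\<^esub>"
  shows "coord b f \<squnion>\<^bsub>K (Dom C f)\<^esub> kr f k = \<top>\<^bsub>K (Dom C f)\<^esub>"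
proof -
  interpret frame_homomorphism "K c" "K (Dom C f)" "kr f" by (rule kr_hom[OF f_into])
  have "kr f (r c b) \<squnion>\<^bsub>K (Dom C f)\<^esub> kr f k = \<top>\<^bsub>K (Dom C f)\<^esub>"
    using hom_join[of "r c b" k] assms hom_top into_obj[OF f_into] by simp
  then show ?thesis
    using M.join_top_mono[of "kr f (r c b)" "kr f k" "coord b f" "kr f k"] kr_r_le[OF f_into b_in]
      into_obj[OF f_into] f_into b_in k_in
    by simp
qed

lemma well_inside_at_strict:
  assumes c_obj: "c \<in> Obj C" and k_in: "k \<in> carrier (K c)" and b_in: "b \<in> X c"
    and "well_inside (K c) k (r c b)"
  shows "well_inside_at c (strict c k) b"
proof -
  interpret K: frame "K c" by (rule K_frame[OF c_obj])
  obtain w where w_in: "w \<in> carrier (K c)" "k \<sqinter>\<^bsub>K c\<^esub> w = \<bottom>\<^bsub>K c\<^esub>" "r c b \<squnion>\<^bsub>K c\<^esub> w = \<top>\<^bsub>K c\<^esub>"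
    by (rule K.well_insideE[OF assms(4)])
  have "kr f \<bottom>\<^bsub>K c\<^esub> = \<bottom>\<^bsub>K (Dom C f)\<^esub> \<and> kr f \<top>\<^bsub>K c\<^esub> = \<top>\<^bsub>K (Dom C f)\<^esub> \<and>
      kr f k \<sqinter>\<^bsub>K (Dom C f)\<^esub> kr f w = \<bottom>\<^bsub>K (Dom C f)\<^esub> \<and>
      coord b f \<squnion>\<^bsub>K (Dom C f)\<^esub> kr f w = \<top>\<^bsub>K (Dom C f)\<^esub>" if f_into: "f \<in> into C c" for f
  proof -
    interpret frame_homomorphism "K c" "K (Dom C f)" "kr f" by (rule kr_hom[OF f_into])
    show ?thesis
      using hom_meet[OF k_in w_in(1)] w_in(2) hom_top hom_bottom
        kr_join_coord_top[OF f_into b_in w_in(1,3)] by simp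
  qed
  then show ?thesis
    unfolding well_inside_at_def using c_obj k_in b_in w_in(1)
    by (intro bexI[of _ "strict c w"] bexI[of _ "strict c \<bottom>\<^bsub>K c\<^esub>"] bexI[of _ "strict c \<top>\<^bsub>K c\<^esub>"])
      (simp_all add: bot_at_iff_coord top_at_iff_coord meet_at_iff_coord join_at_iff_coord
          coord_strict)
qed

lemma well_inside_at_coordE:
  assumes "c \<in> Obj C" "x \<in> X c" "b \<in> X c" "well_inside_at c x b"
  obtains w where "w \<in> X c"
    "\<And>f. f \<in> into C c \<Longrightarrow> coord x f \<sqinter>\<^bsub>K (Dom C f)\<^esub> coord w f = \<bottom>\<^bsub>K (Dom C f)\<^esub>"
    "\<And>f. f \<in> into C c \<Longrightarrow> coord b f \<squnion>\<^bsub>K (Dom C f)\<^esub> coord w f = \<top>\<^bsub>K (Dom C f)\<^esub>"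
  using assms unfolding well_inside_at_def
  by (auto simp: bot_at_iff_coord top_at_iff_coord meet_at_iff_coord join_at_iff_coord)

lemma vals_meet_family:
  assumes f_into: "f \<in> into C c" and S_Pw: "S \<in> Pw c" and a_in: "a \<in> X c"
  shows "vals (meet_family c a S) f = (\<lambda>k. coord a f \<sqinter>\<^bsub>K (Dom C f)\<^esub> k) ` vals S f"
proof -
  have r_meet_eq: "r (Dom C f) y = coord a f \<sqinter>\<^bsub>K (Dom C f)\<^esub> r (Dom C f) x"
    if "x \<in> X (Dom C f)" "y \<in> X (Dom C f)" "meet_at (Dom C f) (res f a) x y" for x y
    using r_meet[of "Dom C f" "res f a" x y] that f_into a_in by (simp add: coord_def)
  show ?thesis
  proof (intro equalityI subsetI)
    fix k assume "k \<in> vals (meet_family c a S) f"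
    then show "k \<in> (\<lambda>k. coord a f \<sqinter>\<^bsub>K (Dom C f)\<^esub> k) ` vals S f"
      using r_meet_eq by (auto simp: meet_family_def)
  next
    fix k assume "k \<in> (\<lambda>k. coord a f \<sqinter>\<^bsub>K (Dom C f)\<^esub> k) ` vals S f"
    then obtain x where x_in: "(f, x) \<in> S" "k = coord a f \<sqinter>\<^bsub>K (Dom C f)\<^esub> r (Dom C f) x" by auto
    note x_closed = PwD(2)[OF S_Pw x_in(1)]
    obtain y where "y \<in> X (Dom C f)" "meet_at (Dom C f) (res f a) x y"
      using meet_at_exists[of "Dom C f" "res f a" x] x_closed f_into a_in by auto
    then show "k \<in> vals (meet_family c a S) f"
      using r_meet_eq[OF x_closed] x_in x_closed f_into by (force simp: meet_family_def)
  qed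
qed

lemma Join_at_meet_family:
  assumes "c \<in> Obj C" "S \<in> Pw c" "a \<in> X c" "s \<in> X c" "m \<in> X c" "Join_at c S s" "meet_at c a s m"
  shows "Join_at c (meet_family c a S) m"
proof (rule Join_at_if_coord)
  fix f assume f_into: "f \<in> into C c"
  interpret frame "K (Dom C f)" by (rule K_frame[OF into_dom[OF f_into]])
  have "coord m f = coord a f \<sqinter>\<^bsub>K (Dom C f)\<^esub> \<Squnion>\<^bsub>K (Dom C f)\<^esub> vals S f"
    using assms f_into by (simp add: meet_at_iff_coord Join_at_iff_coord)
  then show "coord m f = \<Squnion>\<^bsub>K (Dom C f)\<^esub> vals (meet_family c a S) f"
    unfolding vals_meet_family[OF f_into assms(2,3)]
    using frame_distrib[OF coord_closed[OF f_into assms(3)] vals_closed[OF assms(2) f_into]] by simp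
qed (use assms in auto)

lemma directed_vals:
  assumes "c \<in> Obj C" "S \<in> Pw c" "directed_at c S"
  shows "directed_in (K c) (vals S (Idt C c))"
  unfolding directed_in_def
proof (intro conjI ballI)
  show "vals S (Idt C c) \<noteq> {}" using assms(3) by (auto simp: directed_at_def)
  fix j k assume "j \<in> vals S (Idt C c)" "k \<in> vals S (Idt C c)"
  then obtain x y where xy_in: "(Idt C c, x) \<in> S" "(Idt C c, y) \<in> S" "j = r c x" "k = r c y"
    using assms(1) by auto
  then obtain z where "(Idt C c, z) \<in> S" "le c x z" "le c y z"
    using assms(1,3) unfolding directed_at_def by (metis id_arr(2))
  then show "\<exists>s\<in>vals S (Idt C c). j \<sqsubseteq>\<^bsub>K c\<^esub> s \<and> k \<sqsubseteq>\<^bsub>K c\<^esub> s"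
    using xy_in assms(1) r_mono by auto
qed

lemma top_mem_if_directed:
  assumes c_obj: "c \<in> Obj C" and S_Pw: "S \<in> Pw c" and t_in: "t \<in> X c" "top_at c t"
    and directed: "directed_at c S" and Join: "Join_at c S t"
  shows "(Idt C c, t) \<in> S"
proof -
  have "\<Squnion>\<^bsub>K c\<^esub> vals S (Idt C c) = \<top>\<^bsub>K c\<^esub>"
    using Join t_in c_obj into_id[OF c_obj]
    by (auto simp: Join_at_iff_coord[OF c_obj S_Pw] top_at_iff_coord dest!: bspec)
  then have "\<top>\<^bsub>K c\<^esub> \<in> vals S (Idt C c)"
    using kreg_frame.compact[OF K_kreg[OF c_obj]] directed_vals[OF c_obj S_Pw directed]
      vals_closed[OF S_Pw into_id[OF c_obj]] c_obj
    by (simp add: compact_frame_def)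
  then obtain x where x_in: "(Idt C c, x) \<in> S" "r c x = \<top>\<^bsub>K c\<^esub>" using c_obj by auto
  have x_closed: "x \<in> X c" using PwD(2)[OF S_Pw x_in(1)] c_obj by simp
  have "x = t"
  proof (rule eq_if_coord_eq[OF c_obj x_closed t_in(1)])
    fix f assume f_into: "f \<in> into C c"
    interpret frame_homomorphism "K c" "K (Dom C f)" "kr f" by (rule kr_hom[OF f_into])
    have "coord x f = \<top>\<^bsub>K (Dom C f)\<^esub>"
      using kr_r_le[OF f_into x_closed] x_in(2) hom_top f_into x_closed by (intro M.top_le) auto
    then show "coord x f = coord t f" using t_in f_into top_at_iff_coord[OF c_obj t_in(1)] by simp
  qed
  then show ?thesis using x_in by simp
qed

lemma r_eq_Sup_well_inside:
  assumes c_obj: "c \<in> Obj C" and b_in: "b \<in> X c"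
  shows "r c b = \<Squnion>\<^bsub>K c\<^esub> (r c ` {x \<in> X c. well_inside_at c x b})"
proof -
  interpret kreg_frame "K c" by (rule K_kreg[OF c_obj])
  show ?thesis
  proof (rule Sup_eqI[symmetric])
    fix k assume "k \<in> r c ` {x \<in> X c. well_inside_at c x b}"
    then obtain x where x_in: "x \<in> X c" "well_inside_at c x b" "k = r c x" by auto
    obtain w where "w \<in> X c" "r c x \<sqinter>\<^bsub>K c\<^esub> r c w = \<bottom>\<^bsub>K c\<^esub>" "r c b \<squnion>\<^bsub>K c\<^esub> r c w = \<top>\<^bsub>K c\<^esub>"
      using well_inside_at_coordE[OF c_obj x_in(1) b_in x_in(2)] c_obj x_in(1) b_in
      by (metis coord_id id_arr(2) into_id)
    then show "k \<sqsubseteq>\<^bsub>K c\<^esub> r c b"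
      using le_if_meet_bottom_join_top[of "r c x" "r c b" "r c w"] x_in c_obj b_in by simp
  next
    fix u assume u_in: "u \<in> carrier (K c)"
      and upper: "\<And>k. k \<in> r c ` {x \<in> X c. well_inside_at c x b} \<Longrightarrow> k \<sqsubseteq>\<^bsub>K c\<^esub> u"
    have "k \<sqsubseteq>\<^bsub>K c\<^esub> u" if k_in: "k \<in> carrier (K c)" "well_inside (K c) k (r c b)" for k
      using upper[OF imageI, of "strict c k"] well_inside_at_strict[OF c_obj k_in(1) b_in k_in(2)]
        c_obj k_in by (simp add: r_strict)
    then have "\<Squnion>\<^bsub>K c\<^esub> {k \<in> carrier (K c). well_inside (K c) k (r c b)} \<sqsubseteq>\<^bsub>K c\<^esub> u"
      using u_in by (intro sup_least) auto
    then show "r c b \<sqsubseteq>\<^bsub>K c\<^esub> u" using regular c_obj b_in by (simp add: regular_frame_def)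
  qed (use c_obj b_in in auto)
qed

sublocale internal_kreg C U L
proof
  fix c assume c_obj: "c \<in> Obj C"
  show "\<exists>s\<in>X c. Join_at c S s" if "S \<in> Pw c" for S
    using realize_Sup_closed[OF c_obj that] Join_at_realize_Sup[OF c_obj that] by blast
  show "Join_at c (meet_family c a S) m"
    if "S \<in> Pw c" "a \<in> X c" "s \<in> X c" "m \<in> X c" "Join_at c S s" "meet_at c a s m" for S a s m
    by (rule Join_at_meet_family[OF c_obj that])
  show "(Idt C c, t) \<in> S"
    if "S \<in> Pw c" "t \<in> X c" "directed_at c S" "top_at c t" "Join_at c S t" for S t
    using top_mem_if_directed[OF c_obj] that by blast
  show "Join_at c (interior_family c b) b" if b_in: "b \<in> X c" for b
  proof (rule Join_at_if_coord[OF interior_family_Pw[OF b_in] b_in])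
    show "coord b f = \<Squnion>\<^bsub>K (Dom C f)\<^esub> vals (interior_family c b) f" if f_into: "f \<in> into C c" for f
      using r_eq_Sup_well_inside[OF into_dom[OF f_into] res_closed[OF f_into b_in]] f_into
      by (simp add: interior_family_def coord_def)
  qed
qed

lemma strict_regs:
  assumes c_obj: "c \<in> Obj C" and k_in: "k \<in> carrier (K c)"
  shows "strict c k \<in> regs (St c)"
proof -
  interpret S: frame "St c" by (rule frame_stage[OF c_obj])
  interpret K: kreg_frame "K c" by (rule K_kreg[OF c_obj])
  let ?i = "reg_interior (St c) (strict c k)" and ?A = "{j \<in> carrier (K c). well_inside (K c) j k}"
  have i_in: "?i \<in> X c" using c_obj by simp
  have "le c (strict c j) ?i" if j_in: "j \<in> ?A" for j
    using S.le_reg_interior[of "strict c j" "strict c k"]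
      well_inside_at_strict[OF c_obj, of j "strict c k"]
      well_inside_at_iff[OF c_obj, of "strict c j" "strict c k"] j_in c_obj k_in
        by (simp add: r_strict)
  then have kr_le: "kr f j \<sqsubseteq>\<^bsub>K (Dom C f)\<^esub> coord ?i f" if "f \<in> into C c" "j \<in> ?A" for f j
    using coord_mono[OF that(1), of "strict c j" ?i] that c_obj by (simp add: coord_strict)
  have "kr f k \<sqsubseteq>\<^bsub>K (Dom C f)\<^esub> coord ?i f" if f_into: "f \<in> into C c" for f
  proof -
    interpret H: frame_homomorphism "K c" "K (Dom C f)" "kr f" by (rule kr_hom[OF f_into])
    have "kr f k = \<Squnion>\<^bsub>K (Dom C f)\<^esub> (kr f ` ?A)"
      using H.hom_Sup[of ?A] K.regular k_in by (simp add: regular_frame_def)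
    also have "\<dots> \<sqsubseteq>\<^bsub>K (Dom C f)\<^esub> coord ?i f" using kr_le[OF f_into] f_into i_in
      by (intro H.M.sup_least) auto
    finally show ?thesis .
  qed
  then have "le c (strict c k) ?i" using i_in c_obj k_in by (simp add: le_iff_coord coord_strict)
  then show ?thesis using c_obj k_in by (intro S.regsI) auto
qed

lemma le_strict_if_well_inside:
  assumes c_obj: "c \<in> Obj C" and v_in: "v \<in> X c" and x_in: "x \<in> X c" and "well_inside (St c) v x"
  shows "le c v (strict c (r c x))"
proof -
  obtain w where w_in: "w \<in> X c"
    and meet: "\<And>f. f \<in> into C c \<Longrightarrow> coord v f \<sqinter>\<^bsub>K (Dom C f)\<^esub> coord w f = \<bottom>\<^bsub>K (Dom C f)\<^esub>"
    and join: "\<And>f. f \<in> into C c \<Longrightarrow> coord x f \<squnion>\<^bsub>K (Dom C f)\<^esub> coord w f = \<top>\<^bsub>K (Dom C f)\<^esub>"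
    using assms well_inside_at_coordE[OF c_obj v_in x_in] well_inside_at_iff[OF c_obj v_in x_in]
    by blast
  have join_id: "r c w \<squnion>\<^bsub>K c\<^esub> r c x = \<top>\<^bsub>K c\<^esub>"
    using join[OF into_id[OF c_obj]] c_obj w_in x_in by (simp add: coord_id join_comm[of "K c"])
  have "coord v f \<sqsubseteq>\<^bsub>K (Dom C f)\<^esub> kr f (r c x)" if f_into: "f \<in> into C c" for f
  proof -
    interpret frame "K (Dom C f)" by (rule K_frame[OF into_dom[OF f_into]])
    have "kr f (r c x) \<squnion>\<^bsub>K (Dom C f)\<^esub> coord w f = \<top>\<^bsub>K (Dom C f)\<^esub>"
      using kr_join_coord_top[OF f_into w_in _ join_id] c_obj x_in
      by (simp add: join_comm[of "K (Dom C f)"])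
    then show ?thesis
      using le_if_meet_bottom_join_top[of "coord v f" "kr f (r c x)" "coord w f"] meet[OF f_into]
        f_into v_in w_in x_in c_obj by simp
  qed
  then show ?thesis using c_obj v_in x_in by (simp add: le_iff_coord coord_strict)
qed

lemma regs_eq_strict:
  assumes c_obj: "c \<in> Obj C" and reg: "x \<in> regs (St c)"
  shows "strict c (r c x) = x"
proof -
  have x_in: "x \<in> X c" using regs_carrier[OF reg] by simp
  have "le c (reg_interior (St c) x) (strict c (r c x))"
    using frame.reg_interior_least[OF frame_stage[OF c_obj], of "strict c (r c x)" x]
      le_strict_if_well_inside[OF c_obj _ x_in] c_obj x_in by simp
  then show ?thesis
    using reg_interior_regs[OF reg] strict_r_le[OF c_obj x_in] le_antisym[OF c_obj] by simp
qed

lemma r_bij: "c \<in> Obj C \<Longrightarrow> bij_betw (r c) (regs (St c)) (carrier (K c))"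
  by (rule bij_betw_byWitness[of _ "strict c"])
    (use regs_carrier[of _ "St c"] in \<open>auto simp: regs_eq_strict r_strict strict_regs\<close>)

lemma r_le_regs:
  assumes "c \<in> Obj C" "x \<in> regs (St c)" "y \<in> regs (St c)"
  shows "r c x \<sqsubseteq>\<^bsub>K c\<^esub> r c y \<longleftrightarrow> le c x y"
  using r_mono[OF assms(1), of x y] strict_mono[OF assms(1), of "r c x" "r c y"] assms
    regs_carrier[OF assms(2)] regs_carrier[OF assms(3)] by (auto simp: regs_eq_strict)

lemma r_res_regs:
  assumes "f \<in> into C c" "x \<in> regs (St c)"
  shows "r (Dom C f) (res f x) = kr f (r c x)"
  using coord_strict[of c "r c x" f] regs_carrier[OF assms(2)] regs_eq_strict[of c x]
    into_obj[OF assms(1)] assms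
  by (simp add: coord_def)

end

context internal_kreg
begin

lemma kreg_presheaf_regs: "kreg_presheaf C (\<lambda>c. reg_part (St c)) res"
proof (intro kreg_presheaf.intro kreg_presheaf_axioms.intro cat_axioms)
  show "frame_homomorphism (reg_part (St c)) (reg_part (St (Dom C f))) (res f)" if "f \<in> into C c"
    for c f
    using frame_homomorphism.frame_homomorphism_reg_part[OF frame_homomorphism_res[OF that]] .
qed (auto simp: kreg_frame_reg_stage dest!: regs_carrier)

lemma res_reg_interior_le:
  assumes g_into: "g \<in> into C c" and x_in: "x \<in> X c"
  shows "le (Dom C g) (res g (reg_interior (St c) x)) (reg_interior (St (Dom C g)) (res g x))"
proof -
  have c_obj: "c \<in> Obj C" by (rule into_obj[OF g_into])
  interpret frame_homomorphism "St c" "St (Dom C g)" "res g"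
    by (rule frame_homomorphism_res[OF g_into])
  have reg: "res g (reg_interior (St c) x) \<in> regs (St (Dom C g))"
    using normal_frame.reg_interior_in_regs[OF normal_frame_stage[OF c_obj]] x_in
    by (intro hom_regs) simp
  then show ?thesis
    using M.reg_interior_mono[of "res g (reg_interior (St c) x)" "res g x"]
      hom_mono[of "reg_interior (St c) x" x] L.reg_interior_le[of x] reg_interior_regs[OF reg] c_obj
      g_into x_in by simp
qed

lemma lax_rep_regs: "lax_rep C U L (\<lambda>c. reg_part (St c)) res (\<lambda>c. reg_interior (St c))"
proof -
  interpret R: kreg_presheaf C "\<lambda>c. reg_part (St c)" res by (rule kreg_presheaf_regs)
  let ?coords = "\<lambda>c x. \<lambda>f\<in>into C c. reg_interior (St (Dom C f)) (res f x)"
  show ?thesis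
  proof
    fix c assume c_obj: "c \<in> Obj C"
    show "le c x y \<longleftrightarrow> (\<forall>f\<in>into C c.
        reg_interior (St (Dom C f)) (res f x) \<sqsubseteq>\<^bsub>reg_part (St (Dom C f))\<^esub>
        reg_interior (St (Dom C f)) (res f y))"
      if "x \<in> X c" "y \<in> X c" for x y
      using le_iff_reg_interior[OF c_obj that] by simp
    show "bij_betw (?coords c) (X c) (R.lax_families c)"
      unfolding bij_betw_def
    proof (intro conjI inj_onI equalityI subsetI)
      fix x y assume x_in: "x \<in> X c" and y_in: "y \<in> X c" and eq: "?coords c x = ?coords c y"
      have "reg_interior (St (Dom C f)) (res f x) = reg_interior (St (Dom C f)) (res f y)"
        if "f \<in> into C c" for f using that fun_cong[OF eq, of f] by simp
      then show "x = y"
        using le_iff_reg_interior[OF c_obj x_in y_in] le_iff_reg_interior[OF c_obj y_in x_in] x_in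
          y_in
        by (intro le_antisym[OF c_obj]) (simp_all add: le_refl)
    next
      fix u assume "u \<in> ?coords c ` X c"
      then obtain x where x_in: "x \<in> X c" "u = ?coords c x" by blast
      then show "u \<in> R.lax_families c"
        using res_reg_interior_le normal_frame.reg_interior_in_regs[OF normal_frame_stage]
        by (auto simp: R.restrict_lax_families)
    next
      fix u assume u_lax: "u \<in> R.lax_families c"
      then obtain x where "x \<in> X c" "\<And>f. f \<in> into C c \<Longrightarrow> reg_interior (St (Dom C f)) (res f x) = u f"
        using lax_family_realized[OF c_obj, of u] by (auto simp: R.lax_families_def PiE_def Pi_def)
      moreover have "u \<in> extensional (into C c)" using u_lax
        by (simp add: R.lax_families_def PiE_def)
      ultimately show "u \<in> ?coords c ` X c"
        by (intro image_eqI[of _ _ x]) (auto simp: extensional_def restrict_def)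
    qed
  qed
qed

end

section \<open>Internal homomorphisms\<close>

lemma presheaf_topos_eq:
  "presheaf_topos U C = functor_category (op_cat C) (concrete_cat U (\<lambda>A. A) (\<lambda>A B f. True))"
  by (simp add: presheaf_topos_def set_cat_eq)

definition image_family ::
  "('o, 'a) category \<Rightarrow> ('o \<Rightarrow> 'u \<Rightarrow> 'u) \<Rightarrow> ('a \<times> 'u) set \<Rightarrow> ('a \<times> 'u) set" where
  "image_family C a S = (\<lambda>(f, x). (f, a (Dom C f) x)) ` S"

lemma mem_image_family:
  "(f, y) \<in> image_family C a S \<longleftrightarrow> (\<exists>x. (f, x) \<in> S \<and> y = a (Dom C f) x)"
  by (force simp: image_family_def)

lemma image_family_id [simp]: "image_family C (\<lambda>c x. x) S = S"
  by (simp add: image_family_def)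

lemma image_family_comp:
  "image_family C (\<lambda>c x. b c (a c x)) S = image_family C b (image_family C a S)"
  by (simp add: image_family_def image_image case_prod_unfold)

abbreviation psh_arr :: "('o, 'a) category \<Rightarrow> ('o, 'a, 'u) psh_rel \<Rightarrow> ('o \<Rightarrow> 'u \<Rightarrow> 'u) \<Rightarrow>
    ('o, 'a, 'u) psh_rel \<Rightarrow> ('o, 'a, 'u) presheaf_arr" where
  "psh_arr C L a M \<equiv> mk_nat C (\<lambda>A. A) (fst L) a (fst M)"

locale psh_morphism = L: psh_relation C U L + M: psh_relation C U M
  for C :: "('o, 'a) category" and U :: "'u set set" and L M +
  fixes a :: "'o \<Rightarrow> 'u \<Rightarrow> 'u"
  assumes closed [simp]: "c \<in> Obj C \<Longrightarrow> x \<in> L.X c \<Longrightarrow> a c x \<in> M.X c"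
    and natural: "f \<in> into C c \<Longrightarrow> x \<in> L.X c \<Longrightarrow> a (Dom C f) (L.res f x) = M.res f (a c x)"

locale internal_hom = psh_morphism +
  assumes pres_top: "c \<in> Obj C \<Longrightarrow> t \<in> L.X c \<Longrightarrow> L.top_at c t \<Longrightarrow> M.top_at c (a c t)"
    and pres_meet: "c \<in> Obj C \<Longrightarrow> x \<in> L.X c \<Longrightarrow> y \<in> L.X c \<Longrightarrow> m \<in> L.X c \<Longrightarrow>
      L.meet_at c x y m \<Longrightarrow> M.meet_at c (a c x) (a c y) (a c m)"
    and pres_Join: "c \<in> Obj C \<Longrightarrow> S \<in> L.Pw c \<Longrightarrow> s \<in> L.X c \<Longrightarrow> L.Join_at c S s \<Longrightarrow>
      M.Join_at c (image_family C a S) (a c s)"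

context psh_morphism
begin

lemma image_family_Pw [simp]:
  assumes "S \<in> L.Pw c"
  shows "image_family C a S \<in> M.Pw c"
proof (rule M.PwI)
  fix f y assume "(f, y) \<in> image_family C a S"
  then obtain x where x_in: "(f, x) \<in> S" "y = a (Dom C f) x" by (auto simp: mem_image_family)
  note f_x_in = L.PwD[OF assms x_in(1)]
  show "f \<in> into C c \<and> y \<in> M.X (Dom C f)" using f_x_in x_in(2) by auto
  show "(Cmp C f g, M.res g y) \<in> image_family C a S" if "g \<in> into C (Dom C f)" for g
    using f_x_in(1,2) f_x_in(3)[OF that] that x_in(2)
    by (auto simp: mem_image_family natural[symmetric])
qed

lemma psh_arr_Hom: "psh_arr C L a M \<in> Hom (presheaf_topos U C) (fst L) (fst M)"
proof -
  interpret concrete_presheaf_pair C U "\<lambda>A. A" "\<lambda>A B f. True" "fst L" "fst M" ..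
  show ?thesis
    unfolding presheaf_topos_eq
    by (rule mk_nat_Hom) (simp_all add: natural psh_restrict_eq[symmetric])
qed

lemma psh_map_psh_arr [simp]: "c \<in> Obj C \<Longrightarrow> x \<in> L.X c \<Longrightarrow> psh_map (psh_arr C L a M) c x = a c x"
  by (simp add: psh_map_eq)

lemma internal_frame_hom_iff: "internal_frame_hom C L M (psh_arr C L a M) \<longleftrightarrow> internal_hom C U L M a"
proof -
  let ?preserved = "\<lambda>c (\<rho> :: nat \<Rightarrow> 'u) (\<sigma> :: nat \<Rightarrow> ('a \<times> 'u) set).
    (L.top_at c (\<rho> 0) \<longrightarrow> M.top_at c (a c (\<rho> 0))) \<and>
    (L.meet_at c (\<rho> 0) (\<rho> 1) (\<rho> 2) \<longrightarrow> M.meet_at c (a c (\<rho> 0)) (a c (\<rho> 1)) (a c (\<rho> 2))) \<and>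
    (L.Join_at c (\<sigma> 0) (\<rho> 0) \<longrightarrow> M.Join_at c (image_family C a (\<sigma> 0)) (a c (\<rho> 0)))"
  have image_eq: "(\<lambda>(f, x). (f, psh_map (psh_arr C L a M) (Dom C f) x)) ` S = image_family C a S"
    if "S \<in> L.Pw c" for S c
    unfolding image_family_def
    using L.PwD(2)[OF that] L.into_dom[OF L.PwD(1)[OF that]] by (intro image_cong) auto
  have "internal_frame_hom C L M (psh_arr C L a M) \<longleftrightarrow> (\<forall>c\<in>Obj C. \<forall>\<rho> \<sigma>.
      (\<forall>n. \<rho> n \<in> L.X c) \<longrightarrow> (\<forall>n. \<sigma> n \<in> L.Pw c) \<longrightarrow> ?preserved c \<rho> \<sigma>)"
    unfolding internal_frame_hom_def Let_def
  proof (intro ball_cong all_cong1 imp_cong HOL.refl, goal_cases)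
    case (1 c \<rho> \<sigma>)
    then show ?case
      by (simp add: L.forces_top M.forces_top L.forces_meet M.forces_meet L.forces_Join
        M.forces_Join
          image_eq[of _ c] del: One_nat_def)
  qed
  also have "\<dots> \<longleftrightarrow> internal_hom C U L M a"
  proof
    assume preserved: "\<forall>c\<in>Obj C. \<forall>\<rho> \<sigma>. (\<forall>n. \<rho> n \<in> L.X c) \<longrightarrow> (\<forall>n. \<sigma> n \<in> L.Pw c) \<longrightarrow>
      ?preserved c \<rho> \<sigma>"
    show "internal_hom C U L M a"
    proof
      fix c assume c_obj: "c \<in> Obj C"
      note preserved_at = preserved[rule_format, OF c_obj]
      show "M.top_at c (a c t)" if "t \<in> L.X c" "L.top_at c t" for t
        using preserved_at[of "\<lambda>_. t" "\<lambda>_. {}"] that by simp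
      show "M.meet_at c (a c x) (a c y) (a c m)"
        if "x \<in> L.X c" "y \<in> L.X c" "m \<in> L.X c" "L.meet_at c x y m" for x y m
        using preserved_at[of "(\<lambda>_. m)(0 := x, 1 := y)" "\<lambda>_. {}"] that by (simp del: One_nat_def)
      show "M.Join_at c (image_family C a S) (a c s)"
        if "S \<in> L.Pw c" "s \<in> L.X c" "L.Join_at c S s" for S s
        using preserved_at[of "\<lambda>_. s" "\<lambda>_. S"] that by simp
    qed
  next
    assume "internal_hom C U L M a"
    then interpret internal_hom C U L M a .
    show "\<forall>c\<in>Obj C. \<forall>\<rho> \<sigma>. (\<forall>n. \<rho> n \<in> L.X c) \<longrightarrow> (\<forall>n. \<sigma> n \<in> L.Pw c) \<longrightarrow> ?preserved c \<rho> \<sigma>"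
      using pres_top pres_meet pres_Join by simp
  qed
  finally show ?thesis .
qed

end

lemma Hom_presheaf_topos_iff:
  assumes "psh_relation C U L" "psh_relation C U M"
  shows "\<alpha> \<in> Hom (presheaf_topos U C) (fst L) (fst M) \<longleftrightarrow>
    (\<exists>a. psh_morphism C U L M a \<and> \<alpha> = psh_arr C L a M)"
proof
  interpret L: psh_relation C U L by fact
  interpret M: psh_relation C U M by fact
  interpret concrete_presheaf_pair C U "\<lambda>A. A" "\<lambda>A B f. True" "fst L" "fst M" ..
  assume "\<alpha> \<in> Hom (presheaf_topos U C) (fst L) (fst M)"
  note \<alpha>_hom = this[unfolded presheaf_topos_eq]
  have "psh_morphism C U L M (component \<alpha>)"
    using component_funcset[OF \<alpha>_hom] component_natural[OF \<alpha>_hom]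
    by unfold_locales (auto simp: psh_restrict_eq)
  then show "\<exists>a. psh_morphism C U L M a \<and> \<alpha> = psh_arr C L a M"
    using mk_nat_component[OF \<alpha>_hom] by metis
qed (auto intro: psh_morphism.psh_arr_Hom)

locale internal_kreg_hom = L: internal_kreg C U L + M: internal_kreg C U M + internal_hom C U L M a
  for C :: "('o, 'a) category" and U :: "'u set set" and L M and a :: "'o \<Rightarrow> 'u \<Rightarrow> 'u"
begin

lemma image_family_generated:
  assumes "A \<subseteq> L.X c"
  shows "image_family C a (L.generated c A) = M.generated c (a c ` A)"
proof -
  have "(f, y) \<in> image_family C a (L.generated c A) \<longleftrightarrow> (f, y) \<in> M.generated c (a c ` A)" for f y
    using assms natural by (auto simp: mem_image_family L.mem_generated M.mem_generated subset_iff)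
  then show ?thesis by auto
qed

lemma frame_homomorphism_stage:
  assumes c_obj: "c \<in> Obj C"
  shows "frame_homomorphism (L.St c) (M.St c) (a c)"
proof (intro frame_homomorphism.intro frame_homomorphism_axioms.intro L.frame_stage M.frame_stage
    c_obj)
  show "a c x \<in> carrier (M.St c)" if "x \<in> carrier (L.St c)" for x using that c_obj by simp
  have "a c \<top>\<^bsub>L.St c\<^esub> = \<top>\<^bsub>M.St c\<^esub>"
    using pres_top[OF c_obj, of "\<top>\<^bsub>L.St c\<^esub>"] c_obj by (simp add: L.top_at_iff M.top_at_iff)
  moreover have "a c (x \<sqinter>\<^bsub>L.St c\<^esub> y) = a c x \<sqinter>\<^bsub>M.St c\<^esub> a c y" if "x \<in> L.X c" "y \<in> L.X c" for x y
    using pres_meet[OF c_obj that, of "x \<sqinter>\<^bsub>L.St c\<^esub> y"] that c_obj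
    by (simp add: L.meet_at_iff M.meet_at_iff)
  moreover have "a c (\<Squnion>\<^bsub>L.St c\<^esub> A) = \<Squnion>\<^bsub>M.St c\<^esub> (a c ` A)" if A_sub: "A \<subseteq> L.X c" for A
  proof -
    have "a c ` A \<subseteq> M.X c" using A_sub c_obj by auto
    then show ?thesis
      using pres_Join[OF c_obj L.generated_Pw[OF A_sub], of "\<Squnion>\<^bsub>L.St c\<^esub> A"] A_sub c_obj
      by (simp add: L.Join_generated_iff M.Join_generated_iff image_family_generated)
  qed
  ultimately show "frame_hom (L.St c) (M.St c) (a c)" by (simp add: frame_hom_def)
qed

lemma internal_kreg_hom_comp:
  assumes "internal_kreg_hom C U M N b"
  shows "internal_kreg_hom C U L N (\<lambda>c x. b c (a c x))"
proof -
  interpret b: internal_kreg_hom C U M N b by fact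
  show ?thesis
  proof
    show "b (Dom C f) (a (Dom C f) (L.res f x)) = b.M.res f (b c (a c x))"
      if "f \<in> into C c" "x \<in> L.X c" for f c x
      using that L.into_obj[OF that(1)] by (simp add: natural b.natural)
    show "b.M.Join_at c (image_family C (\<lambda>c x. b c (a c x)) S) (b c (a c s))"
      if "c \<in> Obj C" "S \<in> L.Pw c" "s \<in> L.X c" "L.Join_at c S s" for c S s
      unfolding image_family_comp using that by (intro b.pres_Join pres_Join) auto
  qed (simp_all add: pres_top b.pres_top pres_meet b.pres_meet)
qed

end

lemma (in internal_kreg) internal_kreg_hom_id: "internal_kreg_hom C U L L (\<lambda>c x. x)"
  by unfold_locales simp_all

lemma internal_kreg_hom_eq_if_eq_on_regs:
  assumes "internal_kreg_hom C U L M a" "internal_kreg_hom C U L M b"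
    and eq: "\<And>c x. c \<in> Obj C \<Longrightarrow> x \<in> regs (stage L c) \<Longrightarrow> a c x = b c x"
    and c_obj: "c \<in> Obj C" and x_in: "x \<in> FObj (fst L) c"
  shows "a c x = b c x"
proof -
  interpret a: internal_kreg_hom C U L M a by fact
  interpret b: internal_kreg_hom C U L M b by fact
  note below_Pw = a.L.regs_below_Pw[OF x_in] and Join = a.L.Join_regs_below[OF c_obj x_in]
  have "image_family C a (a.L.regs_below c x) = image_family C b (a.L.regs_below c x)"
    unfolding image_family_def by (intro image_cong) (auto simp: a.L.regs_below_def eq)
  then show ?thesis
    using a.M.Join_at_unique[OF c_obj a.image_family_Pw[OF below_Pw] a.closed[OF c_obj x_in]
      b.closed[OF c_obj x_in]]
      a.pres_Join[OF c_obj below_Pw x_in Join] b.pres_Join[OF c_obj below_Pw x_in Join] by simp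
qed

locale lax_rep_morphism = L: lax_rep C U L K kr r + M: lax_rep C U M K' kr' r'
  for C :: "('o, 'a) category" and U :: "'u set set" and L K kr r M K' kr' r' +
  fixes b :: "'o \<Rightarrow> 'u \<Rightarrow> 'u"
  assumes b_hom: "c \<in> Obj C \<Longrightarrow> frame_homomorphism (K c) (K' c) (b c)"
    and b_natural: "f \<in> into C c \<Longrightarrow> k \<in> carrier (K c) \<Longrightarrow> b (Dom C f) (kr f k) = kr' f (b c k)"
begin

definition extension :: "'o \<Rightarrow> 'u \<Rightarrow> 'u" where
  "extension c x = M.realize c (\<lambda>f. b (Dom C f) (L.coord x f))"

lemma b_closed [simp]: "c \<in> Obj C \<Longrightarrow> k \<in> carrier (K c) \<Longrightarrow> b c k \<in> carrier (K' c)"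
  using frame_homomorphism.hom_closed[OF b_hom] .

lemma extension_lax:
  assumes "x \<in> L.X c"
  shows "(\<lambda>f\<in>into C c. b (Dom C f) (L.coord x f)) \<in> M.lax_families c"
  unfolding M.restrict_lax_families
proof (intro ballI conjI)
  fix f assume f_into: "f \<in> into C c"
  then show "b (Dom C f) (L.coord x f) \<in> carrier (K' (Dom C f))" using assms by simp
  fix g assume g_into: "g \<in> into C (Dom C f)"
  interpret frame_homomorphism "K (Dom C g)" "K' (Dom C g)" "b (Dom C g)"
    by (rule b_hom[OF L.into_dom[OF g_into]])
  show "kr' g (b (Dom C f) (L.coord x f)) \<sqsubseteq>\<^bsub>K' (Dom C g)\<^esub>
      b (Dom C (Cmp C f g)) (L.coord x (Cmp C f g))"
    using b_natural[OF g_into L.coord_closed[OF f_into assms]] f_into g_into assms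
      hom_mono[OF L.kr_closed[OF g_into L.coord_closed[OF f_into assms]] _
        L.coord_lax[OF f_into g_into assms]]
      L.coord_closed[OF L.into_comp[OF f_into g_into] assms] by simp
qed

lemma
  assumes "c \<in> Obj C" "x \<in> L.X c"
  shows extension_closed [simp]: "extension c x \<in> M.X c"
    and coord_extension: "f \<in> into C c \<Longrightarrow> M.coord (extension c x) f = b (Dom C f) (L.coord x f)"
  unfolding extension_def
  using M.realize_closed[OF assms(1) extension_lax[OF assms(2)]]
    M.coord_realize[OF assms(1) extension_lax[OF assms(2)]] by auto

lemma extension_natural:
  assumes f_into: "f \<in> into C c" and x_in: "x \<in> L.X c"
  shows "extension (Dom C f) (L.res f x) = M.res f (extension c x)"
  by (rule M.eq_if_coord_eq[of "Dom C f"])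
    (use f_into x_in L.into_obj[OF f_into] in \<open>simp_all add: coord_extension\<close>)

lemma r_extension: "c \<in> Obj C \<Longrightarrow> x \<in> L.X c \<Longrightarrow> r' c (extension c x) = b c (r c x)"
  using coord_extension[of c x "Idt C c"] by (simp add: L.coord_id M.coord_id)

lemma vals_image_extension:
  assumes "f \<in> into C c" "S \<in> L.Pw c"
  shows "M.vals (image_family C extension S) f = b (Dom C f) ` L.vals S f"
proof -
  have "{y. (f, y) \<in> image_family C extension S} = extension (Dom C f) ` {x. (f, x) \<in> S}"
    by (auto simp: mem_image_family)
  then show ?thesis
    using assms L.PwD(2)[OF assms(2)] by (auto simp: image_image r_extension intro!: image_cong)
qed

lemma internal_kreg_hom_extension: "internal_kreg_hom C U L M extension"
proof
  interpret psh_morphism C U L M extension by unfold_locales (simp_all add: extension_natural)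
  fix c assume c_obj: "c \<in> Obj C"
  have hom: "frame_homomorphism (K (Dom C f)) (K' (Dom C f)) (b (Dom C f))" if "f \<in> into C c" for f
    using that by (rule b_hom[OF L.into_dom])
  note hom_top = frame_homomorphism.hom_top[OF hom]
    and hom_meet = frame_homomorphism.hom_meet[OF hom]
    and hom_Sup = frame_homomorphism.hom_Sup[OF hom]
  show "M.top_at c (extension c t)" if "t \<in> L.X c" "L.top_at c t" for t
    using that c_obj hom_top by (simp add: L.top_at_iff_coord M.top_at_iff_coord coord_extension)
  show "M.meet_at c (extension c x) (extension c y) (extension c m)"
    if "x \<in> L.X c" "y \<in> L.X c" "m \<in> L.X c" "L.meet_at c x y m" for x y m
    using that c_obj hom_meet by (simp add: L.meet_at_iff_coord M.meet_at_iff_coord coord_extension)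
  show "M.Join_at c (image_family C extension S) (extension c s)"
    if "S \<in> L.Pw c" "s \<in> L.X c" "L.Join_at c S s" for S s
    using that c_obj hom_Sup L.vals_closed[OF that(1)]
    by (simp add: L.Join_at_iff_coord M.Join_at_iff_coord coord_extension vals_image_extension)
qed (simp_all add: extension_natural)

lemma extension_strict:
  assumes "c \<in> Obj C" "k \<in> carrier (K c)"
  shows "extension c (L.strict c k) = M.strict c (b c k)"
  by (rule M.eq_if_coord_eq[OF assms(1)])
    (use assms in \<open>simp_all add: coord_extension L.coord_strict M.coord_strict b_natural\<close>)

end

lemma internal_kreg_hom_extends_from_regs:
  assumes "internal_kreg C U L" "internal_kreg C U M"
    and hom: "\<And>c. c \<in> Obj C \<Longrightarrow>
      frame_homomorphism (reg_part (stage L c)) (reg_part (stage M c)) (b c)"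
    and natural: "\<And>c f x. f \<in> into C c \<Longrightarrow> x \<in> regs (stage L c) \<Longrightarrow>
      b (Dom C f) (psh_restrict (fst L) f x) = psh_restrict (fst M) f (b c x)"
  obtains a where "internal_kreg_hom C U L M a"
    "\<And>c x. c \<in> Obj C \<Longrightarrow> x \<in> regs (stage L c) \<Longrightarrow> a c x = b c x"
proof -
  interpret L: internal_kreg C U L by fact
  interpret M: internal_kreg C U M by fact
  interpret lax_rep_morphism C U L "\<lambda>c. reg_part (stage L c)" "psh_restrict (fst L)"
    "\<lambda>c. reg_interior (stage L c)" M "\<lambda>c. reg_part (stage M c)" "psh_restrict (fst M)"
    "\<lambda>c. reg_interior (stage M c)" b
    by (intro lax_rep_morphism.intro lax_rep_morphism_axioms.intro L.lax_rep_regs M.lax_rep_regs hom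
      natural)
      simp_all
  have "extension c x = b c x" if c_obj: "c \<in> Obj C" and x_reg: "x \<in> regs (stage L c)" for c x
  proof -
    have bx_reg: "b c x \<in> regs (stage M c)" using b_closed[OF c_obj] x_reg by simp
    show ?thesis
      using extension_strict[OF c_obj, of x] L.regs_eq_strict[OF c_obj x_reg]
        M.regs_eq_strict[OF c_obj bx_reg] x_reg
      by (simp add: reg_interior_regs[OF x_reg] reg_interior_regs[OF bx_reg])
  qed
  then show ?thesis using that internal_kreg_hom_extension by blast
qed

definition kreg_arr :: "('o, 'a) category \<Rightarrow> ('o, 'a, 'u) psh_rel \<Rightarrow> ('o \<Rightarrow> 'u \<Rightarrow> 'u) \<Rightarrow>
    ('o, 'a, 'u) psh_rel \<Rightarrow>
    ('o, 'a, 'u) psh_rel \<times> ('o, 'a, 'u) presheaf_arr \<times> ('o, 'a, 'u) psh_rel" where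
  "kreg_arr C L a M = (L, psh_arr C L a M, M)"

lemma kreg_arr_cong:
  assumes "\<And>c x. c \<in> Obj C \<Longrightarrow> x \<in> FObj (fst L) c \<Longrightarrow> a c x = b c x"
  shows "kreg_arr C L a M = kreg_arr C L b M"
proof -
  have "psh_arr C L a M = psh_arr C L b M" by (rule mk_nat_cong) (rule assms)
  then show ?thesis by (simp add: kreg_arr_def)
qed

lemma Obj_internal_kreg_frm:
  "is_category C \<Longrightarrow> L \<in> Obj (internal_kreg_frm U C) \<longleftrightarrow> internal_kreg C U L"
  by (simp add: internal_kreg_frm_def internal_kreg_frame_iff)

lemma internal_kreg_frm_simps [simp]:
  "Dom (internal_kreg_frm U C) (kreg_arr C L a M) = L"
  "Cod (internal_kreg_frm U C) (kreg_arr C L a M) = M"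
  "Idt (internal_kreg_frm U C) L = kreg_arr C L (\<lambda>c x. x) L"
  by (simp_all add: internal_kreg_frm_def kreg_arr_def presheaf_topos_eq mk_nat_def)

lemma Cmp_internal_kreg_frm:
  assumes "internal_kreg_hom C U L M a"
  shows "Cmp (internal_kreg_frm U C) (kreg_arr C M b N) (kreg_arr C L a M) =
    kreg_arr C L (\<lambda>c x. b c (a c x)) N"
proof -
  interpret internal_kreg_hom C U L M a by fact
  show ?thesis by (simp add: internal_kreg_frm_def kreg_arr_def presheaf_topos_eq mk_nat_comp)
qed

lemma Arr_internal_kreg_frm:
  assumes "is_category C"
  shows "t \<in> Arr (internal_kreg_frm U C) \<longleftrightarrow>
    (\<exists>L a M. internal_kreg_hom C U L M a \<and> t = kreg_arr C L a M)"
proof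
  assume "t \<in> Arr (internal_kreg_frm U C)"
  then obtain L \<alpha> M where t_eq: "t = (L, \<alpha>, M)"
    and kreg: "internal_kreg C U L" "internal_kreg C U M"
    and \<alpha>_hom: "\<alpha> \<in> Hom (presheaf_topos U C) (fst L) (fst M)" "internal_frame_hom C L M \<alpha>"
    by (auto simp: internal_kreg_frm_def internal_kreg_frame_iff[OF assms])
  interpret L: internal_kreg C U L by fact
  interpret M: internal_kreg C U M by fact
  obtain a where a_morphism: "psh_morphism C U L M a" "\<alpha> = psh_arr C L a M"
    using \<alpha>_hom(1) Hom_presheaf_topos_iff[OF L.psh_relation_axioms M.psh_relation_axioms] by blast
  then have "internal_kreg_hom C U L M a"
    using psh_morphism.internal_frame_hom_iff[OF a_morphism(1)] \<alpha>_hom(2) kreg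
    by (simp add: internal_kreg_hom_def)
  then show "\<exists>L a M. internal_kreg_hom C U L M a \<and> t = kreg_arr C L a M"
    using t_eq a_morphism(2) unfolding kreg_arr_def by blast
next
  assume "\<exists>L a M. internal_kreg_hom C U L M a \<and> t = kreg_arr C L a M"
  then obtain L a M where hom: "internal_kreg_hom C U L M a" and t_eq: "t = kreg_arr C L a M"
    by blast
  interpret internal_kreg_hom C U L M a by (rule hom)
  show "t \<in> Arr (internal_kreg_frm U C)"
    using L.internal_kreg_axioms M.internal_kreg_axioms psh_arr_Hom internal_frame_hom_iff
      internal_hom_axioms
    by (simp add: t_eq kreg_arr_def internal_kreg_frm_def internal_kreg_frame_iff[OF assms])
qed

lemma Hom_internal_kreg_frm:
  assumes "is_category C"
  shows "t \<in> Hom (internal_kreg_frm U C) L M \<longleftrightarrow>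
    (\<exists>a. internal_kreg_hom C U L M a \<and> t = kreg_arr C L a M)"
  unfolding Hom_def[of "internal_kreg_frm U C"] mem_Collect_eq Arr_internal_kreg_frm[OF assms]
  by (metis internal_kreg_frm_simps(1,2))

lemma is_category_internal_kreg_frm:
  assumes C_cat: "is_category C"
  shows "is_category (internal_kreg_frm U C)" (is "is_category ?I")
proof (rule is_categoryI)
  note Arr = Arr_internal_kreg_frm[OF C_cat] and Hom = Hom_internal_kreg_frm[OF C_cat]
    and Obj = Obj_internal_kreg_frm[OF C_cat] and comp = internal_kreg_hom.internal_kreg_hom_comp
  fix s assume "s \<in> Arr ?I"
  then obtain L a M where s_hom: "internal_kreg_hom C U L M a" "s = kreg_arr C L a M"
    by (metis Arr)
  interpret a: internal_kreg_hom C U L M a by (rule s_hom(1))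
  show "Dom ?I s \<in> Obj ?I \<and> Cod ?I s \<in> Obj ?I"
    using a.L.internal_kreg_axioms a.M.internal_kreg_axioms by (simp add: s_hom(2) Obj)
  show "Cmp ?I s (Idt ?I (Dom ?I s)) = s \<and> Cmp ?I (Idt ?I (Cod ?I s)) s = s"
    by (simp only: s_hom(2) internal_kreg_frm_simps Cmp_internal_kreg_frm[OF s_hom(1)]
        Cmp_internal_kreg_frm[OF a.L.internal_kreg_hom_id])
  fix t assume "t \<in> Arr ?I" "Cod ?I s = Dom ?I t"
  then have "t \<in> Hom ?I M (Cod ?I t)" by (simp add: s_hom(2) Hom_def)
  then obtain b N where t_hom: "internal_kreg_hom C U M N b" "t = kreg_arr C M b N"
    unfolding Hom by blast
  show "Cmp ?I t s \<in> Hom ?I (Dom ?I s) (Cod ?I t)"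
    unfolding s_hom(2) t_hom(2) internal_kreg_frm_simps Cmp_internal_kreg_frm[OF s_hom(1)] Hom
    using comp[OF s_hom(1) t_hom(1)] by blast
  fix u assume "u \<in> Arr ?I" "Cod ?I t = Dom ?I u"
  then have "u \<in> Hom ?I N (Cod ?I u)" by (simp add: t_hom(2) Hom_def)
  then obtain d P where u_hom: "internal_kreg_hom C U N P d" "u = kreg_arr C N d P"
    unfolding Hom by blast
  show "Cmp ?I u (Cmp ?I t s) = Cmp ?I (Cmp ?I u t) s"
    by (simp only: s_hom(2) t_hom(2) u_hom(2) Cmp_internal_kreg_frm[OF s_hom(1)]
      Cmp_internal_kreg_frm[OF t_hom(1)]
        Cmp_internal_kreg_frm[OF comp[OF s_hom(1) t_hom(1)]])
next
  show "Idt ?I L \<in> Hom ?I L L" if "L \<in> Obj ?I" for L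
    using internal_kreg.internal_kreg_hom_id[of C U L] that
    by (auto simp: Obj_internal_kreg_frm[OF C_cat] Hom_internal_kreg_frm[OF C_cat])
qed

section \<open>The functor of regular elements\<close>

abbreviation kreg_presheaves :: "'u set set \<Rightarrow> ('o, 'a) category \<Rightarrow> _" where
  "kreg_presheaves U C \<equiv> functor_category (op_cat C) (kreg_frm U)"

definition reg_psh :: "('o, 'a) category \<Rightarrow> ('o, 'a, 'u) psh_rel \<Rightarrow>
    ('o, 'a, 'u gorder, 'u gorder \<times> ('u \<Rightarrow> 'u) \<times> 'u gorder) fctr" where
  "reg_psh C L = mk_presheaf C carrier (\<lambda>c. reg_part (stage L c)) (psh_restrict (fst L))"

abbreviation reg_nat :: "('o, 'a) category \<Rightarrow> ('o, 'a, 'u) psh_rel \<Rightarrow> ('o \<Rightarrow> 'u \<Rightarrow> 'u) \<Rightarrow>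
    ('o, 'a, 'u) psh_rel \<Rightarrow> _" where
  "reg_nat C L a M \<equiv> mk_nat C carrier (reg_psh C L) a (reg_psh C M)"

definition reg_fctr where
  "reg_fctr C = \<lparr>FObj = reg_psh C, FArr = (\<lambda>(L, \<alpha>, M). reg_nat C L (psh_map \<alpha>) M)\<rparr>"

lemma reg_psh_simps [simp]:
  "c \<in> Obj C \<Longrightarrow> FObj (reg_psh C L) c = reg_part (stage L c)"
  "f \<in> into C c \<Longrightarrow> x \<in> regs (stage L c) \<Longrightarrow>
    underlying (FArr (reg_psh C L) f) x = psh_restrict (fst L) f x"
  by (simp_all add: reg_psh_def)

lemma reg_fctr_simps [simp]:
  "FObj (reg_fctr C) L = reg_psh C L"
  "FArr (reg_fctr C) (kreg_arr C L a M) = reg_nat C L a M"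
proof -
  have "reg_nat C L (psh_map (psh_arr C L a M)) M = reg_nat C L a M"
    by (rule mk_nat_cong) (auto simp: psh_map_eq dest: regs_carrier)
  then show "FArr (reg_fctr C) (kreg_arr C L a M) = reg_nat C L a M"
    by (simp add: reg_fctr_def kreg_arr_def)
qed (simp add: reg_fctr_def)

lemma (in internal_kreg) reg_psh_Obj:
  assumes "set_universe U"
  shows "reg_psh C L \<in> Obj (kreg_presheaves U C)"
  unfolding reg_psh_def kreg_frm_eq
proof (rule mk_presheaf_Obj[OF is_category])
  show "reg_part (St c) \<in> kreg_frames U" if c_obj: "c \<in> Obj C" for c
    using assms X_in_U[OF c_obj] regs_subset[of "St c"] kreg_frame_reg_stage[OF c_obj]
    by (auto simp: set_universe_def)
  fix f c assume f_into: "f \<in> into C c"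
  interpret frame_homomorphism "reg_part (St c)" "reg_part (St (Dom C f))" "res f"
    by (rule frame_homomorphism.frame_homomorphism_reg_part[OF frame_homomorphism_res[OF f_into]])
  show "res f x \<in> carrier (reg_part (St (Dom C f)))" if "x \<in> carrier (reg_part (St c))" for x
    using that by (rule hom_closed)
  show "frame_hom (reg_part (St c)) (reg_part (St (Dom C f)))
      (\<lambda>x\<in>carrier (reg_part (St c)). res f x)"
    using frame_hom by (simp only: L.frame_hom_restrict)
qed (auto dest!: regs_carrier)

lemma concrete_presheaf_reg_psh:
  assumes "internal_kreg C U L" "set_universe U"
  shows "concrete_presheaf C (kreg_frames U) carrier frame_hom (reg_psh C L)"
proof -
  interpret internal_kreg C U L by fact
  show ?thesis
    using reg_psh_Obj[OF assms(2)] by unfold_locales (simp only: kreg_frm_eq)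
qed

lemma reg_nat_Hom:
  assumes "internal_kreg_hom C U L M a" "set_universe U"
  shows "reg_nat C L a M \<in> Hom (kreg_presheaves U C) (reg_psh C L) (reg_psh C M)"
proof -
  interpret internal_kreg_hom C U L M a by fact
  interpret concrete_presheaf_pair C "kreg_frames U" carrier frame_hom
      "reg_psh C L" "reg_psh C M"
    by (intro concrete_presheaf_pair.intro concrete_presheaf_reg_psh assms
        L.internal_kreg_axioms M.internal_kreg_axioms)
  have hom: "frame_homomorphism (reg_part (L.St c)) (reg_part (M.St c)) (a c)" if "c \<in> Obj C" for c
    by (rule frame_homomorphism.frame_homomorphism_reg_part[OF frame_homomorphism_stage[OF that]])
  show ?thesis
    unfolding kreg_frm_eq
  proof (rule mk_nat_Hom)
    fix c assume c_obj: "c \<in> Obj C"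
    interpret frame_homomorphism "reg_part (L.St c)" "reg_part (M.St c)" "a c"
      by (rule hom[OF c_obj])
    show "a c x \<in> carrier (FObj (reg_psh C M) c)" if "x \<in> carrier (FObj (reg_psh C L) c)" for x
      using that hom_closed c_obj by simp
    show "frame_hom (FObj (reg_psh C L) c) (FObj (reg_psh C M) c)
        (\<lambda>x\<in>carrier (FObj (reg_psh C L) c). a c x)"
      using frame_hom c_obj by (simp only: reg_psh_simps L.frame_hom_restrict)
  next
    fix f c x assume f_into: "f \<in> into C c" and "x \<in> carrier (FObj (reg_psh C L) c)"
    then have x_reg: "x \<in> regs (L.St c)" using L.into_obj[OF f_into] by simp
    have "a c x \<in> regs (M.St c)"
      using frame_homomorphism.hom_closed[OF hom[OF L.into_obj[OF f_into]], of x] x_reg by simp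
    then show "a (Dom C f) (underlying (FArr (reg_psh C L) f) x) =
        underlying (FArr (reg_psh C M) f) (a c x)"
      using f_into x_reg regs_carrier[OF x_reg] by (simp add: natural)
  qed
qed

lemma is_functor_reg_fctr:
  assumes U_universe: "set_universe U" and C_cat: "is_category C"
  shows "is_functor (internal_kreg_frm U C) (kreg_presheaves U C) (reg_fctr C)"
    (is "is_functor ?I ?D ?R")
  unfolding is_functor_def
proof (intro conjI ballI impI)
  fix L assume "L \<in> Obj ?I"
  then show "FObj ?R L \<in> Obj ?D"
    using internal_kreg.reg_psh_Obj[of C U L] U_universe
    by (simp add: Obj_internal_kreg_frm[OF C_cat])
  show "FArr ?R (Idt ?I L) = Idt ?D (FObj ?R L)"
    unfolding kreg_frm_eq mk_nat_id by simp
next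
  fix s assume "s \<in> Arr ?I"
  then obtain L a M where s_hom: "internal_kreg_hom C U L M a" "s = kreg_arr C L a M"
    by (metis Arr_internal_kreg_frm[OF C_cat])
  show "FArr ?R s \<in> Hom ?D (FObj ?R (Dom ?I s)) (FObj ?R (Cod ?I s))"
    using reg_nat_Hom[OF s_hom(1) U_universe] by (simp add: s_hom(2))
  fix t assume "t \<in> Arr ?I" "Cod ?I s = Dom ?I t"
  then have "t \<in> Hom ?I M (Cod ?I t)" by (simp add: s_hom(2) Hom_def)
  then obtain b N where t_eq: "t = kreg_arr C M b N" unfolding Hom_internal_kreg_frm[OF C_cat]
    by blast
  have "a c x \<in> carrier (FObj (reg_psh C M) c)" if "c \<in> Obj C" "x \<in> carrier (FObj (reg_psh C L) c)"
    for c x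
    using frame_homomorphism.hom_regs[OF internal_kreg_hom.frame_homomorphism_stage[OF s_hom(1)],
      of c x] that by simp
  then show "FArr ?R (Cmp ?I t s) = Cmp ?D (FArr ?R t) (FArr ?R s)"
    unfolding s_hom(2) t_eq Cmp_internal_kreg_frm[OF s_hom(1)] reg_fctr_simps kreg_frm_eq
    by (simp only: mk_nat_comp)
qed

lemma reg_fctr_faithful:
  assumes C_cat: "is_category C"
    and s_hom: "s \<in> Hom (internal_kreg_frm U C) L M"
      and t_hom: "t \<in> Hom (internal_kreg_frm U C) L M"
    and eq: "FArr (reg_fctr C) s = FArr (reg_fctr C) t"
  shows "s = t"
proof -
  obtain a where a_hom: "internal_kreg_hom C U L M a" "s = kreg_arr C L a M"
    using s_hom by (auto simp: Hom_internal_kreg_frm[OF C_cat])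
  obtain b where b_hom: "internal_kreg_hom C U L M b" "t = kreg_arr C L b M"
    using t_hom by (auto simp: Hom_internal_kreg_frm[OF C_cat])
  have "a c x = b c x" if "c \<in> Obj C" "x \<in> regs (stage L c)" for c x
  proof -
    have "component (reg_nat C L a M) c x = component (reg_nat C L b M) c x"
      using eq by (simp add: a_hom(2) b_hom(2))
    then show ?thesis using that by simp
  qed
  then have "a c x = b c x" if "c \<in> Obj C" "x \<in> FObj (fst L) c" for c x
    using internal_kreg_hom_eq_if_eq_on_regs[OF a_hom(1) b_hom(1)] that by blast
  then show ?thesis unfolding a_hom(2) b_hom(2) by (rule kreg_arr_cong)
qed

lemma reg_fctr_full:
  assumes C_cat: "is_category C" and U_universe: "set_universe U"
    and L_kreg: "internal_kreg C U L" and M_kreg: "internal_kreg C U M"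
    and h_hom: "h \<in> Hom (kreg_presheaves U C) (reg_psh C L) (reg_psh C M)"
  shows "\<exists>s\<in>Hom (internal_kreg_frm U C) L M. FArr (reg_fctr C) s = h"
proof -
  interpret L: internal_kreg C U L by (rule L_kreg)
  interpret M: internal_kreg C U M by (rule M_kreg)
  interpret concrete_presheaf_pair C "kreg_frames U" carrier frame_hom
      "reg_psh C L" "reg_psh C M"
    by (intro concrete_presheaf_pair.intro concrete_presheaf_reg_psh L_kreg M_kreg U_universe)
  note h_comp = h_hom[unfolded kreg_frm_eq]
  have closed: "component h c x \<in> regs (M.St c)" if "c \<in> Obj C" "x \<in> regs (L.St c)" for c x
    using component_funcset[OF h_comp that(1)] that by auto
  have hom: "frame_homomorphism (reg_part (L.St c)) (reg_part (M.St c)) (component h c)"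
    if "c \<in> Obj C" for c
    using component_hom[OF h_comp that] closed that
    by (intro frame_homomorphism.intro frame_homomorphism_axioms.intro frame.frame_reg_part
        L.frame_stage M.frame_stage) simp_all
  have natural: "component h (Dom C f) (L.res f x) = M.res f (component h c x)"
    if "f \<in> into C c" "x \<in> regs (L.St c)" for c f x
    using component_natural[OF h_comp that(1)] closed[OF L.into_obj[OF that(1)]] that
      L.into_obj[OF that(1)] by simp
  obtain a where a_hom: "internal_kreg_hom C U L M a"
    "\<And>c x. c \<in> Obj C \<Longrightarrow> x \<in> regs (L.St c) \<Longrightarrow> a c x = component h c x"
    using internal_kreg_hom_extends_from_regs[OF L_kreg M_kreg hom natural] by blast
  have "reg_nat C L a M = reg_nat C L (component h) M" by (rule mk_nat_cong) (simp add: a_hom(2))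
  also have "\<dots> = h" by (rule mk_nat_component[OF h_comp])
  finally have "FArr (reg_fctr C) (kreg_arr C L a M) = h" by simp
  moreover have "kreg_arr C L a M \<in> Hom (internal_kreg_frm U C) L M"
    using a_hom(1) unfolding Hom_internal_kreg_frm[OF C_cat] by blast
  ultimately show ?thesis by blast
qed

section \<open>Essential surjectivity\<close>

definition small_set :: "'u set set \<Rightarrow> 'b set \<Rightarrow> bool" where
  "small_set U A \<longleftrightarrow> (\<exists>X\<in>U. A \<lesssim> X)"

lemma small_set_lepoll: "A \<lesssim> B \<Longrightarrow> small_set U B \<Longrightarrow> small_set U A"
  using lepoll_trans by (auto simp: small_set_def)

lemma small_set_member: "X \<in> U \<Longrightarrow> small_set U X"
  by (auto simp: small_set_def)

lemma small_set_encoding: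
  assumes "set_universe U" "small_set U A"
  obtains e where "inj_on e A" "e ` A \<in> U"
  using assms by (auto simp: small_set_def lepoll_def set_universe_def)

lemma small_set_Pow:
  assumes "set_universe U" "small_set U A"
  shows "small_set U (Pow A)"
proof -
  obtain e where e_inj: "inj_on e A" "e ` A \<in> U" by (rule small_set_encoding[OF assms])
  then obtain Y where "Y \<in> U" "Y \<approx> Pow (e ` A)" using assms(1) by (auto simp: set_universe_def)
  moreover have "Pow A \<lesssim> Pow (e ` A)"
    using inj_on_image_Pow[OF e_inj(1)] by (auto simp: lepoll_def)
  ultimately show ?thesis unfolding small_set_def by (meson lepoll_trans2 eqpoll_sym)
qed

lemma small_set_Sigma:
  fixes J :: "'b set"
  assumes U_universe: "set_universe U" and J_small: "small_set U J"
    and A_small: "\<And>j. j \<in> J \<Longrightarrow> small_set U (A j)"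
  shows "small_set U (Sigma J A)"
proof -
  obtain e where e_inj: "inj_on e J" "e ` J \<in> U" by (rule small_set_encoding[OF U_universe J_small])
  obtain X where X_U: "\<And>j. j \<in> J \<Longrightarrow> X j \<in> U \<and> A j \<lesssim> X j"
    using A_small unfolding small_set_def by metis
  let ?X = "\<lambda>i. X (inv_into J e i)"
  have "\<forall>i\<in>e ` J. ?X i \<in> U" using X_U e_inj(1) by auto
  then obtain Y where "Y \<in> U" "Y \<approx> Sigma (e ` J) ?X"
    using U_universe[unfolded set_universe_def, THEN conjunct2, THEN conjunct2, THEN bspec,
      OF e_inj(2), THEN spec, of ?X] by blast
  moreover have "Sigma J A \<lesssim> Sigma (e ` J) ?X"
    by (rule Sigma_inj_lepoll_mono[OF e_inj(1)]) (use X_U e_inj(1) in auto)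
  ultimately show ?thesis unfolding small_set_def by (meson lepoll_trans2 eqpoll_sym)
qed

lemma small_set_PiE:
  assumes "set_universe U" "small_set U J" "\<And>j. j \<in> J \<Longrightarrow> small_set U (A j)"
  shows "small_set U (Pi\<^sub>E J A)"
proof -
  let ?graph = "\<lambda>u. (\<lambda>j. (j, u j)) ` J"
  have "inj_on ?graph (Pi\<^sub>E J A)"
  proof (rule inj_onI)
    fix u v assume u_PiE: "u \<in> Pi\<^sub>E J A" and v_PiE: "v \<in> Pi\<^sub>E J A" and eq: "?graph u = ?graph v"
    show "u = v"
    proof (rule PiE_ext[OF u_PiE v_PiE])
      fix j assume "j \<in> J"
      then have "(j, u j) \<in> ?graph v" using eq by blast
      then show "u j = v j" by auto
    qed
  qed
  moreover have "?graph ` Pi\<^sub>E J A \<subseteq> Pow (Sigma J A)" by auto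
  ultimately have "Pi\<^sub>E J A \<lesssim> Pow (Sigma J A)" by (auto simp: lepoll_def)
  then show ?thesis using small_set_Pow[OF assms(1) small_set_Sigma[OF assms]]
    by (rule small_set_lepoll)
qed

lemma small_set_into:
  assumes "small_category U C"
  shows "small_set U (into C c)"
proof -
  obtain X where X_U: "X \<in> U" "X \<approx> Arr C" using assms by (auto simp: small_category_def)
  have "into C c \<lesssim> Arr C" by (intro subset_imp_lepoll) (auto simp: into_def)
  also have "\<dots> \<approx> X" by (rule eqpoll_sym[OF X_U(2)])
  finally show ?thesis using X_U(1) by (auto simp: small_set_def)
qed

context kreg_presheaf
begin

definition shift :: "'a \<Rightarrow> ('a \<Rightarrow> 'u) \<Rightarrow> 'a \<Rightarrow> 'u" where
  "shift f u = (\<lambda>g\<in>into C (Dom C f). u (Cmp C f g))"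

lemma lax_families_extensional: "u \<in> lax_families c \<Longrightarrow> u \<in> extensional (into C c)"
  by (simp add: lax_families_def PiE_def)

lemma shift_lax_families:
  assumes f_into: "f \<in> into C c" and u_lax: "u \<in> lax_families c"
  shows "shift f u \<in> lax_families (Dom C f)"
  unfolding shift_def restrict_lax_families
proof (intro ballI conjI)
  have closed: "u g \<in> carrier (K (Dom C g))"
    and lax: "h \<in> into C (Dom C g) \<Longrightarrow> kr h (u g) \<sqsubseteq>\<^bsub>K (Dom C h)\<^esub> u (Cmp C g h)"
    if "g \<in> into C c" for g h
    using u_lax that by (auto simp: lax_families_def)
  fix g assume g_into: "g \<in> into C (Dom C f)"
  show "u (Cmp C f g) \<in> carrier (K (Dom C g))"
    using closed[OF into_comp[OF f_into g_into]] f_into g_into by simp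
  show "kr h (u (Cmp C f g)) \<sqsubseteq>\<^bsub>K (Dom C h)\<^esub> u (Cmp C f (Cmp C g h))"
    if "h \<in> into C (Dom C g)" for h
    using lax[OF into_comp[OF f_into g_into], of h] f_into g_into that by simp
qed

lemma shift_id: "c \<in> Obj C \<Longrightarrow> u \<in> lax_families c \<Longrightarrow> shift (Idt C c) u = u"
  by (rule extensionalityI[of _ "into C c"]) (simp_all add: shift_def lax_families_extensional)

lemma shift_comp:
  "f \<in> into C c \<Longrightarrow> g \<in> into C (Dom C f) \<Longrightarrow> shift (Cmp C f g) u = shift g (shift f u)"
  by (auto simp: shift_def intro!: restrict_ext)

end

locale small_kreg_presheaf = kreg_presheaf C K kr
  for C :: "('o, 'a) category" and K :: "'o \<Rightarrow> 'u gorder" and kr :: "'a \<Rightarrow> 'u \<Rightarrow> 'u" +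
  fixes U :: "'u set set"
  assumes universe: "set_universe U" and small: "small_category U C"
    and K_in_U: "c \<in> Obj C \<Longrightarrow> carrier (K c) \<in> U"
begin

lemma small_set_lax_families:
  "small_set U (lax_families c)"
proof (rule small_set_lepoll)
  show "lax_families c \<lesssim> (\<Pi>\<^sub>E f\<in>into C c. carrier (K (Dom C f)))"
    by (intro subset_imp_lepoll) (auto simp: lax_families_def)
  show "small_set U (\<Pi>\<^sub>E f\<in>into C c. carrier (K (Dom C f)))"
    by (intro small_set_PiE small_set_into small_set_member universe small K_in_U into_dom)
qed

definition enc :: "'o \<Rightarrow> ('a \<Rightarrow> 'u) \<Rightarrow> 'u" where
  "enc c = (SOME e. inj_on e (lax_families c) \<and> e ` lax_families c \<in> U)"

definition dec :: "'o \<Rightarrow> 'u \<Rightarrow> 'a \<Rightarrow> 'u" where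
  "dec c = inv_into (lax_families c) (enc c)"

abbreviation codes :: "'o \<Rightarrow> 'u set" where
  "codes c \<equiv> enc c ` lax_families c"

lemma inj_enc: "inj_on (enc c) (lax_families c)"
  and codes_in_U: "codes c \<in> U"
proof -
  have "\<exists>e. inj_on e (lax_families c) \<and> e ` lax_families c \<in> U"
    using small_set_encoding[OF universe small_set_lax_families] by metis
  from someI_ex[OF this] show "inj_on (enc c) (lax_families c)" "codes c \<in> U"
    unfolding enc_def[symmetric] by auto
qed

lemma bij_dec: "bij_betw (dec c) (codes c) (lax_families c)"
  unfolding dec_def by (intro bij_betw_inv_into inj_on_imp_bij_betw inj_enc)

lemma dec_enc [simp]: "u \<in> lax_families c \<Longrightarrow> dec c (enc c u) = u"
  by (simp add: dec_def inj_enc)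

lemma dec_lax: "x \<in> codes c \<Longrightarrow> dec c x \<in> lax_families c"
  by (rule bij_betw_apply[OF bij_dec])

definition lax_psh :: "('o, 'a, 'u) presheaf" where
  "lax_psh = mk_presheaf C (\<lambda>A. A) codes (\<lambda>f x. enc (Dom C f) (shift f (dec (Cod C f) x)))"

definition lax_rel :: "'o \<Rightarrow> ('u \<times> 'u) set" where
  "lax_rel c = {(x, y) \<in> codes c \<times> codes c.
     \<forall>f\<in>into C c. dec c x f \<sqsubseteq>\<^bsub>K (Dom C f)\<^esub> dec c y f}"

abbreviation lax_frame :: "('o, 'a, 'u) psh_rel" where
  "lax_frame \<equiv> (lax_psh, lax_rel)"

lemma lax_psh_obj [simp]: "c \<in> Obj C \<Longrightarrow> FObj lax_psh c = codes c"
  by (simp add: lax_psh_def)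

lemma lax_psh_Obj: "lax_psh \<in> Obj (presheaf_topos U C)"
  unfolding presheaf_topos_eq lax_psh_def
  by (rule mk_presheaf_Obj[OF is_category])
    (auto simp: codes_in_U shift_lax_families shift_id shift_comp intoD)

lemma
  assumes f_into: "f \<in> into C c" and x_in: "x \<in> codes c"
  shows lax_psh_res_closed: "psh_restrict lax_psh f x \<in> codes (Dom C f)"
    and dec_res: "dec (Dom C f) (psh_restrict lax_psh f x) = shift f (dec c x)"
proof -
  note shift = shift_lax_families[OF f_into dec_lax[OF x_in]]
  have "psh_restrict lax_psh f x = enc (Dom C f) (shift f (dec (Cod C f) x))"
    using f_into x_in by (simp add: lax_psh_def psh_restrict_eq)
  then have res: "psh_restrict lax_psh f x = enc (Dom C f) (shift f (dec c x))"
    by (simp only: intoD(2)[OF f_into])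
  show "psh_restrict lax_psh f x \<in> codes (Dom C f)" unfolding res by (rule imageI[OF shift])
  show "dec (Dom C f) (psh_restrict lax_psh f x) = shift f (dec c x)" using shift by (simp add: res)
qed

lemma dec_res_id:
  "f \<in> into C c \<Longrightarrow> x \<in> codes c \<Longrightarrow>
    dec (Dom C f) (psh_restrict lax_psh f x) (Idt C (Dom C f)) = dec c x f"
  by (simp add: dec_res shift_def)

lemma psh_relation_lax_frame: "psh_relation C U lax_frame"
proof
  show "fst lax_frame \<in> Obj (presheaf_topos U C)" using lax_psh_Obj by simp
  show "snd lax_frame c \<subseteq> FObj (fst lax_frame) c \<times> FObj (fst lax_frame) c" if "c \<in> Obj C" for c
    using that by (auto simp: lax_rel_def)
  fix f x y assume "f \<in> Arr C" and "(x, y) \<in> snd lax_frame (Cod C f)"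
  then have f_into: "f \<in> into C (Cod C f)" and codes: "x \<in> codes (Cod C f)" "y \<in> codes (Cod C f)"
    and rel: "\<forall>h\<in>into C (Cod C f). dec (Cod C f) x h \<sqsubseteq>\<^bsub>K (Dom C h)\<^esub> dec (Cod C f) y h"
    by (auto simp: lax_rel_def arr_into)
  have "dec (Cod C f) x (Cmp C f g) \<sqsubseteq>\<^bsub>K (Dom C g)\<^esub> dec (Cod C f) y (Cmp C f g)"
    if "g \<in> into C (Dom C f)" for g
    using bspec[OF rel into_comp[OF f_into that]] f_into that by simp
  then show "(psh_restrict (fst lax_frame) f x, psh_restrict (fst lax_frame) f y) \<in>
      snd lax_frame (Dom C f)"
    using lax_psh_res_closed[OF f_into] codes
    by (simp add: lax_rel_def dec_res[OF f_into] shift_def)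
qed

lemma lax_rep_lax_frame: "lax_rep C U lax_frame K kr (\<lambda>c x. dec c x (Idt C c))"
proof (intro lax_rep.intro lax_rep_axioms.intro psh_relation_lax_frame kreg_presheaf_axioms)
  fix c assume c_obj: "c \<in> Obj C"
  have "(\<lambda>f\<in>into C c. dec (Dom C f) (psh_restrict lax_psh f x) (Idt C (Dom C f))) = dec c x"
    if "x \<in> codes c" for x
    by (rule extensionalityI[of _ "into C c"])
      (use that lax_families_extensional[OF dec_lax[OF that]] in \<open>simp_all add: dec_res_id\<close>)
  then show "bij_betw
      (\<lambda>x. \<lambda>f\<in>into C c. dec (Dom C f) (psh_restrict (fst lax_frame) f x) (Idt C (Dom C f)))
      (FObj (fst lax_frame) c) (lax_families c)"
    using bij_betw_cong[of "codes c"
        "\<lambda>x. \<lambda>f\<in>into C c. dec (Dom C f) (psh_restrict lax_psh f x) (Idt C (Dom C f))"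
        "dec c" "lax_families c"] bij_dec[of c] c_obj by simp
  show "(x, y) \<in> snd lax_frame c \<longleftrightarrow>
      (\<forall>f\<in>into C c. dec (Dom C f) (psh_restrict (fst lax_frame) f x) (Idt C (Dom C f))
         \<sqsubseteq>\<^bsub>K (Dom C f)\<^esub> dec (Dom C f) (psh_restrict (fst lax_frame) f y) (Idt C (Dom C f)))"
    if "x \<in> FObj (fst lax_frame) c" "y \<in> FObj (fst lax_frame) c" for x y
    using that c_obj by (simp add: lax_rel_def dec_res_id)
qed

end

context lax_rep
begin

lemma frame_hom_r: "c \<in> Obj C \<Longrightarrow> frame_hom (reg_part (St c)) (K c) (r c)"
  using r_bij r_le_regs
  by (intro order_iso_frame_hom frame.axioms(1) frame.frame_reg_part frame_stage K_frame) auto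

lemma
  assumes U_universe: "set_universe U"
    and F_presheaf: "concrete_presheaf C (kreg_frames U) carrier frame_hom F"
    and FObj: "\<And>c. c \<in> Obj C \<Longrightarrow> FObj F c = K c"
    and FArr: "\<And>f c k. f \<in> into C c \<Longrightarrow> k \<in> carrier (K c) \<Longrightarrow> underlying (FArr F f) k = kr f k"
  shows mk_nat_r_Hom: "mk_nat C carrier (reg_psh C L) r F \<in>
      Hom (kreg_presheaves U C) (reg_psh C L) F" (is "?h \<in> Hom ?D _ _")
    and is_iso_mk_nat_r:
      "is_iso (kreg_presheaves U C) (mk_nat C carrier (reg_psh C L) r F)"
proof -
  interpret concrete_presheaf_pair C "kreg_frames U" carrier frame_hom
      "reg_psh C L" F
    by (intro concrete_presheaf_pair.intro concrete_presheaf_reg_psh F_presheaf U_universe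
      internal_kreg_axioms)
  show hom: "?h \<in> Hom ?D (reg_psh C L) F"
    unfolding kreg_frm_eq
  proof (rule mk_nat_Hom)
    fix c assume c_obj: "c \<in> Obj C"
    show "r c x \<in> carrier (FObj F c)" if "x \<in> carrier (FObj (reg_psh C L) c)" for x
      using that regs_carrier[of x "St c"] c_obj by (simp add: FObj)
    interpret frame "reg_part (St c)" by (rule frame.frame_reg_part[OF frame_stage[OF c_obj]])
    show "frame_hom (FObj (reg_psh C L) c) (FObj F c) (\<lambda>x\<in>carrier (FObj (reg_psh C L) c). r c x)"
      using frame_hom_r[OF c_obj] c_obj by (simp only: reg_psh_simps FObj frame_hom_restrict)
  next
    fix f c x assume "f \<in> into C c" "x \<in> carrier (FObj (reg_psh C L) c)"
    then show "r (Dom C f) (underlying (FArr (reg_psh C L) f) x) = underlying (FArr F f) (r c x)"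
      using regs_carrier[of x "St c"] into_obj[of f c] by (simp add: r_res_regs FArr)
  qed
  show "is_iso ?D ?h"
    unfolding mk_nat_def
  proof (rule is_iso_functor_categoryI[OF is_category_op_cat[OF is_category] is_category_kreg_frm])
    show "(reg_psh C L,
        \<lambda>c\<in>Obj C. (FObj (reg_psh C L) c, \<lambda>x\<in>carrier (FObj (reg_psh C L) c). r c x, FObj F c), F)
        \<in> Arr ?D"
      using HomD(1)[OF hom] by (simp add: mk_nat_def)
    fix c assume "c \<in> Obj (op_cat C)"
    then have c_obj: "c \<in> Obj C" by simp
    have obj: "reg_part (St c) \<in> Obj (kreg_frm U)" "K c \<in> Obj (kreg_frm U)"
      using F.FObj_in[OF c_obj] G.FObj_in[OF c_obj] c_obj by (simp_all add: kreg_frm_eq FObj)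
    have "is_iso (kreg_frm U) (reg_part (St c), \<lambda>x\<in>carrier (reg_part (St c)). r c x, K c)"
      by (rule is_iso_kreg_frmI[OF obj])
        (use r_bij[OF c_obj] r_le_regs[OF c_obj] in \<open>simp_all\<close>)
    then show "is_iso (kreg_frm U) ((\<lambda>c\<in>Obj C. (FObj (reg_psh C L) c,
        \<lambda>x\<in>carrier (FObj (reg_psh C L) c). r c x, FObj F c)) c)"
      using c_obj by (simp add: FObj)
  qed
qed

end

lemma reg_fctr_dense:
  assumes U_universe: "set_universe U" and small: "small_category U C"
    and F_obj: "F \<in> Obj (kreg_presheaves U C)"
  obtains L h where "internal_kreg C U L"
    "h \<in> Hom (kreg_presheaves U C) (reg_psh C L) F"
    "is_iso (kreg_presheaves U C) h"
proof -
  interpret F: concrete_presheaf C "kreg_frames U" carrier frame_hom F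
    using small F_obj by unfold_locales (simp_all only: small_category_def kreg_frm_eq)
  have FObj: "kreg_frame (FObj F c)" "carrier (FObj F c) \<in> U" if "c \<in> Obj C" for c
    using F.FObj_in[OF that] by auto
  have hom: "frame_homomorphism (FObj F c) (FObj F (Dom C f)) (F.act f)" if f_into: "f \<in> into C c"
    for f c
    using F.act_hom[OF f_into] F.act_closed[OF f_into] FObj(1)[OF F.into_obj[OF f_into]]
      FObj(1)[OF F.into_dom[OF f_into]]
    by (intro frame_homomorphism.intro frame_homomorphism_axioms.intro kreg_frame.axioms(1))
  interpret small_kreg_presheaf C "FObj F" F.act U
    by (intro small_kreg_presheaf.intro kreg_presheaf.intro kreg_presheaf_axioms.intro
        small_kreg_presheaf_axioms.intro F.cat_axioms FObj hom F.act_id F.act_comp U_universe small)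
  interpret R: lax_rep C U lax_frame "FObj F" F.act "\<lambda>c x. dec c x (Idt C c)"
    by (rule lax_rep_lax_frame)
  show ?thesis
    using that R.internal_kreg_axioms R.mk_nat_r_Hom[OF U_universe F.concrete_presheaf_axioms]
      R.is_iso_mk_nat_r[OF U_universe F.concrete_presheaf_axioms] by blast
qed

theorem theorem5p1:
  fixes U :: "'u set set" and C :: "('o, 'a) category"
  assumes "set_universe U"
    and "small_category U C"
  shows "equivalent_categories (internal_kreg_frm U C) (functor_category (op_cat C) (kreg_frm U))"
proof -
  have C_cat: "is_category C" using assms(2) by (simp add: small_category_def)
  note Obj = Obj_internal_kreg_frm[OF C_cat]
  interpret fully_faithful_dense_functor "internal_kreg_frm U C"
    "kreg_presheaves U C" "reg_fctr C"
  proof (intro fully_faithful_dense_functor.intro fully_faithful_dense_functor_axioms.intro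
      cat.intro)
    show "\<exists>f\<in>Hom (internal_kreg_frm U C) L M. FArr (reg_fctr C) f = h"
      if "L \<in> Obj (internal_kreg_frm U C)" "M \<in> Obj (internal_kreg_frm U C)"
        "h \<in> Hom (kreg_presheaves U C) (FObj (reg_fctr C) L) (FObj (reg_fctr C) M)"
      for L M h
      using that reg_fctr_full[OF C_cat assms(1)] by (simp add: Obj)
    show "\<exists>L\<in>Obj (internal_kreg_frm U C).
        \<exists>h\<in>Hom (kreg_presheaves U C) (FObj (reg_fctr C) L) F.
          is_iso (kreg_presheaves U C) h"
      if "F \<in> Obj (kreg_presheaves U C)" for F
      using reg_fctr_dense[OF assms that] by (metis Obj reg_fctr_simps(1))
  qed (simp_all add: is_category_internal_kreg_frm is_category_functor_category is_category_op_cat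
      is_category_kreg_frm is_functor_reg_fctr reg_fctr_faithful[OF C_cat] C_cat assms(1))
  show ?thesis by (rule equivalent_categories)
qed

end
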